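(* There exists an infinite class of simple connected 4-regular planar graphs none of which admits a realization as a system of circles.
   Context: A realization of a simple connected 4-regular planar graph $G$ as a system of circles is a finite set of circles in the plane such that, taking as vertices all points at which two of the circles cross or touch, and as edges all circular arcs of these circles between consecutive such points, the resulting plane graph is $G$. *)

theory Defs
  imports "Graph_Theory.Graph_Theory" "HOL-Complex_Analysis.Contour_Integration"
begin

text \<open>A finite simple graph is a \<^const>\<open>pair_graph\<close>, i.e. a finite symmetric loop-free relation;
  its undirected edge \<open>{u, v}\<close> is the pair of opposite arcs \<open>(u, v)\<close> and \<open>(v, u)\<close>.\<close>

definition edge_set :: "'a pair_pre_digraph \<Rightarrow> 'a set set" where
  "edge_set G = {{u, v} | u v. (u, v) \<in> parcs G}"

definition regular_graph :: "nat \<Rightarrow> 'a pair_pre_digraph \<Rightarrow> bool" where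
  "regular_graph k G \<longleftrightarrow> (\<forall>v \<in> pverts G. out_degree (with_proj G) v = k)"

definition planar_drawing ::
    "'a pair_pre_digraph \<Rightarrow> ('a \<Rightarrow> complex) \<Rightarrow> ('a set \<Rightarrow> real \<Rightarrow> complex) \<Rightarrow> bool" where
  "planar_drawing G p \<gamma> \<longleftrightarrow>
     inj_on p (pverts G) \<and>
     (\<forall>e \<in> edge_set G.
        Path_Connected.arc (\<gamma> e) \<and>
        {pathstart (\<gamma> e), pathfinish (\<gamma> e)} = p ` e \<and>
        path_image (\<gamma> e) \<inter> p ` pverts G = p ` e) \<and>
     (\<forall>e \<in> edge_set G. \<forall>e' \<in> edge_set G.
        e \<noteq> e' \<longrightarrow> path_image (\<gamma> e) \<inter> path_image (\<gamma> e') \<subseteq> p ` (e \<inter> e'))"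

definition planar_graph :: "'a pair_pre_digraph \<Rightarrow> bool" where
  "planar_graph G \<longleftrightarrow> (\<exists>p \<gamma>. planar_drawing G p \<gamma>)"

definition circle_system :: "complex set set \<Rightarrow> bool" where
  "circle_system \<C> \<longleftrightarrow> finite \<C> \<and> (\<forall>S \<in> \<C>. \<exists>z r. 0 < r \<and> S = sphere z r)"

text \<open>Two distinct circles either cross or touch at each common point.\<close>

definition contact_points :: "complex set set \<Rightarrow> complex set" where
  "contact_points \<C> = {x. \<exists>S \<in> \<C>. \<exists>T \<in> \<C>. S \<noteq> T \<and> x \<in> S \<and> x \<in> T}"

text \<open>The closed arcs between consecutive contact points of a circle. The case \<open>t = s + 2 * pi\<close> is
  the whole circle, as a loop at its only contact point. Since no interior point of an arc is a
  contact point, the ends of an arc \<open>A\<close> are exactly \<open>A \<inter> contact_points \<C>\<close>.\<close>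

definition contact_arcs :: "complex set set \<Rightarrow> complex set set" where
  "contact_arcs \<C> = {path_image (part_circlepath z r s t) | z r s t.
     0 < r \<and> sphere z r \<in> \<C> \<and> s < t \<and> t \<le> s + 2 * pi \<and>
     pathstart (part_circlepath z r s t) \<in> contact_points \<C> \<and>
     pathfinish (part_circlepath z r s t) \<in> contact_points \<C> \<and>
     (\<forall>x \<in> {0<..<1}. part_circlepath z r s t x \<notin> contact_points \<C>)}"

text \<open>The points and arcs of \<open>\<C>\<close> form a multigraph, possibly with loops; \<open>\<C>\<close> realizes \<open>G\<close> if
  this multigraph is isomorphic to \<open>G\<close>. In particular no two arcs have the same ends.\<close>

definition realizes :: "complex set set \<Rightarrow> 'a pair_pre_digraph \<Rightarrow> bool" where
  "realizes \<C> G \<longleftrightarrow> circle_system \<C> \<and>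
     (\<exists>\<phi> \<psi>. bij_betw \<phi> (pverts G) (contact_points \<C>) \<and>
            bij_betw \<psi> (edge_set G) (contact_arcs \<C>) \<and>
            (\<forall>e \<in> edge_set G. \<psi> e \<inter> contact_points \<C> = \<phi> ` e))"

end

theory Submission
  imports Defs
begin

text \<open>A vertex that carries a pendant octahedron minus an edge merely subdivides an edge: a circle that
  enters the pendant must return through the same vertex, so the other two edges at the vertex lie on
  one circle. In this way double edges (beads) become available. If two beads follow each other,
  joining \<open>u\<close> to \<open>v\<close> and \<open>v\<close> to \<open>w\<close>, then each of them is a circle, since otherwise two circles
  would share \<open>u\<close>, \<open>v\<close> and \<open>w\<close>; hence the remaining two edges at \<open>u\<close> and at \<open>w\<close> continue each
  other. Chains of two tangent circles between points of given strands can thus be prescribed.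

  Let four strands join two poles, and invert with one pole at infinity. The strands become rays on
  two crossing lines, and one of two neighbouring wedges between them has an angle of at least
  \<open>\<pi>/2\<close>. In both of these wedges \<open>N\<close> chains (rungs) join the two rays, and two chains (arches) join
  the first to the last point of each ray. An arch lies in the adjacent wedge, of angle at most
  \<open>\<pi>/2\<close>, since it would otherwise trap the rungs; this bounds the ratio of the distances of its ends
  by 6. Every rung in the wide wedge contains a circle whose radius is at least a quarter of the
  distance of its point on the ray, and at most ten such disjoint circles fit on each ray, so
  \<open>N \<le> 20\<close>.\<close>

section \<open>Circles tangent to two crossing lines\<close>

text \<open>A realization fixes only an abstract isomorphism: neither the cyclic order of the edges
  at a vertex nor the side of a strand on which an arch lies is given, and each vertex a priori
  admits three pairings of its four edges into two circles. Pendants and double edges settle the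
  pairing along beads and strands, but not at the poles. There the rungs settle it, since a rung
  cannot join opposite rays: the middle strand, which carries points of both ladders, must continue
  the bare edge between the poles, and the two outer strands continue each other. That makes the two
  wedges supplementary. The obstacle is scale: the size of a rung is comparable only with its
  distance from the finite pole, so circles growing geometrically along a ray would leave room for
  any number of rungs unless the distances are bounded. The arches supply this bound; 6 is a round
  number above 3 + 2 sqrt 2, which the estimate gives. Between \<open>s\<close> and
  \<open>6 * s\<close> there are ten slots of length \<open>s / 2\<close>, and no slot holds the
  tangency points of two large circles.\<close>

definition axis_line :: "complex \<Rightarrow> complex set" where
  "axis_line v = range (\<lambda>t::real. of_real t * v)"

definition is_circle :: "complex set \<Rightarrow> bool" where
  "is_circle S \<longleftrightarrow> (\<exists>c r. 0 < r \<and> S = sphere c r)"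

text \<open>Multiplication by \<open>cnj v\<close> rotates the line spanned by \<open>v\<close> onto
  the real axis, so the real and imaginary parts of \<open>cnj v * z\<close> are the positions of
  \<open>z\<close> along and across that line.\<close>

lemma norm_sq_coords:
  assumes "norm v = 1"
  shows "(norm z)\<^sup>2 = (Re (cnj v * z))\<^sup>2 + (Im (cnj v * z))\<^sup>2"
proof -
  have "norm (cnj v * z) = norm z" using assms by (simp add: norm_mult)
  then show ?thesis by (metis cmod_power2)
qed

lemma unit_mult_cnj: "norm v = 1 \<Longrightarrow> v * cnj v = 1"
  by (metis complex_norm_square mult.commute of_real_1 one_power2)

lemma coords_decompose:
  assumes "norm v = 1"
  shows "z = v * (cnj v * z)"
  using unit_mult_cnj[OF assms] by (metis mult.assoc mult_1)

lemma mem_axis_line_iff: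
  assumes "norm v = 1"
  shows "z \<in> axis_line v \<longleftrightarrow> Im (cnj v * z) = 0"
proof
  assume "z \<in> axis_line v"
  then obtain t :: real where "z = of_real t * v" by (auto simp: axis_line_def)
  then have "cnj v * z = of_real t * (v * cnj v)" by simp
  then show "Im (cnj v * z) = 0" using unit_mult_cnj[OF assms] by simp
next
  assume "Im (cnj v * z) = 0"
  then have "cnj v * z = of_real (Re (cnj v * z))" by (simp add: complex_eq_iff)
  then have "z = of_real (Re (cnj v * z)) * v"
    using coords_decompose[OF assms, of z] by (simp add: mult.commute)
  then show "z \<in> axis_line v" unfolding axis_line_def by blast
qed

lemma coords_of_real_mult:
  assumes "norm v = 1"
  shows "cnj v * (of_real t * v) = of_real t"
  using unit_mult_cnj[OF assms] by (metis mult.commute mult.left_commute mult.right_neutral)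

lemma dist_axis_point:
  assumes "norm v = 1"
  shows "(dist c (of_real t * v))\<^sup>2 = (Re (cnj v * c) - t)\<^sup>2 + (Im (cnj v * c))\<^sup>2"
  using norm_sq_coords[OF assms, of "c - of_real t * v"] coords_of_real_mult[OF assms, of t]
  by (simp add: dist_norm right_diff_distrib)

text \<open>Reflecting the common point in the foot of the perpendicular from the centre gives
  another common point; by uniqueness the common point is the foot itself.\<close>

lemma sphere_tangent_axis:
  assumes v: "norm v = 1" and r: "0 < r" and S: "sphere c r \<inter> axis_line v = {of_real p * v}"
  shows "Re (cnj v * c) = p" "\<bar>Im (cnj v * c)\<bar> = r"
proof -
  let ?a = "Re (cnj v * c)" and ?b = "Im (cnj v * c)"
  have "of_real p * v \<in> sphere c r" using S by blast
  then have 1: "r\<^sup>2 = (?a - p)\<^sup>2 + ?b\<^sup>2" using dist_axis_point[OF v, of c p] by simp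
  have "(dist c (of_real (2 * ?a - p) * v))\<^sup>2 = r\<^sup>2"
    unfolding dist_axis_point[OF v] 1 by (simp add: power2_eq_square algebra_simps)
  then have "of_real (2 * ?a - p) * v \<in> sphere c r"
    using power2_eq_imp_eq[OF _ zero_le_dist less_imp_le[OF r]] by simp
  then have "of_real (2 * ?a - p) * v = of_real p * v"
    using S unfolding axis_line_def by blast
  then have "2 * ?a - p = p"
    using v by (metis mult_cancel_right norm_zero of_real_eq_iff zero_neq_one)
  then show "?a = p" by simp
  then show "\<bar>?b\<bar> = r" using 1 r by (metis abs_of_pos diff_self power2_abs power2_eq_imp_eq
        abs_ge_zero add_0 less_imp_le zero_power2)
qed

text \<open>If the centre were within \<open>r\<close> of the line, Pythagoras would give a common
  point on the line at distance \<open>sqrt (r\<^sup>2 - b\<^sup>2)\<close> from the foot of the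
  perpendicular, where \<open>b\<close> is the offset of the centre.\<close>

lemma sphere_disjoint_axis:
  assumes v: "norm v = 1" and r: "0 < r" and S: "sphere c r \<inter> axis_line v = {}"
  shows "r < \<bar>Im (cnj v * c)\<bar>"
proof (rule ccontr)
  let ?a = "Re (cnj v * c)" and ?b = "Im (cnj v * c)"
  assume "\<not> ?thesis"
  then have b: "?b\<^sup>2 \<le> r\<^sup>2" using r by (metis abs_le_square_iff abs_of_pos not_less)
  have "(dist c (of_real (?a + sqrt (r\<^sup>2 - ?b\<^sup>2)) * v))\<^sup>2 = r\<^sup>2"
    unfolding dist_axis_point[OF v] using b by simp
  then have "of_real (?a + sqrt (r\<^sup>2 - ?b\<^sup>2)) * v \<in> sphere c r"
    using power2_eq_imp_eq[OF _ zero_le_dist less_imp_le[OF r]] by simp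
  then show False using S unfolding axis_line_def by blast
qed

lemma sphere_Int_singletonD: "sphere c r \<inter> A = {z} \<Longrightarrow> dist c z = r"
  by auto

text \<open>This and \<open>disjoint_axis_cball\<close> certify that of two discs neither contains
  the other: the tangency point of one lies outside the other.\<close>

lemma tangent_axis_cball:
  assumes v: "norm v = 1" and r: "0 < r" and S: "sphere c r \<inter> axis_line v = {of_real p * v}" and "t \<noteq> p"
  shows "of_real t * v \<notin> cball c r"
proof
  assume "of_real t * v \<in> cball c r"
  then have "(dist c (of_real t * v))\<^sup>2 \<le> r\<^sup>2" using r by (simp add: power_mono)
  moreover have "(Im (cnj v * c))\<^sup>2 = r\<^sup>2" using sphere_tangent_axis(2)[OF v r S] by (metis power2_abs)
  ultimately have "(p - t)\<^sup>2 \<le> 0" using dist_axis_point[OF v, of c t] sphere_tangent_axis(1)[OF v r S] by simp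
  then show False using \<open>t \<noteq> p\<close> by simp
qed

lemma disjoint_axis_cball:
  assumes v: "norm v = 1" and r: "0 < r" and S: "sphere c r \<inter> axis_line v = {}"
  shows "of_real t * v \<notin> cball c r"
proof
  assume "of_real t * v \<in> cball c r"
  then have "(dist c (of_real t * v))\<^sup>2 \<le> r\<^sup>2" using r by (simp add: power_mono)
  moreover have "(Im (cnj v * c))\<^sup>2 > r\<^sup>2" using sphere_disjoint_axis[OF v r S] r
    by (metis abs_le_square_iff abs_of_pos not_less)
  ultimately have "(Re (cnj v * c) - t)\<^sup>2 < 0" using dist_axis_point[OF v, of c t] by linarith
  then show False by (simp add: not_less)
qed

section \<open>Disjoint and tangent circles lying outside each other\<close>

text \<open>Along the connected first circle the distance from \<open>c'\<close> takes every value
  between its extremes, so \<open>r'\<close> falls outside that interval. This means one of two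
  nestings, excluded by \<open>x\<close> and \<open>y\<close>, or the conclusion.\<close>

lemma disjoint_spheres_dist:
  fixes c c' :: complex
  assumes r: "0 < r" "0 < r'" and S: "sphere c r \<inter> sphere c' r' = {}"
    and x: "x \<in> cball c r - cball c' r'" and y: "y \<in> cball c' r' - cball c r"
  shows "r + r' < dist c c'"
proof -
  \<comment> \<open>For concentric circles any unit vector will do; otherwise \<open>e\<close>
    points from \<open>c'\<close> towards \<open>c\<close>, so that moving from \<open>c\<close> by
    \<open>r\<close> along \<open>e\<close> or against it gives the extreme distances from
    \<open>c'\<close>.\<close>
  define e :: complex where "e = (if c = c' then 1 else (c - c') / of_real (dist c c'))"
  have e: "norm e = 1" "c - c' = of_real (dist c c') * e"
    by (auto simp: e_def dist_norm norm_divide)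
  have "Topological_Spaces.connected (sphere c r)" by (rule connected_sphere) simp
  then have con: "Topological_Spaces.connected (dist c' ` sphere c r)"
    by (intro connected_continuous_image continuous_intros)
  have far: "dist c' (c + of_real r * e) = dist c c' + r"
  proof -
    have "c + of_real r * e - c' = of_real (dist c c' + r) * e"
      using e(2) by (simp add: algebra_simps)
    then have "norm (c + of_real r * e - c') = \<bar>dist c c' + r\<bar>"
      using e(1) by (metis mult.right_neutral norm_mult norm_of_real)
    then show ?thesis using r by (simp add: dist_commute dist_norm norm_minus_commute)
  qed
  have near: "dist c' (c - of_real r * e) = \<bar>dist c c' - r\<bar>"
  proof -
    have "c - of_real r * e - c' = of_real (dist c c' - r) * e"
      using e(2) by (simp add: algebra_simps)
    then show ?thesis using e(1) by (metis dist_commute dist_norm mult.right_neutral norm_mult norm_of_real)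
  qed
  have in1: "c + of_real r * e \<in> sphere c r" and in2: "c - of_real r * e \<in> sphere c r"
    using e(1) r by (auto simp: dist_norm norm_mult)
  have "r' \<notin> dist c' ` sphere c r" using S by auto
  then have "\<not> (\<bar>dist c c' - r\<bar> \<le> r' \<and> r' \<le> dist c c' + r)"
    using con in1 in2 far near unfolding connected_iff_interval by (metis image_eqI)
  moreover have "\<not> dist c c' + r < r'"
  proof
    assume "dist c c' + r < r'"
    moreover have "dist c' x \<le> dist c c' + dist c x" by (metis dist_triangle2 dist_commute)
    ultimately show False using x by auto
  qed
  moreover have "\<not> dist c c' + r' < r"
  proof
    assume "dist c c' + r' < r"
    moreover have "dist c y \<le> dist c c' + dist c' y" by (rule dist_triangle)
    ultimately show False using y by auto
  qed
  ultimately show ?thesis by linarith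
qed

text \<open>Reflection in the line of centres preserves both circles, hence fixes their only common
  point, which therefore lies on that line. If its parameter \<open>a\<close> is negative or exceeds
  1, one disc is inside the other, which \<open>x\<close> and \<open>y\<close> exclude.\<close>

lemma tangent_spheres_dist:
  fixes c c' :: complex
  assumes r: "0 < r" "0 < r'" and S: "sphere c r \<inter> sphere c' r' = {z}"
    and x: "x \<in> cball c r - cball c' r'" and y: "y \<in> cball c' r' - cball c r"
  shows "dist c c' = r + r'"
proof -
  have z: "dist c z = r" "dist c' z = r'" using S by auto
  have "c \<noteq> c'" using x y z by auto
  define d where "d = c' - c"
  have d: "d \<noteq> 0" "norm d = dist c c'" using \<open>c \<noteq> c'\<close> by (auto simp: d_def dist_norm norm_minus_commute)
  define a where "a = (z - c) / d"
  have za: "z = c + a * d" using d by (simp add: a_def)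
  define z' where "z' = c + cnj a * d"
  have eq1: "dist c z' = r"
    using z(1) by (simp add: za z'_def dist_norm norm_mult)
  have "z' - c' = (cnj a - 1) * d" "z - c' = (a - 1) * d"
    by (simp_all add: z'_def za d_def algebra_simps)
  then have eq2: "dist c' z' = norm (cnj a - 1) * norm d" "dist c' z = norm (a - 1) * norm d"
    by (metis dist_commute dist_norm norm_mult)+
  note eq2(1)
  also have "norm (cnj a - 1) = norm (a - 1)" by (metis complex_cnj_diff complex_cnj_one complex_mod_cnj)
  also have "norm (a - 1) * norm d = dist c' z"
    using eq2(2) by simp
  finally have "z' \<in> sphere c r \<inter> sphere c' r'" using eq1 z by simp
  then have "z' = z" using S by simp
  then have "Im a = 0" using d(1) by (simp add: z'_def za) (metis Im_complex_of_real complex_cnj_cancel_iff complex_is_Real_iff Reals_cnj_iff)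
  then have a: "a = of_real (Re a)" by (simp add: complex_eq_iff)
  have 1: "r = \<bar>Re a\<bar> * dist c c'"
    using z(1) a d by (metis (no_types, lifting) za add_diff_cancel_left' dist_commute dist_norm norm_mult norm_of_real)
  have "z - c' = of_real (Re a - 1) * d" using a by (simp add: za d_def algebra_simps)
  then have 2: "r' = \<bar>Re a - 1\<bar> * dist c c'"
    using z(2) d by (metis dist_commute dist_norm norm_mult norm_of_real)
  have pos: "0 < dist c c'" using \<open>c \<noteq> c'\<close> by simp
  have "\<not> Re a < 0"
  proof
    assume "Re a < 0"
    then have "r' = r + dist c c'" using 1 2 by (simp add: algebra_simps)
    moreover have "dist c' x \<le> dist c c' + dist c x" by (metis dist_triangle2 dist_commute)
    ultimately show False using x by auto
  qed
  moreover have "\<not> Re a > 1"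
  proof
    assume "Re a > 1"
    then have "r = r' + dist c c'" using 1 2 by (simp add: algebra_simps)
    moreover have "dist c y \<le> dist c c' + dist c' y" by (rule dist_triangle)
    ultimately show False using y by auto
  qed
  ultimately show ?thesis using 1 2 by (simp add: algebra_simps)
qed

section \<open>Circles in a wedge with a right or obtuse angle\<close>

text \<open>\<open>e\<close> is the orientation of the pair of \<open>u\<close> and
  \<open>w\<close>. With this parameter the locale is stable under exchanging the rays, which turns
  \<open>e\<close> into \<open>- e\<close>, so that everything proved for \<open>u\<close> is
  available for \<open>w\<close>.\<close>

locale obtuse_wedge =
  fixes u w :: complex and e :: real
  assumes u: "norm u = 1" and w: "norm w = 1" and e: "e * e = 1"
    and side: "0 < e * Im (cnj u * w)" and obtuse: "Re (cnj u * w) \<le> 0"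
begin

text \<open>\<open>X\<close>, \<open>Y\<close> are coordinates along and across \<open>u\<close>,
  and \<open>X'\<close>, \<open>Y'\<close> those for \<open>w\<close>; the signs make
  \<open>Y\<close> and \<open>Y'\<close> positive towards the other ray.\<close>

definition X :: "complex \<Rightarrow> real" where "X z = Re (cnj u * z)"
definition Y :: "complex \<Rightarrow> real" where "Y z = e * Im (cnj u * z)"
definition X' :: "complex \<Rightarrow> real" where "X' z = Re (cnj w * z)"
definition Y' :: "complex \<Rightarrow> real" where "Y' z = - e * Im (cnj w * z)"
text \<open>Minus the cosine, and then the sine, of the wedge angle; that the angle is right or
  obtuse reads \<open>0 \<le> \<kappa>\<close>.\<close>

definition \<kappa> :: real where "\<kappa> = - Re (cnj u * w)"
definition \<tau> :: real where "\<tau> = e * Im (cnj u * w)"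

lemma kappa_tau: "0 \<le> \<kappa>" "0 < \<tau>" "\<kappa>\<^sup>2 + \<tau>\<^sup>2 = 1" "\<kappa> \<le> 1" "\<tau> \<le> 1"
proof -
  show 1: "0 \<le> \<kappa>" and 2: "0 < \<tau>" using obtuse side by (auto simp: \<kappa>_def \<tau>_def)
  have "\<kappa>\<^sup>2 + \<tau>\<^sup>2 = (Re (cnj u * w))\<^sup>2 + e * e * (Im (cnj u * w))\<^sup>2"
    by (simp add: \<kappa>_def \<tau>_def power2_eq_square algebra_simps)
  also have "\<dots> = (norm w)\<^sup>2" using norm_sq_coords[OF u, of w] e by simp
  finally show 3: "\<kappa>\<^sup>2 + \<tau>\<^sup>2 = 1" using w by simp
  have "\<kappa>\<^sup>2 \<le> 1\<^sup>2" using 3 zero_le_power2[of \<tau>] unfolding one_power2 by linarith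
  moreover have "\<tau>\<^sup>2 \<le> 1\<^sup>2" using 3 zero_le_power2[of \<kappa>] unfolding one_power2 by linarith
  ultimately show "\<kappa> \<le> 1" "\<tau> \<le> 1" using 1 2 by (auto intro: power2_le_imp_le)
qed

lemma abs_mult_e: "\<bar>e * x\<bar> = \<bar>x\<bar>"
  using e by (metis abs_mult abs_mult_self_eq abs_1 mult_1 abs_mult_pos abs_ge_zero square_eq_1_iff abs_minus)

lemma dist_sq: "(dist z z')\<^sup>2 = (X z - X z')\<^sup>2 + (Y z - Y z')\<^sup>2"
proof -
  have "(Y z - Y z')\<^sup>2 = (e * e) * (Im (cnj u * (z - z')))\<^sup>2"
    by (simp add: Y_def power2_eq_square algebra_simps)
  moreover have "(X z - X z')\<^sup>2 = (Re (cnj u * (z - z')))\<^sup>2"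
    by (simp add: X_def right_diff_distrib)
  ultimately show ?thesis using norm_sq_coords[OF u, of "z - z'"] e by (simp add: dist_norm)
qed

text \<open>The two coordinate systems are exchanged by the reflection in the bisector of the wedge.
  Being an involution, it has the same formulas in both directions.\<close>

lemma change_coords:
  "X' z = - \<kappa> * X z + \<tau> * Y z" "Y' z = \<kappa> * Y z + \<tau> * X z"
  "X z = - \<kappa> * X' z + \<tau> * Y' z" "Y z = \<kappa> * Y' z + \<tau> * X' z"
proof -
  have "cnj w * z = cnj (cnj u * w) * (cnj u * z)"
    using unit_mult_cnj[OF u] by (simp add: algebra_simps)
  then have *: "Re (cnj w * z) = Re (cnj (cnj u * w) * (cnj u * z))"
    "Im (cnj w * z) = Im (cnj (cnj u * w) * (cnj u * z))" by metis+
  have R: "Re (cnj (a::complex) * b) = Re a * Re b + Im a * Im b" "Im (cnj a * b) = Re a * Im b - Im a * Re b"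
    for a b by (simp_all add: algebra_simps)
  have 1: "X' z = Re (cnj u * w) * X z + (e * e) * Im (cnj u * w) * Im (cnj u * z)"
    unfolding X'_def * R(1)[of "cnj u * w"] X_def e by simp
  then show X': "X' z = - \<kappa> * X z + \<tau> * Y z" unfolding \<kappa>_def \<tau>_def Y_def by (simp add: algebra_simps)
  have "Y' z = - e * (Re (cnj u * w) * Im (cnj u * z) - Im (cnj u * w) * X z)"
    unfolding Y'_def * R(2)[of "cnj u * w"] X_def by simp
  then show Y': "Y' z = \<kappa> * Y z + \<tau> * X z" unfolding \<kappa>_def \<tau>_def Y_def by (simp add: algebra_simps)
  have "- \<kappa> * X' z + \<tau> * Y' z = (\<kappa>\<^sup>2 + \<tau>\<^sup>2) * X z" "\<kappa> * Y' z + \<tau> * X' z = (\<kappa>\<^sup>2 + \<tau>\<^sup>2) * Y z"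
    unfolding X' Y' by (simp_all add: power2_eq_square algebra_simps)
  then show "X z = - \<kappa> * X' z + \<tau> * Y' z" "Y z = \<kappa> * Y' z + \<tau> * X' z"
    using kappa_tau(3) by auto
qed

lemma coords_axis:
  "X (of_real t * u) = t" "Y (of_real t * u) = 0" "X' (of_real t * w) = t" "Y' (of_real t * w) = 0"
  "X (of_real t * w) = - \<kappa> * t" "Y (of_real t * w) = \<tau> * t"
  "X' (of_real t * u) = - \<kappa> * t" "Y' (of_real t * u) = \<tau> * t"
proof -
  show 1: "X (of_real t * u) = t" "Y (of_real t * u) = 0" "X' (of_real t * w) = t" "Y' (of_real t * w) = 0"
    unfolding X_def Y_def X'_def Y'_def coords_of_real_mult[OF u] coords_of_real_mult[OF w] by simp_all
  show "X (of_real t * w) = - \<kappa> * t" "Y (of_real t * w) = \<tau> * t"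
    unfolding change_coords(3,4)[of "of_real t * w"] 1 by simp_all
  show "X' (of_real t * u) = - \<kappa> * t" "Y' (of_real t * u) = \<tau> * t"
    unfolding change_coords(1,2)[of "of_real t * u"] 1 by simp_all
qed

lemma abs_Y_diff_le: "\<bar>Y z - Y z'\<bar> \<le> dist z z'"
proof -
  have "(Y z - Y z')\<^sup>2 \<le> (dist z z')\<^sup>2" unfolding dist_sq by simp
  then show ?thesis by (metis abs_le_square_iff abs_of_nonneg zero_le_dist)
qed

lemma continuous_coords: "continuous_on A X" "continuous_on A Y"
  unfolding X_def Y_def by (intro continuous_intros)+

lemma swapped: "obtuse_wedge w u (- e)"
proof
  have "cnj w * u = cnj (cnj u * w)" by simp
  then show "0 < - e * Im (cnj w * u)" "Re (cnj w * u) \<le> 0"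
    using side obtuse by (simp_all add: algebra_simps)
qed (use u w e in \<open>auto dest: sphere_Int_singletonD\<close>)

lemma swapped_X: "obtuse_wedge.X w = X'" 
  by (rule ext) (simp add: obtuse_wedge.X_def[OF swapped] X'_def)

lemma swapped_Y: "obtuse_wedge.Y w (- e) = Y'" 
  by (rule ext) (simp add: obtuse_wedge.Y_def[OF swapped] Y'_def)

text \<open>A disc whose circle misses the line lies on one side of it, and a single point tells on
  which.\<close>

lemma disjoint_axis_side:
  assumes r: "0 < r" and S: "sphere c r \<inter> axis_line u = {}" and z: "z \<in> cball c r" "0 < Y z"
  shows "r < Y c"
proof -
  have "r < \<bar>Y c\<bar>" unfolding Y_def abs_mult_e by (rule sphere_disjoint_axis[OF u r S])
  moreover have "\<bar>Y c - Y z\<bar> \<le> r" using abs_Y_diff_le[of c z] z(1) by simp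
  ultimately show ?thesis using z(2) by linarith
qed

lemma tangent_axis_coords:
  assumes r: "0 < r" and S: "sphere c r \<inter> axis_line u = {of_real p * u}"
  shows "X c = p" "Y c = r \<or> Y c = - r"
proof -
  show "X c = p" unfolding X_def by (rule sphere_tangent_axis[OF u r S])
  have "\<bar>Y c\<bar> = r" unfolding Y_def abs_mult_e by (rule sphere_tangent_axis[OF u r S])
  then show "Y c = r \<or> Y c = - r" by linarith
qed

end

definition rung :: "complex \<Rightarrow> complex \<Rightarrow> real \<Rightarrow> real \<Rightarrow> complex set \<Rightarrow> complex set \<Rightarrow> bool" where
  "rung u w p q S T \<longleftrightarrow> is_circle S \<and> is_circle T \<and>
     S \<inter> axis_line u = {of_real p * u} \<and> S \<inter> axis_line w = {} \<and>
     T \<inter> axis_line w = {of_real q * w} \<and> T \<inter> axis_line u = {} \<and> (\<exists>x. S \<inter> T = {x})"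

text \<open>The side of the line \<open>u\<close> is left open: whether the arch lies in the wedge
  or outside it has to come out of the geometry.\<close>

definition arch :: "complex \<Rightarrow> complex \<Rightarrow> real \<Rightarrow> real \<Rightarrow> complex set \<Rightarrow> complex set \<Rightarrow> bool" where
  "arch u w s t S T \<longleftrightarrow> is_circle S \<and> is_circle T \<and>
     S \<inter> axis_line u = {of_real s * u} \<and> S \<inter> axis_line w = {} \<and>
     T \<inter> axis_line u = {of_real t * u} \<and> T \<inter> axis_line w = {} \<and> (\<exists>x. S \<inter> T = {x})"

lemma rung_swap: "rung u w p q S T \<Longrightarrow> rung w u q p T S"
  by (auto simp: rung_def Int_commute)

context obtuse_wedge
begin

text \<open>The second circle misses the line \<open>u\<close> and contains a point of the ray
  \<open>w\<close>, so it lies above the line \<open>u\<close>. The contact point is then above as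
  well and forces the first circle to be there. Exchanging the rays puts both circles into the
  wedge.\<close>

lemma rung_coords:
  assumes R: "rung u w p q (sphere c r) (sphere c' r')" and r: "0 < r" "0 < r'" and pq: "0 < p" "0 < q"
  shows "X c = p" "Y c = r" "X' c' = q" "Y' c' = r'" "dist c c' = r + r'" "r' < Y c'"
proof -
  interpret s: obtuse_wedge w u "- e" by (rule swapped)
  from R obtain x where S: "sphere c r \<inter> axis_line u = {of_real p * u}" "sphere c r \<inter> axis_line w = {}"
    "sphere c' r' \<inter> axis_line w = {of_real q * w}" "sphere c' r' \<inter> axis_line u = {}"
    and x: "sphere c r \<inter> sphere c' r' = {x}" by (auto simp: rung_def)
  have t1: "r' < Y c'"
    by (rule disjoint_axis_side[OF r(2) S(4), of "of_real q * w"]) (use S(3) pq kappa_tau in \<open>auto simp: coords_axis dest: sphere_Int_singletonD\<close>)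
  have t2: "r < Y' c"
    by (rule s.disjoint_axis_side[OF r(1) S(2), of "of_real p * u", unfolded swapped_Y])
      (use S(1) pq kappa_tau in \<open>auto simp: coords_axis dest: sphere_Int_singletonD\<close>)
  have xx: "dist c x = r" "dist c' x = r'" using x by auto
  show "r' < Y c'" by (rule t1)
  show "X c = p" by (rule tangent_axis_coords[OF r(1) S(1)])
  show "X' c' = q" using s.tangent_axis_coords(1)[OF r(2) S(3)] by (simp add: swapped_X)
  have "Y x > 0" using abs_Y_diff_le[of c' x] xx t1 by linarith
  then show "Y c = r" using tangent_axis_coords(2)[OF r(1) S(1)] abs_Y_diff_le[of c x] xx r by linarith
  have "Y' x > 0" using s.abs_Y_diff_le[of c x] xx t2 by (simp add: swapped_Y)
  then show "Y' c' = r'" using s.tangent_axis_coords(2)[OF r(2) S(3)] s.abs_Y_diff_le[of c' x] xx r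
    by (simp add: swapped_Y) linarith
  show "dist c c' = r + r'"
    by (rule tangent_spheres_dist[OF r x, of "of_real p * u" "of_real q * w"])
      (use S disjoint_axis_cball[OF u r(2) S(4)] disjoint_axis_cball[OF w r(1) S(2)] in \<open>auto dest: sphere_Int_singletonD\<close>)
qed

text \<open>The tangency condition expands to the identity \<open>eq\<close>. If both radii were
  below a quarter, its right side would be at most 5/4 of \<open>p * q\<close>, while the left side
  is at least \<open>2 * (p * q)\<close> because \<kappa> is nonnegative.\<close>

lemma rung_radius:
  assumes R: "rung u w p q (sphere c r) (sphere c' r')" and r: "0 < r" "0 < r'" and pq: "0 < p" "0 < q"
  shows "p / 4 \<le> r \<or> q / 4 \<le> r'"
proof (rule ccontr)
  assume "\<not> ?thesis"
  then have lt: "r < p / 4" "r' < q / 4" by auto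
  note k = kappa_tau
  note C = rung_coords[OF R r pq]
  have "(p + \<kappa> * q - \<tau> * r')\<^sup>2 + (r - \<kappa> * r' - \<tau> * q)\<^sup>2 = (r + r')\<^sup>2"
    using dist_sq[of c c'] C change_coords(3,4)[of c'] by (simp add: algebra_simps)
  moreover have "(p + \<kappa> * q - \<tau> * r')\<^sup>2 + (r - \<kappa> * r' - \<tau> * q)\<^sup>2 =
      p\<^sup>2 + r\<^sup>2 + (\<kappa>\<^sup>2 + \<tau>\<^sup>2) * (q\<^sup>2 + r'\<^sup>2) + 2 * \<kappa> * (p * q) - 2 * \<tau> * (p * r' + q * r) - 2 * \<kappa> * (r * r')"
    by (simp add: power2_eq_square algebra_simps)
  ultimately have eq: "p\<^sup>2 + q\<^sup>2 + 2 * (\<kappa> * (p * q)) = 2 * (\<tau> * (p * r' + q * r)) + 2 * ((1 + \<kappa>) * (r * r'))"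
    unfolding k(3) by (simp add: power2_eq_square algebra_simps)
  have "p * r' \<le> p * q / 4" "q * r \<le> p * q / 4" 
    using lt pq mult_left_mono[of r' "q/4" p] mult_left_mono[of r "p/4" q] by (auto simp: mult.commute)
  then have b: "p * r' + q * r \<le> p * q / 2" by simp
  have "\<tau> * (p * r' + q * r) \<le> 1 * (p * q / 2)"
    by (rule mult_mono) (use k b r pq in \<open>auto dest: sphere_Int_singletonD\<close>)
  moreover have "r * r' \<le> (p / 4) * (q / 4)" by (rule mult_mono) (use lt r pq in \<open>auto dest: sphere_Int_singletonD\<close>)
  then have "(1 + \<kappa>) * (r * r') \<le> 2 * (p * q / 16)" by (intro mult_mono) (use k r in \<open>auto dest: sphere_Int_singletonD\<close>)
  moreover have "0 \<le> \<kappa> * (p * q)" using k pq by simp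
  moreover have "2 * (p * q) \<le> p\<^sup>2 + q\<^sup>2" using zero_le_power2[of "p - q"] by (simp add: power2_eq_square algebra_simps)
  moreover have "0 < p * q" using pq by simp
  ultimately show False using eq by linarith
qed


text \<open>On opposite sides of the line \<open>u\<close> the centres would differ by
  \<open>r + r'\<close> in height alone, which is their whole distance and leaves no room for
  \<open>s < t\<close>; hence both circles are on the same side.\<close>

lemma arch_coords:
  assumes A: "arch u w s t (sphere c r) (sphere c' r')" and r: "0 < r" "0 < r'" and st: "0 < s" "s < t"
  shows "X c = s" "X c' = t" "dist c c' = r + r'" "Y c = r \<and> Y c' = r' \<or> Y c = - r \<and> Y c' = - r'"
    "r < Y' c" "r' < Y' c'"
proof -
  interpret s: obtuse_wedge w u "- e" by (rule swapped)
  from A obtain x where S: "sphere c r \<inter> axis_line u = {of_real s * u}" "sphere c r \<inter> axis_line w = {}"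
    "sphere c' r' \<inter> axis_line u = {of_real t * u}" "sphere c' r' \<inter> axis_line w = {}"
    and x: "sphere c r \<inter> sphere c' r' = {x}" by (auto simp: arch_def)
  have xx: "dist c x = r" "dist c' x = r'" using x by auto
  show "r < Y' c"
    by (rule s.disjoint_axis_side[OF r(1) S(2), of "of_real s * u", unfolded swapped_Y])
      (use S(1) st kappa_tau in \<open>auto simp: coords_axis dest: sphere_Int_singletonD\<close>)
  show "r' < Y' c'"
    by (rule s.disjoint_axis_side[OF r(2) S(4), of "of_real t * u", unfolded swapped_Y])
      (use S(3) st kappa_tau in \<open>auto simp: coords_axis dest: sphere_Int_singletonD\<close>)
  show X: "X c = s" "X c' = t" using tangent_axis_coords(1) r S by blast+
  show d: "dist c c' = r + r'"
    by (rule tangent_spheres_dist[OF r x, of "of_real s * u" "of_real t * u"])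
      (use S st tangent_axis_cball[OF u r(2) S(3), of s] tangent_axis_cball[OF u r(1) S(1), of t] in \<open>auto dest: sphere_Int_singletonD\<close>)
  have "(r + r')\<^sup>2 = (s - t)\<^sup>2 + (Y c - Y c')\<^sup>2" using dist_sq[of c c'] d X by simp
  moreover have "0 < (s - t)\<^sup>2" using st by simp
  ultimately have "(Y c - Y c')\<^sup>2 < (r + r')\<^sup>2" by linarith
  then have "Y c - Y c' \<noteq> r + r'" "Y c - Y c' \<noteq> - (r + r')" by (metis less_irrefl power2_minus)+
  then show "Y c = r \<and> Y c' = r' \<or> Y c = - r \<and> Y c' = - r'"
    using tangent_axis_coords(2)[OF r(1) S(1)] tangent_axis_coords(2)[OF r(2) S(3)] by auto
qed

text \<open>On this side the angle between the lines is at most a right angle, so a circle that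
  touches \<open>u\<close> at distance \<open>s\<close> and misses the line \<open>w\<close> has
  radius below \<open>s\<close>. Then \<open>(t - s)\<^sup>2 = 4 * r * r' < 4 * s * t\<close>, that
  is, \<open>t\<^sup>2 - 6 * s * t + s\<^sup>2 < 0\<close>.\<close>

lemma arch_ratio:
  assumes A: "arch u w s t (sphere c r) (sphere c' r')" and r: "0 < r" "0 < r'" and st: "0 < s" "s < t"
    and below: "Y c = - r" "Y c' = - r'"
  shows "t < 6 * s"
proof (rule ccontr)
  assume "\<not> t < 6 * s"
  note C = arch_coords[OF A r st]
  have "r < \<tau> * s" using C(1,5) below change_coords(2)[of c] mult_nonneg_nonneg[OF kappa_tau(1), of r] r by simp
  then have "r < s" using mult_right_mono[OF kappa_tau(5), of s] st by linarith
  have "r' < \<tau> * t" using C(2,6) below change_coords(2)[of c'] mult_nonneg_nonneg[OF kappa_tau(1), of r'] r by simp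
  then have "r' < t" using mult_right_mono[OF kappa_tau(5), of t] st by linarith
  have "(r + r')\<^sup>2 = (s - t)\<^sup>2 + (r' - r)\<^sup>2" using dist_sq[of c c'] C below by simp
  then have "(s - t)\<^sup>2 = 4 * (r * r')" by (simp add: power2_eq_square algebra_simps)
  also have "\<dots> < 4 * (s * t)" using \<open>r < s\<close> \<open>r' < t\<close> r mult_strict_mono[of r s r' t] by simp
  finally have "t * (t - 6 * s) + s * s < 0" by (simp add: power2_eq_square algebra_simps)
  moreover have "0 \<le> t * (t - 6 * s)" "0 < s * s" using \<open>\<not> t < 6 * s\<close> st by simp_all
  ultimately show False by linarith
qed

text \<open>An arch on the side of \<open>w\<close> would trap every rung below it: the trapezoid spanned by the two
  centres and the two points of tangency is bounded by the discs of the arch and the line.\<close>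

lemma arch_below:
  assumes A: "arch u w s t (sphere c1 r1) (sphere c2 r2)" and r: "0 < r1" "0 < r2" and st: "0 < s" "s < p" "p < t"
    and R: "rung u w p q (sphere c r) (sphere c' r')" and rr: "0 < r" "0 < r'" and q: "0 < q"
    and dis: "sphere c1 r1 \<inter> sphere c r = {}" "sphere c2 r2 \<inter> sphere c r = {}"
      "sphere c1 r1 \<inter> sphere c' r' = {}" "sphere c2 r2 \<inter> sphere c' r' = {}"
  shows "Y c1 = - r1" "Y c2 = - r2"
proof -
  have st': "0 < s" "s < t" "0 < p" using st by auto
  note C = arch_coords[OF A r st'(1,2)]
  note D = rung_coords[OF R rr st'(3) q]
  have False if up: "Y c1 = r1" "Y c2 = r2"
  proof -
    from A have SA: "sphere c1 r1 \<inter> axis_line u = {of_real s * u}" "sphere c1 r1 \<inter> axis_line w = {}"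
      "sphere c2 r2 \<inter> axis_line u = {of_real t * u}" "sphere c2 r2 \<inter> axis_line w = {}" by (auto simp: arch_def)
    from R obtain x where SR: "sphere c r \<inter> axis_line u = {of_real p * u}" "sphere c r \<inter> axis_line w = {}"
      "sphere c' r' \<inter> axis_line w = {of_real q * w}" "sphere c' r' \<inter> axis_line u = {}"
      and x: "sphere c r \<inter> sphere c' r' = {x}" by (auto simp: rung_def)
    have far1: "r1 + r < dist c1 c"
      by (rule disjoint_spheres_dist[OF r(1) rr(1) dis(1), of "of_real s * u" "of_real p * u"])
        (use SA SR st tangent_axis_cball[OF u r(1) SA(1), of p] tangent_axis_cball[OF u rr(1) SR(1), of s] in \<open>auto dest: sphere_Int_singletonD\<close>)
    have far2: "r2 + r < dist c2 c"
      by (rule disjoint_spheres_dist[OF r(2) rr(1) dis(2), of "of_real t * u" "of_real p * u"])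
        (use SA SR st tangent_axis_cball[OF u r(2) SA(3), of p] tangent_axis_cball[OF u rr(1) SR(1), of t] in \<open>auto dest: sphere_Int_singletonD\<close>)
    have far3: "r1 + r' < dist c1 c'"
      by (rule disjoint_spheres_dist[OF r(1) rr(2) dis(3), of "of_real s * u" "of_real q * w"])
        (use SA SR disjoint_axis_cball[OF u rr(2) SR(4), of s] disjoint_axis_cball[OF w r(1) SA(2), of q] in \<open>auto dest: sphere_Int_singletonD\<close>)
    have far4: "r2 + r' < dist c2 c'"
      by (rule disjoint_spheres_dist[OF r(2) rr(2) dis(4), of "of_real t * u" "of_real q * w"])
        (use SA SR disjoint_axis_cball[OF u rr(2) SR(4), of t] disjoint_axis_cball[OF w r(2) SA(4), of q] in \<open>auto dest: sphere_Int_singletonD\<close>)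
    \<comment> \<open>A connected stand-in for the rung. The first disc is taken open because its
      closure touches the line \<open>u\<close>; the contact point \<open>x\<close> joins it to the
      second disc.\<close>
    define K where "K = (ball c r \<union> {x}) \<union> cball c' r'"
    have "Topological_Spaces.connected (ball c r \<union> {x})"
      by (rule connected_intermediate_closure[of "ball c r"]) (use x rr in \<open>auto dest: sphere_Int_singletonD\<close>)
    then have conK: "Topological_Spaces.connected K" unfolding K_def by (rule connected_Un) (use x in \<open>auto dest: sphere_Int_singletonD\<close>)
    have K: "0 < Y z" "r1 < dist c1 z" "r2 < dist c2 z" if "z \<in> K" for z
    proof -
      have "dist c' z \<le> r' \<or> dist c z < r" using that x by (auto simp: K_def)
      then show "0 < Y z" using D(2,6) abs_Y_diff_le[of c z] abs_Y_diff_le[of c' z] by linarith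
      show "r1 < dist c1 z" "r2 < dist c2 z" 
        using \<open>dist c' z \<le> r' \<or> dist c z < r\<close> far1 far2 far3 far4 
          dist_triangle2[of c1 c z] dist_triangle2[of c1 c' z] dist_triangle2[of c2 c z] dist_triangle2[of c2 c' z]
        by linarith+
    qed
    \<comment> \<open>\<open>top z < 0\<close> says that \<open>z\<close> is below the line through
      the two centres. The vertical sides of the trapezoid are radii of the two discs, and its lower
      side is on the line \<open>u\<close>, above which \<open>K\<close> lies.\<close>
    define top where "top z = (Y z - r1) * (t - s) - (r2 - r1) * (X z - s)" for z
    define T where "T = {z. s < X z} \<inter> {z. X z < t} \<inter> {z. top z < 0}"
    define U where "U = {z. X z < s} \<union> {z. t < X z} \<union> {z. 0 < top z}"
    have cont: "continuous_on UNIV X" "continuous_on UNIV top"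
      unfolding top_def by (intro continuous_intros continuous_coords)+
    have op: "open T" "open U"
      unfolding T_def U_def by (intro open_Int open_Un open_Collect_less continuous_on_const cont)+
    have cover: "K \<subseteq> T \<union> U"
    proof
      fix z assume z: "z \<in> K"
      show "z \<in> T \<union> U"
      proof (rule ccontr)
        assume not: "z \<notin> T \<union> U"
        then have b: "s \<le> X z" "X z \<le> t" "top z \<le> 0" by (auto simp: U_def)
        have 1: "(dist c1 z)\<^sup>2 = (X z - s)\<^sup>2 + (Y z - r1)\<^sup>2" "(dist c2 z)\<^sup>2 = (X z - t)\<^sup>2 + (Y z - r2)\<^sup>2"
          using dist_sq[of c1 z] dist_sq[of c2 z] C up by (simp_all add: power2_commute)
        have 2: "r1\<^sup>2 < (X z - s)\<^sup>2 + (Y z - r1)\<^sup>2" "r2\<^sup>2 < (X z - t)\<^sup>2 + (Y z - r2)\<^sup>2"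
          unfolding 1[symmetric] using K[OF z] r by (simp_all add: power_strict_mono)
        consider "X z = s" | "X z = t" | "top z = 0" using not b by (force simp: T_def)
        then show False
        proof cases
          case 1
          then have "Y z \<le> r1" using b(3) st' by (simp add: top_def mult_le_0_iff)
          then have "\<bar>Y z - r1\<bar> \<le> r1" using K(1)[OF z] by linarith
          then have "(Y z - r1)\<^sup>2 \<le> r1\<^sup>2" using r by (metis abs_le_square_iff abs_of_pos)
          then show False using 2(1) 1 by simp
        next
          case 2
          then have "top z = (Y z - r2) * (t - s)" by (simp add: top_def algebra_simps)
          then have "Y z \<le> r2" using b(3) st' by (simp add: mult_le_0_iff)
          then have "\<bar>Y z - r2\<bar> \<le> r2" using K(1)[OF z] by linarith
          then have "(Y z - r2)\<^sup>2 \<le> r2\<^sup>2" using r by (metis abs_le_square_iff abs_of_pos)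
          then show False using \<open>r2\<^sup>2 < (X z - t)\<^sup>2 + (Y z - r2)\<^sup>2\<close> 2 by simp
        next
          case 3
          \<comment> \<open>The position of \<open>z\<close> on the segment between the centres.
            This segment has length \<open>r1 + r2\<close> and is covered by the two discs.\<close>
          define l where "l = (X z - s) / (t - s)"
          have l: "0 \<le> l" "l \<le> 1" using b st' by (auto simp: l_def)
          have Xz: "X z - s = l * (t - s)" "X z - t = - ((1 - l) * (t - s))" using st' by (simp_all add: l_def field_simps)
          have "(Y z - r1) * (t - s) = (l * (r2 - r1)) * (t - s)" using 3 unfolding top_def Xz(1) by (simp add: algebra_simps)
          then have Yz: "Y z - r1 = l * (r2 - r1)" using st' by simp
          then have Yz': "Y z - r2 = - ((1 - l) * (r2 - r1))" by (simp add: algebra_simps)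
          have L: "(t - s)\<^sup>2 + (r2 - r1)\<^sup>2 = (r1 + r2)\<^sup>2" using dist_sq[of c1 c2] C up by (simp add: power2_commute)
          have "(dist c1 z)\<^sup>2 = (l * (r1 + r2))\<^sup>2" "(dist c2 z)\<^sup>2 = ((1 - l) * (r1 + r2))\<^sup>2"
            unfolding 1 Xz Yz Yz' power2_minus power_mult_distrib L[symmetric] by (simp_all add: algebra_simps)
          then have "dist c1 z = l * (r1 + r2)" "dist c2 z = (1 - l) * (r1 + r2)" using l r by auto
          then have "dist c1 z + dist c2 z = r1 + r2" by (simp add: algebra_simps)
          then show False using K[OF z] by linarith
        qed
      qed
    qed
    have "of_real q * w \<in> K" using SR by (auto simp: K_def)
    \<comment> \<open>Here the angle enters: a point of the ray \<open>w\<close> has abscissa at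
      most 0, hence lies to the left of the trapezoid.\<close>
    moreover have "- \<kappa> * q < s" using mult_nonneg_nonneg[OF kappa_tau(1), of q] q st by linarith
    then have "of_real q * w \<in> U" by (simp add: U_def coords_axis)
    moreover
    \<comment> \<open>For a point just above the tangency point of the rung:
      \<open>\<epsilon> \<le> r\<close> keeps it in the first disc, and
      \<open>\<epsilon> < r1\<close>, \<open>\<epsilon> < r2\<close> keep it below the line of
      centres.\<close>
    define \<epsilon> where "\<epsilon> = min r (min r1 r2 / 2)"
    define z where "z = u * Complex p (e * \<epsilon>)"
    have "cnj u * z = Complex p (e * \<epsilon>)" unfolding z_def using unit_mult_cnj[OF u] by (metis mult.assoc mult.commute mult_1)
    then have z: "X z = p" "Y z = \<epsilon>" using e by (simp_all add: X_def Y_def flip: mult.assoc)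
    have eps: "0 < \<epsilon>" "\<epsilon> \<le> r" "\<epsilon> < r1" "\<epsilon> < r2" using r rr by (auto simp: \<epsilon>_def min_def)
    have "z \<in> T"
    proof -
      have "top z = (\<epsilon> - r1) * (t - p) + (\<epsilon> - r2) * (p - s)" by (simp add: top_def z algebra_simps)
      moreover have "(\<epsilon> - r1) * (t - p) < 0" "(\<epsilon> - r2) * (p - s) < 0" using eps st by (simp_all add: mult_neg_pos)
      ultimately show ?thesis using st by (simp add: T_def z)
    qed
    moreover have "z \<in> K"
    proof -
      have "(dist c z)\<^sup>2 = (r - \<epsilon>)\<^sup>2" using dist_sq[of c z] D z by simp
      then have "dist c z = r - \<epsilon>" using eps by auto
      then show ?thesis using eps by (simp add: K_def)
    qed
    moreover have "T \<inter> U \<inter> K = {}" by (auto simp: T_def U_def)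
    ultimately show False using connectedD[OF conK op _ cover] by blast
  qed
  then show "Y c1 = - r1" "Y c2 = - r2" using C(4) by auto
qed

text \<open>For two circles outside each other that touch a line from the same side, the squared
  distance of the tangency points exceeds four times the product of the radii. Radii of at least
  \<open>s / 4\<close> thus keep these points more than \<open>s / 2\<close> apart.\<close>

lemma few_large_rungs:
  assumes A: "arch u w s t E E'" and s: "0 < s"
    and R: "\<And>k. k \<in> J \<Longrightarrow> rung u w (p k) (q k) (sphere (c k) (r k)) (sphere (c' k) (r' k))"
    and pos: "\<And>k. k \<in> J \<Longrightarrow> 0 < r k" "\<And>k. k \<in> J \<Longrightarrow> 0 < r' k" "\<And>k. k \<in> J \<Longrightarrow> 0 < q k"
    and between: "\<And>k. k \<in> J \<Longrightarrow> s < p k" "\<And>k. k \<in> J \<Longrightarrow> p k < t"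
    and dis: "\<And>k. k \<in> J \<Longrightarrow> (E \<union> E') \<inter> (sphere (c k) (r k) \<union> sphere (c' k) (r' k)) = {}"
    and sep: "\<And>j k. j \<in> J \<Longrightarrow> k \<in> J \<Longrightarrow> j \<noteq> k \<Longrightarrow> sphere (c j) (r j) \<inter> sphere (c k) (r k) = {}"
    and large: "\<And>k. k \<in> J \<Longrightarrow> p k / 4 \<le> r k"
  shows "card J \<le> 10"
proof (cases "J = {}")
  case False
  then obtain k0 where k0: "k0 \<in> J" by blast
  from A obtain c1 r1 c2 r2 where E: "E = sphere c1 r1" "0 < r1" "E' = sphere c2 r2" "0 < r2"
    by (auto simp: arch_def is_circle_def)
  have st: "s < t" using between[OF k0] by linarith
  have t6: "t < 6 * s"
    by (rule arch_ratio[OF A[unfolded E] E(2,4) s st]; 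
        rule arch_below[OF A[unfolded E] E(2,4) s between[OF k0] R[OF k0] pos[OF k0]];
        use dis[OF k0] E in blast)
  \<comment> \<open>The index of the slot of length \<open>s / 2\<close>, counted from
    \<open>s\<close>, that contains the tangency point.\<close>
  define m where "m k = nat \<lfloor>2 * (p k - s) / s\<rfloor>" for k
  have "inj_on m J"
  proof (rule inj_onI, rule ccontr)
    fix j k assume jk: "j \<in> J" "k \<in> J" "m j = m k" "j \<noteq> k"
    have P: "0 < p j" "0 < p k" using between jk s by (metis less_trans)+
    note Cj = rung_coords[OF R[OF jk(1)] pos(1,2)[OF jk(1)] P(1) pos(3)[OF jk(1)]]
    note Ck = rung_coords[OF R[OF jk(2)] pos(1,2)[OF jk(2)] P(2) pos(3)[OF jk(2)]]
    have Sj: "sphere (c j) (r j) \<inter> axis_line u = {of_real (p j) * u}"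
      and Sk: "sphere (c k) (r k) \<inter> axis_line u = {of_real (p k) * u}"
      using R[OF jk(1)] R[OF jk(2)] by (auto simp: rung_def)
    have "u \<noteq> 0" using u by auto
    have "p j \<noteq> p k" using Sj Sk sep[OF jk(1,2,4)] by (metis IntI Int_iff empty_iff singletonI)
    then have "r j + r k < dist (c j) (c k)"
      by (intro disjoint_spheres_dist[OF pos(1)[OF jk(1)] pos(1)[OF jk(2)] sep[OF jk(1,2,4)], of "of_real (p j) * u" "of_real (p k) * u"])
        (use Sj Sk tangent_axis_cball[OF u pos(1)[OF jk(1)] Sj, of "p k"] tangent_axis_cball[OF u pos(1)[OF jk(2)] Sk, of "p j"] in \<open>auto dest: sphere_Int_singletonD\<close>)
    then have "(r j + r k)\<^sup>2 < (p j - p k)\<^sup>2 + (r j - r k)\<^sup>2"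
      using dist_sq[of "c j" "c k"] Cj Ck pos(1) jk by (metis add_pos_pos less_eq_real_def power_strict_mono zero_less_numeral)
    then have "4 * (r j * r k) < (p j - p k)\<^sup>2" by (simp add: power2_eq_square algebra_simps)
    moreover have "(s / 4) * (s / 4) \<le> r j * r k"
      by (rule mult_mono) (use large[OF jk(1)] large[OF jk(2)] between[OF jk(1)] between[OF jk(2)] s P pos(1)[OF jk(1)] in \<open>auto dest: sphere_Int_singletonD\<close>)
    ultimately have "(s / 2)\<^sup>2 < (p j - p k)\<^sup>2" by (simp add: power2_eq_square)
    then have "s / 2 < \<bar>p j - p k\<bar>" using s by (metis abs_le_square_iff abs_of_pos half_gt_zero not_less)
    then have far: "1 < \<bar>2 * (p j - s) / s - 2 * (p k - s) / s\<bar>"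
      using s by (simp add: abs_if field_simps split: if_splits)
    have "0 \<le> 2 * (p j - s) / s" "0 \<le> 2 * (p k - s) / s" using between jk s by (auto simp: less_imp_le)
    then have "\<lfloor>2 * (p j - s) / s\<rfloor> = \<lfloor>2 * (p k - s) / s\<rfloor>"
      using jk(3) unfolding m_def by (metis nat_eq_iff2 zero_le_floor nat_0_le)
    then show False using far by linarith
  qed
  moreover have "m ` J \<subseteq> {..<10}"
  proof
    fix y assume "y \<in> m ` J"
    then obtain k where k: "k \<in> J" "y = m k" by blast
    have "2 * (p k - s) / s < 10" using between[OF k(1)] t6 s by (simp add: field_simps)
    then have "\<lfloor>2 * (p k - s) / s\<rfloor> < 10" by linarith
    then have "m k < 10" unfolding m_def by linarith
    then show "y \<in> {..<10}" using k by simp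
  qed
  ultimately show ?thesis by (metis card_image card_lessThan card_mono finite_lessThan)
qed simp

end

lemma no_long_ladder:
  fixes N :: nat
  assumes u: "norm u = 1" and w: "norm w = 1" and ind: "Im (cnj u * w) \<noteq> 0" and obt: "Re (cnj u * w) \<le> 0"
    and R: "\<And>k. k \<in> {1..N} \<Longrightarrow> rung u w (p k) (q k) (S k) (T k)"
    and A: "arch u w s t E E'" "0 < s" "\<And>k. k \<in> {1..N} \<Longrightarrow> s < p k" "\<And>k. k \<in> {1..N} \<Longrightarrow> p k < t"
    and B: "arch w u s' t' F F'" "0 < s'" "\<And>k. k \<in> {1..N} \<Longrightarrow> s' < q k" "\<And>k. k \<in> {1..N} \<Longrightarrow> q k < t'"
    and dis: "\<And>k. k \<in> {1..N} \<Longrightarrow> (E \<union> E' \<union> F \<union> F') \<inter> (S k \<union> T k) = {}"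
    and sep: "\<And>j k. j \<in> {1..N} \<Longrightarrow> k \<in> {1..N} \<Longrightarrow> j \<noteq> k \<Longrightarrow> S j \<inter> S k = {} \<and> T j \<inter> T k = {}"
  shows "N \<le> 20"
proof -
  define e where "e = sgn (Im (cnj u * w))"
  interpret obtuse_wedge u w e
    by standard (use u w ind obt in \<open>auto simp: e_def sgn_if\<close>)
  interpret s: obtuse_wedge w u "- e" by (rule swapped)
  have "\<forall>k. \<exists>c r c' r'. k \<in> {1..N} \<longrightarrow> 0 < r \<and> 0 < r' \<and> S k = sphere c r \<and> T k = sphere c' r'"
    using R unfolding rung_def is_circle_def by metis
  then obtain c r c' r' where C: "\<And>k. k \<in> {1..N} \<Longrightarrow> 0 < r k \<and> 0 < r' k \<and> S k = sphere (c k) (r k) \<and> T k = sphere (c' k) (r' k)"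
    by metis
  define J where "J = {k \<in> {1..N}. p k / 4 \<le> r k}"
  define J' where "J' = {k \<in> {1..N}. q k / 4 \<le> r' k}"
  have pq: "0 < p k" "0 < q k" if "k \<in> {1..N}" for k using A(2,3) B(2,3) that by (meson less_trans)+
  have "{1..N} \<subseteq> J \<union> J'"
  proof
    fix k assume k: "k \<in> {1..N}"
    show "k \<in> J \<union> J'" using rung_radius[of "p k" "q k" "c k" "r k" "c' k" "r' k"] R[OF k] C[OF k] pq[OF k] k
      by (auto simp: J_def J'_def)
  qed
  moreover have "J \<subseteq> {1..N}" "J' \<subseteq> {1..N}" by (auto simp: J_def J'_def)
  then have "finite J" "finite J'" by (auto intro: finite_subset)
  ultimately have "card {1..N} \<le> card (J \<union> J')" by (intro card_mono finite_UnI)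
  also have "\<dots> \<le> card J + card J'" by (rule card_Un_le)
  also have "card J \<le> 10"
  proof (rule few_large_rungs[OF A(1,2), of J p q c r c' r'])
    fix k assume "k \<in> J"
    then have k: "k \<in> {1..N}" "p k / 4 \<le> r k" by (auto simp: J_def)
    show "rung u w (p k) (q k) (sphere (c k) (r k)) (sphere (c' k) (r' k))" using R[OF k(1)] C[OF k(1)] by simp
    show "(E \<union> E') \<inter> (sphere (c k) (r k) \<union> sphere (c' k) (r' k)) = {}" using dis[OF k(1)] C[OF k(1)] by blast
    show "0 < r k" "0 < r' k" "0 < q k" "s < p k" "p k < t" "p k / 4 \<le> r k" using C[OF k(1)] pq[OF k(1)] A k by auto
  next
    fix j k assume "j \<in> J" "k \<in> J" "j \<noteq> k"
    then have jk: "j \<in> {1..N}" "k \<in> {1..N}" "j \<noteq> k" by (auto simp: J_def)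
    then show "sphere (c j) (r j) \<inter> sphere (c k) (r k) = {}" using sep C by metis
  qed
  also have "card J' \<le> 10"
  proof (rule s.few_large_rungs[OF B(1,2), of J' q p c' r' c r])
    fix k assume "k \<in> J'"
    then have k: "k \<in> {1..N}" "q k / 4 \<le> r' k" by (auto simp: J'_def)
    show "rung w u (q k) (p k) (sphere (c' k) (r' k)) (sphere (c k) (r k))" 
      using rung_swap[OF R[OF k(1)]] C[OF k(1)] by simp
    show "(F \<union> F') \<inter> (sphere (c' k) (r' k) \<union> sphere (c k) (r k)) = {}" using dis[OF k(1)] C[OF k(1)] by blast
    show "0 < r k" "0 < r' k" "0 < p k" "s' < q k" "q k < t'" "q k / 4 \<le> r' k" using C[OF k(1)] pq[OF k(1)] B k by auto
  next
    fix j k assume "j \<in> J'" "k \<in> J'" "j \<noteq> k"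
    then have jk: "j \<in> {1..N}" "k \<in> {1..N}" "j \<noteq> k" by (auto simp: J'_def)
    then show "sphere (c' j) (r' j) \<inter> sphere (c' k) (r' k) = {}" using sep C by metis
  qed
  finally show ?thesis by simp
qed

section \<open>Inversion\<close>

text \<open>The Moebius map sending \<open>d'\<close> to infinity and \<open>d\<close> to 0, an
  inversion followed by a reflection. At \<open>d'\<close> division by zero gives a meaningless
  value, so it is used on sets avoiding \<open>d'\<close>.\<close>

definition invert :: "complex \<Rightarrow> complex \<Rightarrow> complex \<Rightarrow> complex" where
  "invert d d' z = 1 / (z - d') - 1 / (d - d')"

lemma invert_self [simp]: "invert d d' d = 0"
  by (simp add: invert_def)

lemma inj_on_invert: "inj_on (invert d d') (- {d'})"
  by (auto simp: inj_on_def invert_def)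

lemma continuous_on_invert: "d' \<notin> A \<Longrightarrow> continuous_on A (invert d d')"
  unfolding invert_def by (intro continuous_intros) auto

lemma invert_image_iff:
  assumes "d' \<notin> A"
  shows "y \<in> invert d d' ` A \<longleftrightarrow>
    y + 1 / (d - d') \<noteq> 0 \<and> d' + 1 / (y + 1 / (d - d')) \<in> A"
proof
  assume "y \<in> invert d d' ` A"
  then obtain z where z: "z \<in> A" "y + 1 / (d - d') = 1 / (z - d')" by (auto simp: invert_def)
  moreover have "z \<noteq> d'" using z assms by auto
  ultimately show "y + 1 / (d - d') \<noteq> 0 \<and> d' + 1 / (y + 1 / (d - d')) \<in> A" by simp
next
  assume "y + 1 / (d - d') \<noteq> 0 \<and> d' + 1 / (y + 1 / (d - d')) \<in> A"
  moreover have "invert d d' (d' + 1 / (y + 1 / (d - d'))) = y" by (simp add: invert_def)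
  ultimately show "y \<in> invert d d' ` A" by (metis imageI)
qed

text \<open>The coefficient of \<open>(norm y)\<^sup>2\<close> is the power of \<open>d\<close> with
  respect to the circle. It decides whether the image is a circle or, when it vanishes, a
  line.\<close>

lemma inverse_mem_sphere_iff:
  fixes y c d :: complex
  assumes "y \<noteq> 0" "0 < r"
  shows "d + 1 / y \<in> sphere c r \<longleftrightarrow>
    1 - 2 * Re ((c - d) * y) + ((norm (c - d))\<^sup>2 - r\<^sup>2) * (norm y)\<^sup>2 = 0"
proof -
  define m where "m = c - d"
  have "d + 1 / y - c = (1 - m * y) / y" using assms by (simp add: m_def field_simps)
  then have "dist c (d + 1 / y) = norm (1 - m * y) / norm y"
    by (metis dist_commute dist_norm norm_divide)
  then have "d + 1 / y \<in> sphere c r \<longleftrightarrow> norm (1 - m * y) / norm y = r"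
    by (simp only: mem_sphere)
  also have "\<dots> \<longleftrightarrow> norm (1 - m * y) = r * norm y" using assms by (simp add: divide_eq_eq)
  also have "\<dots> \<longleftrightarrow> (norm (1 - m * y))\<^sup>2 = (r * norm y)\<^sup>2"
    using assms by (metis abs_norm_cancel abs_of_pos mult_nonneg_nonneg norm_ge_zero power2_eq_imp_eq less_imp_le)
  also have "(norm (1 - m * y))\<^sup>2 = 1 - 2 * Re (m * y) + (norm m)\<^sup>2 * (norm y)\<^sup>2"
  proof -
    have "(norm (1 - a))\<^sup>2 = 1 - 2 * Re a + (norm a)\<^sup>2" for a :: complex
      unfolding cmod_power2 by (simp add: power2_eq_square algebra_simps)
    then show ?thesis by (simp add: norm_mult power_mult_distrib)
  qed
  finally show ?thesis by (simp add: m_def power_mult_distrib algebra_simps)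
qed

lemma invert_circle:
  assumes "is_circle S" "d' \<notin> S"
  shows "is_circle (invert d d' ` S)"
proof -
  from assms obtain c r where S: "S = sphere c r" "0 < r" by (auto simp: is_circle_def)
  define m where "m = c - d'"
  define K where "K = (norm m)\<^sup>2 - r\<^sup>2"
  have K0: "K \<noteq> 0"
  proof
    assume "K = 0"
    then have "norm m = r" using S by (simp add: K_def)
    then show False using assms(2) S by (simp add: m_def dist_norm)
  qed
  \<comment> \<open>Multiplying the equation by \<open>K\<close> completes the square.\<close>
  have key: "1 - 2 * Re (m * y) + K * (norm y)\<^sup>2 = 0 \<longleftrightarrow> y \<in> sphere (cnj m / of_real K) (r / \<bar>K\<bar>)" for y
  proof -
    have "(norm (of_real K * y - cnj m))\<^sup>2 = K\<^sup>2 * (norm y)\<^sup>2 - 2 * K * Re (m * y) + (norm m)\<^sup>2"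
      unfolding cmod_power2 by (simp add: power2_eq_square algebra_simps)
    then have "(norm (of_real K * y - cnj m))\<^sup>2 - r\<^sup>2 = K * (1 - 2 * Re (m * y) + K * (norm y)\<^sup>2)"
      by (simp add: K_def power2_eq_square algebra_simps)
    then have "1 - 2 * Re (m * y) + K * (norm y)\<^sup>2 = 0 \<longleftrightarrow> (norm (of_real K * y - cnj m))\<^sup>2 = r\<^sup>2"
      using K0 by (metis eq_iff_diff_eq_0 mult_eq_0_iff)
    also have "\<dots> \<longleftrightarrow> norm (of_real K * y - cnj m) = r"
      using S(2) by (metis norm_ge_zero power2_eq_imp_eq less_imp_le)
    also have "of_real K * y - cnj m = of_real K * (y - cnj m / of_real K)" using K0 by (simp add: field_simps)
    also have "norm (of_real K * (y - cnj m / of_real K)) = r \<longleftrightarrow> y \<in> sphere (cnj m / of_real K) (r / \<bar>K\<bar>)"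
      unfolding norm_mult norm_of_real mem_sphere dist_norm norm_minus_commute[of y] using K0
      by (simp add: eq_divide_eq mult.commute)
    finally show ?thesis .
  qed
  have nz: "y \<noteq> 0" if "y \<in> sphere (cnj m / of_real K) (r / \<bar>K\<bar>)" for y using key[of y] that by auto
  have "invert d d' ` S = sphere (cnj m / of_real K - 1 / (d - d')) (r / \<bar>K\<bar>)"
  proof (rule set_eqI)
    fix y
    let ?y = "y + 1 / (d - d')"
    have "y \<in> invert d d' ` S \<longleftrightarrow> ?y \<noteq> 0 \<and> d' + 1 / ?y \<in> sphere c r"
      using invert_image_iff[OF assms(2), of y d] unfolding S(1) .
    also have "\<dots> \<longleftrightarrow> ?y \<noteq> 0 \<and> ?y \<in> sphere (cnj m / of_real K) (r / \<bar>K\<bar>)"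
      using inverse_mem_sphere_iff[OF _ S(2), of ?y d' c] key[of ?y] by (auto simp: m_def K_def)
    also have "\<dots> \<longleftrightarrow> ?y \<in> sphere (cnj m / of_real K) (r / \<bar>K\<bar>)" using nz by blast
    also have "\<dots> \<longleftrightarrow> y \<in> sphere (cnj m / of_real K - 1 / (d - d')) (r / \<bar>K\<bar>)"
      by (simp add: dist_norm algebra_simps)
    finally show "y \<in> invert d d' ` S \<longleftrightarrow> y \<in> sphere (cnj m / of_real K - 1 / (d - d')) (r / \<bar>K\<bar>)" .
  qed
  then show ?thesis using S K0 unfolding is_circle_def by (metis zero_less_abs_iff zero_less_divide_iff)
qed

lemma invert_circle_to_line:
  assumes "is_circle S" "d \<in> S" "d' \<in> S" "d \<noteq> d'"
  obtains v where "norm v = 1" "invert d d' ` (S - {d'}) = axis_line v"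
proof -
  from assms obtain c r where S: "S = sphere c r" "0 < r" by (auto simp: is_circle_def)
  define m where "m = c - d'"
  have m: "norm m = r" using assms S by (auto simp: m_def dist_norm)
  \<comment> \<open>The image line has an equation \<open>Re (m * y) = const\<close>, hence the
    normal \<open>cnj m\<close>; \<open>v\<close> is this normal, scaled and turned by a right
    angle.\<close>
  define v where "v = \<i> * cnj m / of_real r"
  have v: "norm v = 1" using m S by (simp add: v_def norm_mult norm_divide)
  let ?w = "1 / (d - d')"
  have "d' + 1 / ?w \<in> sphere c r" using assms S by simp
  then have w: "2 * Re (m * ?w) = 1"
    using inverse_mem_sphere_iff[of ?w r d' c] assms S m by (simp add: m_def)
  have "invert d d' ` (S - {d'}) = axis_line v"
  proof (rule set_eqI)
    fix y
    let ?y = "y + ?w"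
    have "y \<in> invert d d' ` (S - {d'}) \<longleftrightarrow> ?y \<noteq> 0 \<and> d' + 1 / ?y \<in> sphere c r"
      by (subst invert_image_iff) (auto simp: S)
    also have "\<dots> \<longleftrightarrow> ?y \<noteq> 0 \<and> 2 * Re (m * ?y) = 1"
      using inverse_mem_sphere_iff[OF _ S(2), of ?y d' c] m by (auto simp: m_def)
    also have "\<dots> \<longleftrightarrow> 2 * Re (m * ?y) = 1" by (metis mult_zero_right zero_complex.sel(1) zero_neq_one)
    also have "\<dots> \<longleftrightarrow> Re (m * y) = 0" using w by (simp add: distrib_left)
    also have "\<dots> \<longleftrightarrow> Im (cnj v * y) = 0"
    proof -
      have "cnj v * y = - \<i> * (m * y) / of_real r" by (simp add: v_def)
      then have "Im (cnj v * y) = - Re (m * y) / r" by (simp add: Im_divide_of_real diff_divide_distrib)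
      moreover have "- Re (m * y) / r = 0 \<longleftrightarrow> Re (m * y) = 0" using S by (simp del: times_complex.simps)
      ultimately show ?thesis by metis
    qed
    also have "\<dots> \<longleftrightarrow> y \<in> axis_line v" using mem_axis_line_iff[OF v] by simp
    finally show "y \<in> invert d d' ` (S - {d'}) \<longleftrightarrow> y \<in> axis_line v" .
  qed
  then show ?thesis using that v by blast
qed

text \<open>Common points of circles with different centres lie on the radical axis. In the
  coordinate along it, measured from \<open>x\<close>, the first circle becomes a quadratic equation
  with root 0, so only one further common point is possible.\<close>

lemma circle_eq_if_three_common:
  assumes S: "is_circle S" "is_circle T" and x: "x \<in> S \<inter> T" and y: "y \<in> S \<inter> T" and z: "z \<in> S \<inter> T"
    and ne: "x \<noteq> y" "x \<noteq> z" "y \<noteq> z"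
  shows "S = T"
proof -
  from S obtain c r c' r' where ST: "S = sphere c r" "T = sphere c' r'" by (auto simp: is_circle_def)
  have sq: "(Re p - Re c)\<^sup>2 + (Im p - Im c)\<^sup>2 = r\<^sup>2" "(Re p - Re c')\<^sup>2 + (Im p - Im c')\<^sup>2 = r'\<^sup>2"
    if "p \<in> S \<inter> T" for p
    using that by (auto simp: ST dist_norm norm_minus_commute simp flip: cmod_power2 minus_complex.simps)
  have "c = c'"
  proof (rule ccontr)
    assume cc: "c \<noteq> c'"
    define dx dy where "dx = Re c' - Re c" and "dy = Im c' - Im c"
    have d: "dx \<noteq> 0 \<or> dy \<noteq> 0" using cc by (auto simp: dx_def dy_def complex_eq_iff)
    define N where "N = dx\<^sup>2 + dy\<^sup>2"
    have N: "N > 0" using d by (auto simp: N_def sum_power2_gt_zero_iff)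
    have par: "\<exists>a. Re p = Re x - a * dy \<and> Im p = Im x + a * dx \<and> (a = 0 \<or> a * N = 2 * ((Re x - Re c) * dy - (Im x - Im c) * dx))"
      if p: "p \<in> S \<inter> T" for p
    proof -
      let ?a = "((Im p - Im x) * dx - (Re p - Re x) * dy) / N"
      have 1: "(Re p - Re x) * dx + (Im p - Im x) * dy = 0"
        using sq[OF p] sq[OF x] by (simp add: dx_def dy_def power2_eq_square algebra_simps)
      have "(Re p - Re x + ?a * dy) * N = dx * ((Re p - Re x) * dx + (Im p - Im x) * dy)"
        "(Im p - Im x - ?a * dx) * N = dy * ((Re p - Re x) * dx + (Im p - Im x) * dy)"
        using N by (simp_all add: field_simps) (simp_all add: N_def power2_eq_square algebra_simps)
      then have 2: "Re p = Re x - ?a * dy" "Im p = Im x + ?a * dx" using 1 N by simp_all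
      have "?a * (?a * N - 2 * ((Re x - Re c) * dy - (Im x - Im c) * dx)) = 0"
      proof -
        obtain b where b: "?a = b" by simp
        have "(Re x - b * dy - Re c)\<^sup>2 + (Im x + b * dx - Im c)\<^sup>2 = r\<^sup>2" using sq(1)[OF p] 2 unfolding b by simp
        then have "b * (b * N - 2 * ((Re x - Re c) * dy - (Im x - Im c) * dx)) = 0"
          using sq(1)[OF x] by (simp add: N_def power2_eq_square algebra_simps)
        then show ?thesis unfolding b .
      qed
      then show ?thesis using 2 by (intro exI[of _ ?a]) auto
    qed
    from par[OF y] par[OF z] obtain a b where
      a: "Re y = Re x - a * dy" "Im y = Im x + a * dx" "a = 0 \<or> a * N = 2 * ((Re x - Re c) * dy - (Im x - Im c) * dx)"
      and b: "Re z = Re x - b * dy" "Im z = Im x + b * dx" "b = 0 \<or> b * N = 2 * ((Re x - Re c) * dy - (Im x - Im c) * dx)"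
      by blast
    have "a \<noteq> 0" "b \<noteq> 0" using a b ne by (auto simp: complex_eq_iff)
    then have "a * N = b * N" using a b by simp
    then have "a = b" using N by simp
    then show False using a b ne(3) by (simp add: complex_eq_iff)
  qed
  moreover have "r = r'" using x \<open>c = c'\<close> by (auto simp: ST)
  ultimately show ?thesis by (simp add: ST)
qed

section \<open>Arcs between contact points\<close>

text \<open>Angles are kept as reals rather than modulo \<open>2 * pi\<close>, so that arcs are
  images of intervals and consecutive contact points have consecutive angles.\<close>

definition circ :: "complex \<Rightarrow> real \<Rightarrow> real \<Rightarrow> complex" where
  "circ z r \<theta> = z + of_real r * cis \<theta>"

lemma part_circlepath_eq_circ: "part_circlepath z r s t x = circ z r (linepath s t x)"
  by (simp add: part_circlepath_def circ_def cis_conv_exp)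

lemma circ_eq_iff:
  assumes "0 < r"
  shows "circ z r a = circ z r b \<longleftrightarrow> (\<exists>k::int. a = b + 2 * pi * of_int k)"
proof -
  have "circ z r a = circ z r b \<longleftrightarrow> sin a = sin b \<and> cos a = cos b"
    using assms by (auto simp: circ_def complex_eq_iff)
  also have "\<dots> \<longleftrightarrow> (\<exists>k::int. a = b + 2 * pi * of_int k)"
    unfolding sin_cos_eq_iff by (simp add: mult_ac)
  finally show ?thesis .
qed

lemma two_pi_mult_less_iff: "2 * pi * real_of_int k < 2 * pi * real_of_int m \<longleftrightarrow> k < m"
  by (simp add: mult_less_cancel_left_pos)

lemma circ_shift: "circ z r (a + 2 * pi * of_int k) = circ z r a"
proof -
  have "cis (2 * pi * of_int k) = 1" by (rule cis_multiple_2pi) simp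
  then show ?thesis by (simp add: circ_def flip: cis_mult)
qed

lemma circ_plus_2pi: "circ z r (a + 2 * pi) = circ z r a" and circ_minus_2pi: "circ z r (a - 2 * pi) = circ z r a"
  using circ_shift[of z r a 1] circ_shift[of z r a "-1"] by simp_all

lemma sphere_eq_range_circ:
  assumes "0 < r"
  shows "sphere z r = range (circ z r)"
proof -
  have "w \<in> range (circ z r)" if "w \<in> sphere z r" for w
  proof -
    have "norm (w - z) = r" using that by (simp add: dist_norm norm_minus_commute)
    then have "circ z r (Arg (w - z)) = w" using rcis_cmod_Arg[of "w - z"] by (simp add: circ_def rcis_def)
    then show ?thesis by (metis rangeI)
  qed
  then show ?thesis using assms by (auto simp: circ_def dist_norm norm_mult)
qed

lemma continuous_on_circ: "continuous_on A (circ z r)"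
  unfolding circ_def cis.ctr by (intro continuous_intros)

lemma connected_sphere_minus_point:
  fixes z :: complex
  assumes "0 < r"
  shows "Topological_Spaces.connected (sphere z r - {q})"
proof (cases "q \<in> sphere z r")
  case True
  then obtain a where a: "q = circ z r a" using sphere_eq_range_circ[OF assms] by auto
  have "sphere z r - {q} = circ z r ` {a<..<a + 2 * pi}"
  proof (intro equalityI subsetI)
    fix w assume w: "w \<in> sphere z r - {q}"
    then obtain b where b: "w = circ z r b" using sphere_eq_range_circ[OF assms] by auto
    define k :: int where "k = \<lfloor>(b - a) / (2 * pi)\<rfloor>"
    define b' where "b' = b - 2 * pi * of_int k"
    have "of_int k \<le> (b - a) / (2 * pi)" "(b - a) / (2 * pi) < of_int k + 1" unfolding k_def by linarith+
    then have 1: "a \<le> b'" "b' < a + 2 * pi" by (simp_all add: b'_def field_simps)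
    have 2: "circ z r b' = w" using circ_shift[of z r b "- k"] by (simp add: b b'_def)
    then have "b' \<noteq> a" using w a by auto
    then show "w \<in> circ z r ` {a<..<a + 2 * pi}" using 1 2 by force
  next
    fix w assume "w \<in> circ z r ` {a<..<a + 2 * pi}"
    then obtain b where b: "w = circ z r b" "a < b" "b < a + 2 * pi" by auto
    have "w \<noteq> q"
    proof
      assume "w = q"
      then obtain k :: int where "b = a + 2 * pi * of_int k" using a b circ_eq_iff[OF assms] by metis
      then have "2 * pi * of_int 0 < 2 * pi * of_int k" "2 * pi * of_int k < 2 * pi * of_int 1" using b by auto
      then have "0 < k" "k < 1" unfolding two_pi_mult_less_iff by auto
      then show False by simp
    qed
    then show "w \<in> sphere z r - {q}" using b sphere_eq_range_circ[OF assms] by auto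
  qed
  moreover have "Topological_Spaces.connected (circ z r ` {a<..<a + 2 * pi})"
    by (intro connected_continuous_image continuous_on_circ) simp
  ultimately show ?thesis by simp
next
  case False
  then show ?thesis using connected_sphere[of z r] by simp
qed

text \<open>With different centres, the points of the circle on the line of centres would have
  different distances from the second centre.\<close>

lemma sphere_eq_imp_eq:
  fixes z z' :: complex
  assumes "sphere z r = sphere z' r'" "0 < r"
  shows "z = z'" "r = r'"
proof -
  show "z = z'"
  proof (rule ccontr)
    assume ne: "z \<noteq> z'"
    define e where "e = (z - z') / of_real (dist z z')"
    have e: "norm e = 1" "z - z' = of_real (dist z z') * e" using ne by (auto simp: e_def dist_norm norm_divide)
    have "z + of_real r * e \<in> sphere z' r'" "z - of_real r * e \<in> sphere z' r'"
      unfolding assms(1)[symmetric] using e(1) assms(2) by (auto simp: dist_norm norm_mult)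
    then have "norm (z + of_real r * e - z') = r'" "norm (z - of_real r * e - z') = r'"
      by (auto simp: dist_norm norm_minus_commute)
    moreover have "z + of_real r * e - z' = of_real (dist z z' + r) * e" "z - of_real r * e - z' = of_real (dist z z' - r) * e"
      using e(2) by (simp_all add: algebra_simps)
    ultimately have "\<bar>dist z z' + r\<bar> = r'" "\<bar>dist z z' - r\<bar> = r'"
      using e(1) by (metis mult.right_neutral norm_mult norm_of_real)+
    moreover have "0 < dist z z'" using ne by simp
    ultimately show False using assms(2) by linarith
  qed
  moreover have "z + of_real r \<in> sphere z' r'" unfolding assms(1)[symmetric] using assms(2) by (simp add: dist_norm)
  ultimately show "r = r'" using assms by (simp add: dist_norm)
qed

lemma mem_contact_arcs_iff:
  "A \<in> contact_arcs \<C> \<longleftrightarrow> (\<exists>z r s t. 0 < r \<and> sphere z r \<in> \<C> \<and> s < t \<and> t \<le> s + 2 * pi \<and>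
     circ z r s \<in> contact_points \<C> \<and> circ z r t \<in> contact_points \<C> \<and>
     (\<forall>\<theta>\<in>{s<..<t}. circ z r \<theta> \<notin> contact_points \<C>) \<and> A = circ z r ` {s..t})"
proof -
  have im: "path_image (part_circlepath z r s t) = circ z r ` {s..t}" if "s < t" for z r s t
    using that unfolding path_image_part_circlepath' circ_def by (simp add: closed_segment_eq_real_ivl)
  have int: "(\<forall>x\<in>{0<..<1}. part_circlepath z r s t x \<notin> P) \<longleftrightarrow> (\<forall>\<theta>\<in>{s<..<t}. circ z r \<theta> \<notin> P)"
    if "s < t" for z r s t and P :: "complex set"
  proof -
    have "linepath s t ` {0<..<1} = {s<..<t}"
    proof (intro equalityI subsetI)
      fix \<theta> assume \<theta>: "\<theta> \<in> {s<..<t}"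
      have "linepath s t x = s + x * (t - s)" for x by (simp add: linepath_def algebra_simps)
      then have "linepath s t ((\<theta> - s) / (t - s)) = \<theta>" using that by simp
      moreover have "(\<theta> - s) / (t - s) \<in> {0<..<1}" using \<theta> that by (simp add: field_simps)
      ultimately show "\<theta> \<in> linepath s t ` {0<..<1}" by (metis imageI)
    next
      fix \<theta> assume "\<theta> \<in> linepath s t ` {0<..<1}"
      then obtain x where x: "0 < x" "x < 1" "\<theta> = s + x * (t - s)" by (auto simp: linepath_def algebra_simps)
      have "0 < x * (t - s)" "x * (t - s) < 1 * (t - s)" using x that by (auto intro: mult_strict_right_mono)
      then show "\<theta> \<in> {s<..<t}" using x by simp
    qed
    then have "(\<forall>\<theta>\<in>{s<..<t}. circ z r \<theta> \<notin> P) \<longleftrightarrow> (\<forall>\<theta>\<in>linepath s t ` {0<..<1}. circ z r \<theta> \<notin> P)" by (simp only:)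
    then show ?thesis unfolding part_circlepath_eq_circ by blast
  qed
  have ends: "pathstart (part_circlepath z r s t) = circ z r s" "pathfinish (part_circlepath z r s t) = circ z r t" for z r s t
    by (simp_all add: circ_def cis_conv_exp)
  have eq: "(A = path_image (part_circlepath z r s t) \<and> 0 < r \<and> sphere z r \<in> \<C> \<and> s < t \<and> t \<le> s + 2 * pi \<and>
      circ z r s \<in> contact_points \<C> \<and> circ z r t \<in> contact_points \<C> \<and>
      (\<forall>x\<in>{0<..<1}. part_circlepath z r s t x \<notin> contact_points \<C>)) \<longleftrightarrow>
    (0 < r \<and> sphere z r \<in> \<C> \<and> s < t \<and> t \<le> s + 2 * pi \<and>
     circ z r s \<in> contact_points \<C> \<and> circ z r t \<in> contact_points \<C> \<and>
     (\<forall>\<theta>\<in>{s<..<t}. circ z r \<theta> \<notin> contact_points \<C>) \<and> A = circ z r ` {s..t})" for z r s t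
    using im[of s t z r] int[of s t z r "contact_points \<C>"] by metis
  show ?thesis unfolding contact_arcs_def mem_Collect_eq ends by (simp only: eq)
qed

section \<open>Consecutive contact points on one circle\<close>

context
  fixes P :: "complex set" and z :: complex and r :: real
  assumes r: "0 < r" and fin: "finite P" and ne: "sphere z r \<inter> P \<noteq> {}"
begin

text \<open>A half-open window of one full turn represents each point of the circle exactly once;
  existence is used here, uniqueness in \<open>finite_contact_angles\<close>.\<close>

lemma contact_angle_window: "\<exists>\<alpha>. x < \<alpha> \<and> \<alpha> \<le> x + 2 * pi \<and> circ z r \<alpha> \<in> P"
proof -
  obtain \<beta> where \<beta>: "circ z r \<beta> \<in> P" using ne sphere_eq_range_circ[OF r] by auto
  define k :: int where "k = \<lfloor>(x - \<beta>) / (2 * pi)\<rfloor> + 1"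
  have "(x - \<beta>) / (2 * pi) < of_int k" "of_int k \<le> (x - \<beta>) / (2 * pi) + 1" unfolding k_def by linarith+
  then have "x < \<beta> + 2 * pi * of_int k" "\<beta> + 2 * pi * of_int k \<le> x + 2 * pi"
    by (simp_all add: field_simps)
  then show ?thesis using \<beta> circ_shift by metis
qed

lemma finite_contact_angles: "finite {\<alpha>. x < \<alpha> \<and> \<alpha> \<le> x + 2 * pi \<and> circ z r \<alpha> \<in> P}"
proof -
  have "inj_on (circ z r) {x<..x + 2 * pi}"
  proof (rule inj_onI)
    fix a b assume ab: "a \<in> {x<..x + 2 * pi}" "b \<in> {x<..x + 2 * pi}" "circ z r a = circ z r b"
    then obtain k :: int where k: "a = b + 2 * pi * of_int k" using circ_eq_iff[OF r] by blast
    have "x < a" "a \<le> x + 2 * pi" "x < b" "b \<le> x + 2 * pi" using ab by auto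
    then have "2 * pi * of_int k < 2 * pi * of_int 1" unfolding of_int_1 using k by linarith
    moreover have "2 * pi * of_int (-1) < 2 * pi * of_int k" using \<open>x < a\<close> \<open>b \<le> x + 2 * pi\<close> k by simp
    ultimately have "k < 1" "-1 < k" unfolding two_pi_mult_less_iff by auto
    then show "a = b" using k by simp
  qed
  then have "finite (circ z r -` P \<inter> {x<..x + 2 * pi})" by (rule finite_vimage_IntI[OF fin])
  then show ?thesis by (rule finite_subset[rotated]) auto
qed

text \<open>If the only contact point of the circle sits at the angle \<open>x\<close>, the result
  is \<open>x + 2 * pi\<close>, which is the loop case of \<open>contact_arcs\<close>.\<close>

lemma next_contact:
  obtains t where "x < t" "t \<le> x + 2 * pi" "circ z r t \<in> P" "\<forall>\<theta>\<in>{x<..<t}. circ z r \<theta> \<notin> P"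
proof -
  let ?Z = "{\<alpha>. x < \<alpha> \<and> \<alpha> \<le> x + 2 * pi \<and> circ z r \<alpha> \<in> P}"
  have ne: "?Z \<noteq> {}" using contact_angle_window[of x] by blast
  have "Min ?Z \<in> ?Z" by (rule Min_in[OF finite_contact_angles ne])
  moreover have "\<forall>\<theta>\<in>{x<..<Min ?Z}. circ z r \<theta> \<notin> P"
  proof
    fix \<theta> assume \<theta>: "\<theta> \<in> {x<..<Min ?Z}"
    show "circ z r \<theta> \<notin> P"
    proof
      assume "circ z r \<theta> \<in> P"
      then have "\<theta> \<in> ?Z" using \<theta> calculation by auto
      then show False using Min_le[OF finite_contact_angles, of \<theta> x] \<theta> by auto
    qed
  qed
  ultimately show ?thesis using that by blast
qed

lemma prev_contact:
  obtains s where "s < x" "x \<le> s + 2 * pi" "circ z r s \<in> P" "\<forall>\<theta>\<in>{s<..<x}. circ z r \<theta> \<notin> P"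
proof -
  let ?Z = "{\<alpha>. x - 2 * pi \<le> \<alpha> \<and> \<alpha> < x \<and> circ z r \<alpha> \<in> P}"
  obtain \<beta> where \<beta>: "x - 2 * pi < \<beta>" "\<beta> \<le> x" "circ z r \<beta> \<in> P" using contact_angle_window[of "x - 2 * pi"] by auto
  have "\<exists>\<alpha>. \<alpha> \<in> ?Z"
  proof (cases "\<beta> = x")
    case True
    then have "x - 2 * pi \<in> ?Z" using \<beta> by (simp add: circ_minus_2pi)
    then show ?thesis by blast
  next
    case False
    then show ?thesis using \<beta> by (intro exI[of _ \<beta>]) auto
  qed
  then have ne: "?Z \<noteq> {}" by blast
  \<comment> \<open>The windows of \<open>finite_contact_angles\<close> omit their left end, so the
    window before is added in order to include \<open>x - 2 * pi\<close>.\<close>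
  have fin: "finite ?Z"
    by (rule finite_subset[OF _ finite_UnI[OF finite_contact_angles[of "x - 4 * pi"] finite_contact_angles[of "x - 2 * pi"]]]) auto
  have "Max ?Z \<in> ?Z" by (rule Max_in[OF fin ne])
  moreover have "\<forall>\<theta>\<in>{Max ?Z<..<x}. circ z r \<theta> \<notin> P"
  proof
    fix \<theta> assume \<theta>: "\<theta> \<in> {Max ?Z<..<x}"
    show "circ z r \<theta> \<notin> P"
    proof
      assume "circ z r \<theta> \<in> P"
      then have "\<theta> \<in> ?Z" using \<theta> calculation by auto
      then show False using Max_ge[OF fin, of \<theta>] \<theta> by auto
    qed
  qed
  moreover have "Max ?Z < x" "x \<le> Max ?Z + 2 * pi" "circ z r (Max ?Z) \<in> P" using calculation(1) by simp_all
  ultimately show ?thesis using that by blast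
qed

end

lemma contact_arcs_cover:
  assumes r: "0 < r" "sphere z r \<in> \<C>" and fin: "finite (contact_points \<C>)" and ne: "sphere z r \<inter> contact_points \<C> \<noteq> {}"
    and y: "y \<in> sphere z r"
  shows "\<exists>A\<in>contact_arcs \<C>. A \<subseteq> sphere z r \<and> y \<in> A"
proof -
  obtain x where x: "y = circ z r x" using y sphere_eq_range_circ[OF r(1)] by auto
  obtain s where s: "s < x" "x \<le> s + 2 * pi" "circ z r s \<in> contact_points \<C>" "\<forall>\<theta>\<in>{s<..<x}. circ z r \<theta> \<notin> contact_points \<C>"
    by (rule prev_contact[OF r(1) fin ne])
  \<comment> \<open>The forward search starts at \<open>s\<close>, not at \<open>x\<close>: if
    \<open>x\<close> is itself a contact angle, this gives \<open>t = x\<close> and the arc still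
    contains the point.\<close>
  obtain t where t: "s < t" "t \<le> s + 2 * pi" "circ z r t \<in> contact_points \<C>" "\<forall>\<theta>\<in>{s<..<t}. circ z r \<theta> \<notin> contact_points \<C>"
    by (rule next_contact[OF r(1) fin ne])
  have "x \<le> t" using s(4) t(1,3) by (meson greaterThanLessThan_iff not_less)
  then have "y \<in> circ z r ` {s..t}" using s(1) x by auto
  moreover have "circ z r ` {s..t} \<in> contact_arcs \<C>" using r s t unfolding mem_contact_arcs_iff by blast
  moreover have "circ z r ` {s..t} \<subseteq> sphere z r" using sphere_eq_range_circ[OF r(1)] by auto
  ultimately show ?thesis by blast
qed

text \<open>A circle with a single contact point would contribute a loop; this excludes such
  circles, since a simple graph has no loops.\<close>

lemma contact_arc_loop:
  assumes r: "0 < r" "sphere z r \<in> \<C>" and P: "sphere z r \<inter> contact_points \<C> = {x}"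
  shows "sphere z r \<in> contact_arcs \<C>"
proof -
  have "x \<in> sphere z r" "x \<in> contact_points \<C>" using P by auto
  then obtain a where a: "x = circ z r a" using sphere_eq_range_circ[OF r(1)] by auto
  have sph: "circ z r b \<in> sphere z r" for b using sphere_eq_range_circ[OF r(1)] by auto
  have int: "circ z r \<theta> \<notin> contact_points \<C>" if \<theta>: "\<theta> \<in> {a<..<a + 2 * pi}" for \<theta>
  proof
    assume "circ z r \<theta> \<in> contact_points \<C>"
    then have "circ z r \<theta> = circ z r a" using P sph a by auto
    then obtain k :: int where "\<theta> = a + 2 * pi * of_int k" using circ_eq_iff[OF r(1)] by blast
    then have "2 * pi * of_int 0 < 2 * pi * of_int k" "2 * pi * of_int k < 2 * pi * of_int 1" using \<theta> by auto
    then have "0 < k" "k < 1" unfolding two_pi_mult_less_iff by auto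
    then show False by simp
  qed
  have im: "sphere z r = circ z r ` {a..a + 2 * pi}"
  proof (intro equalityI subsetI)
    fix w assume "w \<in> sphere z r"
    then obtain b where b: "w = circ z r b" using sphere_eq_range_circ[OF r(1)] by auto
    define k :: int where "k = \<lfloor>(b - a) / (2 * pi)\<rfloor>"
    have "of_int k \<le> (b - a) / (2 * pi)" "(b - a) / (2 * pi) < of_int k + 1" unfolding k_def by linarith+
    then have "a \<le> b - 2 * pi * of_int k" "b - 2 * pi * of_int k \<le> a + 2 * pi" by (simp_all add: field_simps)
    moreover have "circ z r (b - 2 * pi * of_int k) = w" using circ_shift[of z r b "- k"] by (simp add: b)
    ultimately show "w \<in> circ z r ` {a..a + 2 * pi}" by force
  qed (use sph in auto)
  show ?thesis unfolding mem_contact_arcs_iff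
  proof (intro exI conjI ballI)
    show "circ z r a \<in> contact_points \<C>" "circ z r (a + 2 * pi) \<in> contact_points \<C>"
      using a \<open>x \<in> contact_points \<C>\<close> by (simp_all add: circ_plus_2pi)
  qed (use r int im in simp_all)
qed

text \<open>The arcs before and after \<open>x\<close> may have the same two ends, so they are told
  apart by an inner point. If the midpoint of the later arc were on the earlier one, its angle would
  differ there by exactly one turn, and \<open>t - 2 * pi\<close> would be a contact angle between
  \<open>s\<close> and \<open>a\<close>.\<close>

lemma two_contact_arcs:
  assumes r: "0 < r" "sphere z r \<in> \<C>" and fin: "finite (contact_points \<C>)"
    and x: "x \<in> sphere z r" "x \<in> contact_points \<C>" and ne1: "sphere z r \<inter> contact_points \<C> \<noteq> {x}"
  obtains A B where "A \<in> contact_arcs \<C>" "B \<in> contact_arcs \<C>" "A \<noteq> B" "A \<subseteq> sphere z r" "B \<subseteq> sphere z r" "x \<in> A" "x \<in> B"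
proof -
  let ?P = "contact_points \<C>"
  have ne: "sphere z r \<inter> ?P \<noteq> {}" using x by auto
  obtain a where a: "x = circ z r a" using x sphere_eq_range_circ[OF r(1)] by auto
  have sph: "circ z r b \<in> sphere z r" for b using sphere_eq_range_circ[OF r(1)] by auto
  obtain s where s: "s < a" "a \<le> s + 2 * pi" "circ z r s \<in> ?P" "\<forall>\<theta>\<in>{s<..<a}. circ z r \<theta> \<notin> ?P"
    by (rule prev_contact[OF r(1) fin ne])
  obtain t where t: "a < t" "t \<le> a + 2 * pi" "circ z r t \<in> ?P" "\<forall>\<theta>\<in>{a<..<t}. circ z r \<theta> \<notin> ?P"
    by (rule next_contact[OF r(1) fin ne])
  have t': "t \<noteq> a + 2 * pi"
  proof
    assume ta: "t = a + 2 * pi"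
    obtain y where y: "y \<in> sphere z r" "y \<in> ?P" "y \<noteq> x" using ne1 x by blast
    have "sphere z r \<inter> {y} \<noteq> {}" using y by auto
    then obtain b where b: "a < b" "b \<le> a + 2 * pi" "circ z r b = y"
      using contact_angle_window[OF r(1), of "{y}" z a] by auto
    then have "b \<noteq> t" using ta y a by (auto simp: circ_plus_2pi)
    then show False using t(4) b ta y by auto
  qed
  have "circ z r ` {a..t} \<noteq> circ z r ` {s..a}"
  proof
    assume eq: "circ z r ` {a..t} = circ z r ` {s..a}"
    define \<theta> where "\<theta> = (a + t) / 2"
    have \<theta>: "a < \<theta>" "\<theta> < t" using t by (auto simp: \<theta>_def)
    then have "circ z r \<theta> \<in> circ z r ` {s..a}" using eq by auto
    then obtain \<theta>' where \<theta>': "s \<le> \<theta>'" "\<theta>' \<le> a" "circ z r \<theta> = circ z r \<theta>'" by auto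
    then obtain k :: int where k: "\<theta> = \<theta>' + 2 * pi * of_int k" using circ_eq_iff[OF r(1)] by blast
    have "2 * pi * of_int 0 < 2 * pi * of_int k" using k \<theta> \<theta>' by simp
    moreover have "2 * pi * of_int k < 2 * pi * of_int 2" unfolding of_int_numeral using k \<theta> \<theta>' s(1,2) t(1,2) by linarith
    ultimately have "0 < k" "k < 2" unfolding two_pi_mult_less_iff by auto
    then have "k = 1" by simp
    then have "s \<le> \<theta> - 2 * pi" using k \<theta>' by simp
    then have "t - 2 * pi \<in> {s<..<a}" using \<theta> t t' by auto
    then show False using s(4) t(3) circ_minus_2pi by metis
  qed
  moreover have "circ z r ` {a..t} \<in> contact_arcs \<C>" unfolding mem_contact_arcs_iff using r t x a by blast
  moreover have "circ z r ` {s..a} \<in> contact_arcs \<C>" unfolding mem_contact_arcs_iff using r s x a by blast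
  moreover have "x \<in> circ z r ` {a..t}" "x \<in> circ z r ` {s..a}" using a s t by auto
  ultimately show ?thesis using that sph by blast
qed

text \<open>A common point that is no contact point puts both arcs on one circle. After a shift by
  full turns their angle intervals overlap; as both end in contacts and have none inside, they
  coincide.\<close>

lemma contact_arcs_Int_subset:
  assumes A: "A \<in> contact_arcs \<C>" and B: "B \<in> contact_arcs \<C>" and "A \<noteq> B"
  shows "A \<inter> B \<subseteq> contact_points \<C>"
proof (rule subsetI, rule ccontr)
  fix y assume y: "y \<in> A \<inter> B" and yP: "y \<notin> contact_points \<C>"
  let ?P = "contact_points \<C>"
  from A obtain z r s t where 1: "0 < r" "sphere z r \<in> \<C>" "circ z r s \<in> ?P" "circ z r t \<in> ?P"
    "\<forall>\<theta>\<in>{s<..<t}. circ z r \<theta> \<notin> ?P" "A = circ z r ` {s..t}" unfolding mem_contact_arcs_iff by blast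
  from B obtain z' r' s' t' where 2: "0 < r'" "sphere z' r' \<in> \<C>" "circ z' r' s' \<in> ?P" "circ z' r' t' \<in> ?P"
    "\<forall>\<theta>\<in>{s'<..<t'}. circ z' r' \<theta> \<notin> ?P" "B = circ z' r' ` {s'..t'}" unfolding mem_contact_arcs_iff by blast
  have "y \<in> sphere z r" "y \<in> sphere z' r'"
    using y 1(6) 2(6) sphere_eq_range_circ[OF 1(1), of z] sphere_eq_range_circ[OF 2(1), of z'] by auto
  then have "sphere z r = sphere z' r'" using yP 1 2 unfolding contact_points_def by blast
  from sphere_eq_imp_eq[OF this 1(1)] have eq: "z' = z" "r' = r" by auto
  obtain a where a: "a \<in> {s..t}" "y = circ z r a" using y 1 by auto
  obtain b where b: "b \<in> {s'..t'}" "y = circ z r b" using y 2 eq by auto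
  have "a \<noteq> s" "a \<noteq> t" "b \<noteq> s'" "b \<noteq> t'" using 1 2 eq a b yP by metis+
  then have ab: "s < a" "a < t" "s' < b" "b < t'" using a b by auto
  obtain k :: int where k: "a = b + 2 * pi * of_int k" using a b circ_eq_iff[OF 1(1)] by metis
  let ?d = "2 * pi * of_int k"
  have P': "circ z r (s' + ?d) \<in> ?P" "circ z r (t' + ?d) \<in> ?P" using 2 eq circ_shift by metis+
  have int': "circ z r \<theta> \<notin> ?P" if "s' + ?d < \<theta>" "\<theta> < t' + ?d" for \<theta>
  proof -
    have "circ z r (\<theta> - ?d) \<notin> ?P" using 2(5) that eq by auto
    then show ?thesis using circ_shift[of z r "\<theta> - ?d" k] by simp
  qed
  have "s = s' + ?d"
    using ab k 1(3,5) P'(1) int'[of s] by (smt (verit) greaterThanLessThan_iff)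
  moreover have "t = t' + ?d"
    using ab k 1(4,5) P'(2) int'[of t] by (smt (verit) greaterThanLessThan_iff)
  moreover have "circ z r ` {s' + ?d..t' + ?d} = circ z r ` {s'..t'}"
  proof -
    have "{s' + ?d..t' + ?d} = (\<lambda>x. x + ?d) ` {s'..t'}" by simp
    show ?thesis unfolding \<open>{s' + ?d..t' + ?d} = (\<lambda>x. x + ?d) ` {s'..t'}\<close> image_image circ_shift ..
  qed
  ultimately show False using \<open>A \<noteq> B\<close> 1(6) 2(6) eq by simp
qed

lemma contact_arc_props:
  assumes "A \<in> contact_arcs \<C>"
  shows "compact A" "Topological_Spaces.connected A" "\<exists>S\<in>\<C>. A \<subseteq> S" "\<exists>y\<in>A. y \<notin> contact_points \<C>"
proof -
  from assms obtain z r s t where A: "0 < r" "sphere z r \<in> \<C>" "s < t"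
    "\<forall>\<theta>\<in>{s<..<t}. circ z r \<theta> \<notin> contact_points \<C>" "A = circ z r ` {s..t}" unfolding mem_contact_arcs_iff by blast
  show "compact A" unfolding A by (intro compact_continuous_image continuous_on_circ) simp
  show "Topological_Spaces.connected A" unfolding A by (intro connected_continuous_image continuous_on_circ) simp
  show "\<exists>S\<in>\<C>. A \<subseteq> S" using A(2,5) sphere_eq_range_circ[OF A(1), of z] by auto
  have "(s + t) / 2 \<in> {s<..<t}" using A by simp
  then show "\<exists>y\<in>A. y \<notin> contact_points \<C>" using A(4,5) by (intro bexI[of _ "circ z r ((s + t) / 2)"]) auto
qed

section \<open>The circles of a realization\<close>

locale circle_realization =
  fixes G :: "'a pair_pre_digraph" and \<C> :: "complex set set"
    and \<phi> :: "'a \<Rightarrow> complex" and \<psi> :: "'a set \<Rightarrow> complex set"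
  assumes graph: "pair_graph G" and regular: "regular_graph 4 G"
    and circles: "circle_system \<C>"
    and bij_\<phi>: "bij_betw \<phi> (pverts G) (contact_points \<C>)"
    and bij_\<psi>: "bij_betw \<psi> (edge_set G) (contact_arcs \<C>)"
    and ends: "\<And>e. e \<in> edge_set G \<Longrightarrow> \<psi> e \<inter> contact_points \<C> = \<phi> ` e"
begin

abbreviation V :: "'a set" where "V \<equiv> pverts G"
abbreviation adj :: "'a \<Rightarrow> 'a \<Rightarrow> bool" where "adj u v \<equiv> (u, v) \<in> parcs G"

text \<open>The circle carrying an edge, used as its colour: two edges at a vertex continue each
  other when their colours agree. It is unique because an arc contains points that are no contact
  points.\<close>

definition col :: "'a \<Rightarrow> 'a \<Rightarrow> complex set" where
  "col u v = (THE S. S \<in> \<C> \<and> \<psi> {u, v} \<subseteq> S)"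

lemma finV: "finite V" and finE: "finite (parcs G)"
  using graph by (simp_all add: pair_graph_def pair_digraph_def pair_fin_digraph_def pair_fin_digraph_axioms_def)

lemma adj_sym: "adj u v \<Longrightarrow> adj v u"
proof -
  interpret pair_graph G by (rule graph)
  show "adj u v \<Longrightarrow> adj v u" using pair_sym_arcs unfolding symmetric_def with_proj_simps by (rule symD)
qed

lemma adj_in: "adj u v \<Longrightarrow> u \<in> V \<and> v \<in> V"
  using graph by (metis fst_conv snd_conv pair_digraph_def pair_fin_digraph_def pair_graph_def pair_wf_digraph.arc_fst_in_verts pair_wf_digraph.arc_snd_in_verts)

lemma adj_ne: "adj u v \<Longrightarrow> u \<noteq> v"
  using graph by (metis fst_conv snd_conv pair_digraph_def pair_graph_def pair_loopfree_digraph.pair_no_loops)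

lemma edge_iff: "{u, v} \<in> edge_set G \<longleftrightarrow> adj u v"
  unfolding edge_set_def by (auto simp: doubleton_eq_iff intro: adj_sym)

lemma edgeE:
  assumes "e \<in> edge_set G" "v \<in> e"
  obtains w where "e = {v, w}" "adj v w"
proof -
  obtain a b where ab: "e = {a, b}" "adj a b" using assms(1) by (auto simp: edge_set_def)
  then consider "v = a" | "v = b" using assms(2) by auto
  then show ?thesis
  proof cases
    case 1
    then show ?thesis using ab that by blast
  next
    case 2
    then show ?thesis using ab that[of a] adj_sym[OF ab(2)] by (simp add: insert_commute)
  qed
qed

lemma edge_subset: "e \<in> edge_set G \<Longrightarrow> e \<subseteq> V"
  unfolding edge_set_def using adj_in by auto

lemma fin_edges: "finite (edge_set G)"
proof -
  have "edge_set G = (\<lambda>(u, v). {u, v}) ` parcs G" by (auto simp: edge_set_def)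
  then show ?thesis using finE by simp
qed

lemma card_nbrs: "v \<in> V \<Longrightarrow> card {w. adj v w} = 4"
proof -
  assume "v \<in> V"
  then have "card {e \<in> parcs G. fst e = v} = 4"
    using regular by (simp add: regular_graph_def out_degree_def out_arcs_def)
  moreover have "{e \<in> parcs G. fst e = v} = Pair v ` {w. adj v w}" by auto
  moreover have "card (Pair v ` {w. adj v w}) = card {w. adj v w}" by (rule card_image) (simp add: inj_on_def)
  ultimately show ?thesis by simp
qed

lemma fin_nbrs: "finite {w. adj v w}"
proof -
  have "{w. adj v w} \<subseteq> V" using adj_in by auto
  then show ?thesis using finV finite_subset by blast
qed

lemma inj_\<phi>: "u \<in> V \<Longrightarrow> v \<in> V \<Longrightarrow> \<phi> u = \<phi> v \<longleftrightarrow> u = v"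
  using bij_\<phi> by (auto simp: bij_betw_def inj_on_def)

lemma \<phi>_contact: "v \<in> V \<Longrightarrow> \<phi> v \<in> contact_points \<C>"
  using bij_\<phi> by (auto simp: bij_betw_def)

lemma contact_\<phi>: "x \<in> contact_points \<C> \<Longrightarrow> \<exists>v\<in>V. x = \<phi> v"
  using bij_\<phi> by (auto simp: bij_betw_def)

lemma fin_contact: "finite (contact_points \<C>)"
  using bij_\<phi> finV bij_betw_finite by blast

lemma circle: "S \<in> \<C> \<Longrightarrow> is_circle S"
  using circles by (auto simp: circle_system_def is_circle_def)

lemma circles_Int_contact: "S \<in> \<C> \<Longrightarrow> T \<in> \<C> \<Longrightarrow> S \<noteq> T \<Longrightarrow> S \<inter> T \<subseteq> contact_points \<C>"
  by (auto simp: contact_points_def)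

lemma arc_circle_unique:
  assumes "A \<in> contact_arcs \<C>" "S \<in> \<C>" "A \<subseteq> S" "T \<in> \<C>" "A \<subseteq> T"
  shows "S = T"
proof (rule ccontr)
  assume "S \<noteq> T"
  then have "A \<subseteq> contact_points \<C>" using circles_Int_contact[OF assms(2,4)] assms(3,5) by blast
  then show False using contact_arc_props(4)[OF assms(1)] by blast
qed

lemma \<psi>_arc: "e \<in> edge_set G \<Longrightarrow> \<psi> e \<in> contact_arcs \<C>"
  using bij_\<psi> by (auto simp: bij_betw_def)

lemma arc_\<psi>: "A \<in> contact_arcs \<C> \<Longrightarrow> \<exists>e\<in>edge_set G. A = \<psi> e"
  using bij_\<psi> by (auto simp: bij_betw_def)

lemma inj_\<psi>: "e \<in> edge_set G \<Longrightarrow> e' \<in> edge_set G \<Longrightarrow> \<psi> e = \<psi> e' \<longleftrightarrow> e = e'"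
  using bij_\<psi> by (auto simp: bij_betw_def inj_on_def)

lemma col_eqI: "adj u v \<Longrightarrow> S \<in> \<C> \<Longrightarrow> \<psi> {u, v} \<subseteq> S \<Longrightarrow> col u v = S"
  unfolding col_def using arc_circle_unique[OF \<psi>_arc] edge_iff by (intro the_equality) blast+

lemma col_props: assumes "adj u v" shows "col u v \<in> \<C>" "\<psi> {u, v} \<subseteq> col u v"
proof -
  obtain S where "S \<in> \<C>" "\<psi> {u, v} \<subseteq> S" using contact_arc_props(3)[OF \<psi>_arc] edge_iff assms by blast
  then show "col u v \<in> \<C>" "\<psi> {u, v} \<subseteq> col u v" using col_eqI[OF assms] by auto
qed

lemma col_sym: "col u v = col v u"
  by (simp add: col_def insert_commute)

lemma \<phi>_mem_arc_iff: "adj u v \<Longrightarrow> w \<in> V \<Longrightarrow> \<phi> w \<in> \<psi> {u, v} \<longleftrightarrow> w = u \<or> w = v"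
proof -
  assume a: "adj u v" "w \<in> V"
  have "\<phi> w \<in> \<psi> {u, v} \<longleftrightarrow> \<phi> w \<in> \<phi> ` {u, v}" using ends[of "{u, v}"] edge_iff a \<phi>_contact[of w] by blast
  then show ?thesis using a adj_in inj_\<phi> by auto
qed

lemma col_mem: assumes "adj u v" shows "\<phi> u \<in> col u v" "\<phi> v \<in> col u v"
  using col_props[OF assms] \<phi>_mem_arc_iff[OF assms] adj_in[OF assms] by auto

text \<open>A circle through a vertex leaves it along two distinct arcs unless it has no other
  vertex; in that case it would be a loop of \<open>G\<close>.\<close>

lemma circle_at_vertex:
  assumes v: "v \<in> V" and S: "S \<in> \<C>" "\<phi> v \<in> S"
  obtains w w' where "w \<noteq> w'" "adj v w" "adj v w'" "col v w = S" "col v w' = S"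
proof -
  obtain z r where S': "S = sphere z r" "0 < r" using circle[OF S(1)] by (auto simp: is_circle_def)
  have r: "0 < r" "sphere z r \<in> \<C>" using S S' by auto
  have "sphere z r \<inter> contact_points \<C> \<noteq> {\<phi> v}"
  proof
    assume P: "sphere z r \<inter> contact_points \<C> = {\<phi> v}"
    then obtain e where e: "e \<in> edge_set G" "sphere z r = \<psi> e" using arc_\<psi>[OF contact_arc_loop[OF r P]] by auto
    then have "\<phi> ` e = {\<phi> v}" using ends P by simp
    moreover obtain u w where "e = {u, w}" "adj u w" using e(1) by (auto simp: edge_set_def)
    ultimately show False using adj_ne[of u w] adj_in[of u w] inj_\<phi>[of u w] by auto
  qed
  then obtain A B where A: "A \<in> contact_arcs \<C>" "B \<in> contact_arcs \<C>" "A \<noteq> B" "A \<subseteq> S" "B \<subseteq> S" "\<phi> v \<in> A" "\<phi> v \<in> B"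
    using two_contact_arcs[OF r fin_contact, of "\<phi> v"] S S' \<phi>_contact[OF v] by metis
  have *: "\<exists>w. adj v w \<and> A = \<psi> {v, w} \<and> col v w = S" if A: "A \<in> contact_arcs \<C>" "A \<subseteq> S" "\<phi> v \<in> A" for A
  proof -
    obtain e where e: "e \<in> edge_set G" "A = \<psi> e" using arc_\<psi>[OF A(1)] by auto
    then have "\<phi> v \<in> \<phi> ` e" using ends \<phi>_contact[OF v] A by blast
    then have "v \<in> e" using edge_subset[OF e(1)] inj_\<phi>[OF v] by blast
    then obtain w where "e = {v, w}" "adj v w" using edgeE e by blast
    then show ?thesis using col_eqI S A e by auto
  qed
  from *[OF A(1,4,6)] *[OF A(2,5,7)] A(3) that show ?thesis by metis
qed

text \<open>A contact point is on at least two circles and each of them uses at least two of the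
  four edges, so both bounds are attained. The count is the same for crossing and for touching
  circles.\<close>

lemma vertex_circles:
  assumes v: "v \<in> V"
  obtains S T where "S \<noteq> T" "S \<in> \<C>" "T \<in> \<C>" "{R \<in> \<C>. \<phi> v \<in> R} = {S, T}"
    "card {w. adj v w \<and> col v w = S} = 2" "card {w. adj v w \<and> col v w = T} = 2"
proof -
  obtain S T where ST: "S \<in> \<C>" "T \<in> \<C>" "S \<noteq> T" "\<phi> v \<in> S" "\<phi> v \<in> T"
    using \<phi>_contact[OF v] by (auto simp: contact_points_def)
  let ?N = "\<lambda>R. {w. adj v w \<and> col v w = R}"
  have fin: "finite (?N R)" for R using fin_nbrs[of v] by (rule finite_subset[rotated]) auto
  have ge2: "2 \<le> card (?N R)" if R: "R \<in> \<C>" "\<phi> v \<in> R" for R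
  proof -
    obtain w w' where w: "w \<noteq> w'" "adj v w" "adj v w'" "col v w = R" "col v w' = R" by (rule circle_at_vertex[OF v R])
    then have "{w, w'} \<subseteq> ?N R" by simp
    then show ?thesis using card_mono[OF fin, of "{w, w'}" R] w(1) by simp
  qed
  have "?N S \<inter> ?N T = {}" using ST by auto
  then have sum: "card (?N S \<union> ?N T) = card (?N S) + card (?N T)" by (rule card_Un_disjoint[OF fin fin])
  have le: "card (?N S \<union> ?N T) \<le> 4"
    using card_mono[OF fin_nbrs, of "?N S \<union> ?N T" v] card_nbrs[OF v] by auto
  have c: "card (?N S) = 2" "card (?N T) = 2" 
    using ge2[OF ST(1,4)] ge2[OF ST(2,5)] sum le by linarith+
  have "?N S \<union> ?N T = {w. adj v w}"
    by (rule card_subset_eq[OF fin_nbrs]) (use sum c card_nbrs[OF v] in auto)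
  moreover have "R = S \<or> R = T" if R: "R \<in> \<C>" "\<phi> v \<in> R" for R
  proof -
    obtain w where "w \<in> ?N R" using ge2[OF R] by (metis card.empty ex_in_conv not_numeral_le_zero)
    then have "w \<in> ?N S \<union> ?N T" using calculation by blast
    then show ?thesis using \<open>w \<in> ?N R\<close> by auto
  qed
  ultimately show ?thesis using that[of S T] ST c by auto
qed

lemma col_pairing:
  assumes v: "v \<in> V" and nb: "{w. adj v w} = {a, b, c, d}"
  shows "col v a = col v b \<and> col v c = col v d \<and> col v a \<noteq> col v c \<or>
    col v a = col v c \<and> col v b = col v d \<and> col v a \<noteq> col v b \<or>
    col v a = col v d \<and> col v b = col v c \<and> col v a \<noteq> col v b"
proof -
  have "card {a, b, c, d} = 4" using card_nbrs[OF v] nb by simp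
  then have dist: "a \<noteq> b" "a \<noteq> c" "a \<noteq> d" "b \<noteq> c" "b \<noteq> d" "c \<noteq> d"
    by (auto simp: card_insert_if split: if_splits)
  obtain S T where ST: "S \<noteq> T" "{R \<in> \<C>. \<phi> v \<in> R} = {S, T}"
    "card {w. adj v w \<and> col v w = S} = 2" by (rule vertex_circles[OF v])
  have mem: "col v w \<in> {S, T}" if "adj v w" for w
    using ST(2) col_props[OF that] col_mem[OF that] by blast
  have adj: "adj v a" "adj v b" "adj v c" "adj v d" using nb by auto
  have "{w. adj v w \<and> col v w = S} = {w \<in> {a, b, c, d}. col v w = S}" using nb by blast
  also have "\<dots> = (if col v a = S then {a} else {}) \<union> (if col v b = S then {b} else {}) \<union>
      (if col v c = S then {c} else {}) \<union> (if col v d = S then {d} else {})" by auto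
  finally have "card ((if col v a = S then {a} else {}) \<union> (if col v b = S then {b} else {}) \<union>
      (if col v c = S then {c} else {}) \<union> (if col v d = S then {d} else {})) = 2" using ST by simp
  then show ?thesis using mem[OF adj(1)] mem[OF adj(2)] mem[OF adj(3)] mem[OF adj(4)] ST(1) dist
    by (auto split: if_splits)
qed

lemma circles_at_vertex:
  assumes "adj v w" "adj v w'" "col v w \<noteq> col v w'" "S \<in> \<C>" "\<phi> v \<in> S"
  shows "S = col v w \<or> S = col v w'"
proof -
  have v: "v \<in> V" using assms adj_in by blast
  obtain R T where "{R \<in> \<C>. \<phi> v \<in> R} = {R, T}" by (rule vertex_circles[OF v])
  then show ?thesis using assms col_props col_mem by (metis (no_types, lifting) insertE mem_Collect_eq singletonD)
qed

text \<open>A circle minus a point is connected, so its vertices cannot be split by removing one of them.\<close>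

lemma circle_vertices_closed:
  assumes S: "S \<in> \<C>" and clo: "\<And>v w. v \<in> K \<Longrightarrow> adj v w \<Longrightarrow> col v w = S \<Longrightarrow> w \<in> insert q K"
    and v0: "v0 \<in> K" "v0 \<in> V" "v0 \<noteq> q" "\<phi> v0 \<in> S" and w: "w \<in> V" "\<phi> w \<in> S" and q: "q \<in> V"
  shows "w \<in> insert q K"
proof (rule ccontr)
  assume notin: "w \<notin> insert q K"
  obtain z r where S': "S = sphere z r" "0 < r" using circle[OF S] by (auto simp: is_circle_def)
  define E where "E = {e \<in> edge_set G. \<psi> e \<subseteq> S}"
  \<comment> \<open>The arcs on \<open>S\<close> with an end in \<open>K\<close> other than
    \<open>q\<close>, against all others on \<open>S\<close>: two finite unions of compact arcs that
    cover \<open>S\<close> and meet at most in \<open>\<phi> q\<close>.\<close>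
  define E1 where "E1 = {e \<in> E. e \<inter> (K - {q}) \<noteq> {}}"
  define E2 where "E2 = E - E1"
  have colE: "col a b = S" if "{a, b} \<in> E" for a b using that S col_eqI edge_iff by (auto simp: E_def)
  have finE: "finite E1" "finite E2" using fin_edges by (auto simp: E_def E1_def E2_def)
  have clo1: "closed (\<Union>(\<psi> ` E1))" "closed (\<Union>(\<psi> ` E2))"
    using finE contact_arc_props(1)[OF \<psi>_arc] by (auto intro!: closed_UN compact_imp_closed simp: E_def E1_def E2_def)
  have ne: "sphere z r \<inter> contact_points \<C> \<noteq> {}" using v0 S' \<phi>_contact by auto
  have cover: "S \<subseteq> \<Union>(\<psi> ` E1) \<union> \<Union>(\<psi> ` E2)"
  proof (intro subsetI)
    fix y assume "y \<in> S"
    then obtain A where A: "A \<in> contact_arcs \<C>" "A \<subseteq> S" "y \<in> A"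
      using contact_arcs_cover[OF S'(2) S[unfolded S'] fin_contact ne] S' by blast
    then obtain e where "e \<in> edge_set G" "A = \<psi> e" using arc_\<psi> by blast
    then have "e \<in> E" "y \<in> \<psi> e" using A by (auto simp: E_def)
    then show "y \<in> \<Union>(\<psi> ` E1) \<union> \<Union>(\<psi> ` E2)" by (cases "e \<in> E1") (auto simp: E2_def)
  qed
  have in1: "b \<in> insert q K" if e: "e \<in> E1" "b \<in> e" for e b
  proof -
    obtain k where k: "k \<in> e" "k \<in> K" "k \<noteq> q" using e by (auto simp: E1_def)
    have "e \<in> edge_set G" using e by (auto simp: E1_def E_def)
    then obtain k' where k': "e = {k, k'}" "adj k k'" using k edgeE by metis
    then have "col k k' = S" using colE e by (auto simp: E1_def)
    then have "k' \<in> insert q K" using clo k k' by blast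
    then show ?thesis using e k k' by auto
  qed
  have dis: "\<Union>(\<psi> ` E1) \<inter> \<Union>(\<psi> ` E2) \<inter> (S - {\<phi> q}) = {}"
  proof (rule ccontr)
    assume "\<not> ?thesis"
    then obtain y e1 e2 where y: "e1 \<in> E1" "e2 \<in> E2" "y \<in> \<psi> e1" "y \<in> \<psi> e2" "y \<noteq> \<phi> q" by blast
    have e: "e1 \<in> edge_set G" "e2 \<in> edge_set G" "e1 \<noteq> e2" using y by (auto simp: E_def E1_def E2_def)
    then have "y \<in> contact_points \<C>" using contact_arcs_Int_subset[OF \<psi>_arc \<psi>_arc] inj_\<psi> y by blast
    then have "y \<in> \<phi> ` e1" "y \<in> \<phi> ` e2" using ends e y by blast+
    then obtain b b' where b': "b \<in> e1" "b' \<in> e2" "y = \<phi> b" "y = \<phi> b'" by auto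
    then have "b = b'" using inj_\<phi>[of b b'] edge_subset[OF e(1)] edge_subset[OF e(2)] by auto
    then have b: "b \<in> e1" "b \<in> e2" "y = \<phi> b" using b' by auto
    then have "b \<in> K - {q}" using in1[OF y(1)] y(5) by auto
    then show False using b y(2) by (auto simp: E1_def E2_def)
  qed
  have edge_at: "\<exists>e\<in>E. b \<in> e \<and> \<phi> b \<in> \<psi> e" if b: "b \<in> V" "\<phi> b \<in> S" for b
  proof -
    obtain c where c: "adj b c" "col b c = S" using circle_at_vertex[OF b(1) S b(2)] by metis
    then have "{b, c} \<in> E" using col_props[OF c(1)] edge_iff by (auto simp: E_def)
    then show ?thesis using \<phi>_mem_arc_iff[OF c(1) b(1)] by blast
  qed
  obtain e0 where "e0 \<in> E" "v0 \<in> e0" "\<phi> v0 \<in> \<psi> e0" using edge_at v0 by blast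
  then have A: "\<phi> v0 \<in> \<Union>(\<psi> ` E1) \<inter> (S - {\<phi> q})" using v0 q inj_\<phi> by (auto simp: E1_def)
  obtain e where e: "e \<in> E" "w \<in> e" "\<phi> w \<in> \<psi> e" using edge_at w by blast
  then have "e \<in> E2" using in1 notin by (auto simp: E2_def)
  then have B: "\<phi> w \<in> \<Union>(\<psi> ` E2) \<inter> (S - {\<phi> q})" using e w q inj_\<phi> notin by auto
  have "Topological_Spaces.connected (S - {\<phi> q})" unfolding S' by (rule connected_sphere_minus_point[OF S'(2)])
  then show False using connected_closedD[of "S - {\<phi> q}" "\<Union>(\<psi> ` E1)" "\<Union>(\<psi> ` E2)"] clo1 cover dis A B by blast
qed

lemma circles_share_le_2:
  assumes "S \<in> \<C>" "T \<in> \<C>" "u \<in> V" "v \<in> V" "w \<in> V" "u \<noteq> v" "u \<noteq> w" "v \<noteq> w"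
    "\<phi> u \<in> S \<inter> T" "\<phi> v \<in> S \<inter> T" "\<phi> w \<in> S \<inter> T"
  shows "S = T"
  using circle_eq_if_three_common[OF circle[OF assms(1)] circle[OF assms(2)] assms(9-11)] assms(3-8) by (simp add: inj_\<phi>)

end

section \<open>The order of the vertices along an inverted strand\<close>

text \<open>If the sequence turned back somewhere, the values before and after the turning point
  would be on the same side of it, and the nearer one would lie between it and the other.\<close>

lemma monotone_if_none_between:
  fixes a :: "nat \<Rightarrow> real"
  assumes inj: "inj_on a {..m}"
    and nb: "\<And>i j. i < m \<Longrightarrow> j \<le> m \<Longrightarrow> j \<noteq> i \<Longrightarrow> j \<noteq> Suc i \<Longrightarrow>
      \<not> (a i < a j \<and> a j < a (Suc i)) \<and> \<not> (a (Suc i) < a j \<and> a j < a i)"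
  shows "(\<forall>i<m. a i < a (Suc i)) \<or> (\<forall>i<m. a (Suc i) < a i)"
proof -
  have ne: "a i \<noteq> a j" if "i \<le> m" "j \<le> m" "i \<noteq> j" for i j using inj that by (auto simp: inj_on_def)
  have step: "(a i < a (Suc i)) = (a (Suc i) < a (Suc (Suc i)))" if "Suc (Suc i) \<le> m" for i
    using nb[of i "Suc (Suc i)"] nb[of "Suc i" i] ne[of i "Suc i"] ne[of "Suc i" "Suc (Suc i)"] ne[of i "Suc (Suc i)"] that
    by (auto simp: not_less order.order_iff_strict)
  have "(a 0 < a 1) = (a i < a (Suc i))" if "i < m" for i
    using that by (induction i) (use step in auto)
  then show ?thesis using ne by (metis Suc_leI less_imp_le linorder_less_linear n_not_Suc_n)
qed

lemma axis_line_minus: "axis_line (- v) = axis_line v"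
proof -
  have "of_real t * (- v) = of_real (- t) * v" "of_real t * v = of_real (- t) * (- v)" for t :: real by simp_all
  then show ?thesis unfolding axis_line_def by (metis (no_types, lifting) equalityI image_subsetI rangeI)
qed

lemma axis_line_unit_eq:
  assumes "norm v = 1" "norm v' = 1" "axis_line v = axis_line v'"
  shows "v' = v \<or> v' = - v"
proof -
  have "v' \<in> axis_line v'" unfolding axis_line_def by (rule range_eqI[of _ _ 1]) simp
  then have "v' \<in> axis_line v" using assms(3) by simp
  then obtain t :: real where t: "v' = of_real t * v" by (auto simp: axis_line_def)
  then have "\<bar>t\<bar> = 1" using assms by (simp add: norm_mult)
  then show ?thesis using t by (auto simp: abs_if split: if_splits)
qed

lemma invert_eqD:
  assumes "invert d d' z = invert d d' w" "z \<noteq> d'" "w \<noteq> d'"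
  shows "z = w"
  using assms inj_on_invert[of d d'] by (metis ComplI inj_onD singletonD)

context circle_realization
begin

text \<open>The inverted arc is connected, so its coordinate takes every value between
  \<open>a\<close> and \<open>b\<close>; a vertex with such a coordinate would be on the arc without
  being one of its ends.\<close>

lemma arc_no_between:
  assumes v: "norm v = 1" and im: "invert (\<phi> d) (\<phi> d') ` (S - {\<phi> d'}) = axis_line v"
    and xy: "adj x y" "col x y = S" "x \<noteq> d'" "y \<noteq> d'" "d' \<in> V" and w: "w \<in> V" "w \<noteq> x" "w \<noteq> y" "w \<noteq> d'"
    and a: "invert (\<phi> d) (\<phi> d') (\<phi> x) = of_real a * v" and b: "invert (\<phi> d) (\<phi> d') (\<phi> y) = of_real b * v"
    and c: "invert (\<phi> d) (\<phi> d') (\<phi> w) = of_real c * v"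
  shows "\<not> (a < c \<and> c < b)"
proof
  assume abc: "a < c \<and> c < b"
  let ?f = "invert (\<phi> d) (\<phi> d')"
  let ?g = "\<lambda>z. Re (cnj v * ?f z)"
  have A: "\<psi> {x, y} \<in> contact_arcs \<C>" using \<psi>_arc edge_iff xy by blast
  have d: "\<phi> d' \<notin> \<psi> {x, y}" using \<phi>_mem_arc_iff[OF xy(1)] xy by blast
  have "continuous_on (\<psi> {x, y}) ?g" by (intro continuous_intros continuous_on_invert d)
  then have con: "Topological_Spaces.connected (?g ` \<psi> {x, y})"
    using connected_continuous_image contact_arc_props(2)[OF A] by blast
  have "?g (\<phi> x) = a" "?g (\<phi> y) = b" unfolding a b coords_of_real_mult[OF v] by simp_all
  moreover have "\<phi> x \<in> \<psi> {x, y}" "\<phi> y \<in> \<psi> {x, y}" using \<phi>_mem_arc_iff[OF xy(1)] adj_in[OF xy(1)] by auto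
  ultimately have "a \<in> ?g ` \<psi> {x, y}" "b \<in> ?g ` \<psi> {x, y}" by (metis imageI)+
  then have "c \<in> ?g ` \<psi> {x, y}" using con abc unfolding connected_iff_interval by (meson less_imp_le)
  then obtain z where z: "z \<in> \<psi> {x, y}" "?g z = c" by auto
  have zd: "z \<noteq> \<phi> d'" using z d by auto
  have "z \<in> S" using z col_props[OF xy(1)] xy(2) by auto
  then have "?f z \<in> axis_line v" using zd im by blast
  then obtain t :: real where t: "?f z = of_real t * v" by (auto simp: axis_line_def)
  then have "t = c" using z(2) unfolding t coords_of_real_mult[OF v] by simp
  then have "?f z = ?f (\<phi> w)" using t c by simp
  moreover have "\<phi> w \<noteq> \<phi> d'" using w xy inj_\<phi> by blast
  ultimately have "z = \<phi> w" using invert_eqD zd by blast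
  then show False using z \<phi>_mem_arc_iff[OF xy(1) w(1)] w by auto
qed

text \<open>No vertex lies between two consecutive ones, so the coordinates are monotone. Passing
  from \<open>v\<close> to \<open>- v\<close> if necessary makes them increase from 0, and the
  strand becomes a ray.\<close>

lemma strand_ray:
  assumes d: "d \<in> V" "d' \<in> V" "d \<noteq> d'" and S: "S \<in> \<C>" "\<phi> d' \<in> S"
    and m: "0 < m" and x0: "x 0 = d" and xV: "\<And>i. i \<le> m \<Longrightarrow> x i \<in> V \<and> x i \<noteq> d'" and inj: "inj_on x {..m}"
    and step: "\<And>i. i < m \<Longrightarrow> adj (x i) (x (Suc i)) \<and> col (x i) (x (Suc i)) = S"
  obtains v p where "norm v = 1" "invert (\<phi> d) (\<phi> d') ` (S - {\<phi> d'}) = axis_line v"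
    "\<And>i. i \<le> m \<Longrightarrow> invert (\<phi> d) (\<phi> d') (\<phi> (x i)) = of_real (p i) * v"
    "p 0 = 0" "strict_mono_on {..m} p"
proof -
  let ?f = "invert (\<phi> d) (\<phi> d')"
  have xS: "\<phi> (x i) \<in> S" if "i \<le> m" for i
  proof (cases "i = m")
    case True
    then obtain j where "m = Suc j" using m by (cases m) auto
    then show ?thesis using step[of j] col_mem(2)[of "x j" "x (Suc j)"] True by auto
  next
    case False
    then show ?thesis using step[of i] col_mem(1)[of "x i" "x (Suc i)"] that by auto
  qed
  have "\<phi> d \<in> S" using xS[of 0] x0 by simp
  moreover have "\<phi> d \<noteq> \<phi> d'" using inj_\<phi> d by blast
  ultimately obtain v where v: "norm v = 1" "?f ` (S - {\<phi> d'}) = axis_line v"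
    using invert_circle_to_line[OF circle[OF S(1)] _ S(2)] by metis
  have "\<exists>t::real. ?f (\<phi> (x i)) = of_real t * v" if "i \<le> m" for i
  proof -
    have "\<phi> (x i) \<in> S - {\<phi> d'}" using xS that xV inj_\<phi> d by blast
    then have "?f (\<phi> (x i)) \<in> axis_line v" using v by blast
    then show ?thesis by (auto simp: axis_line_def)
  qed
  then obtain p :: "nat \<Rightarrow> real" where p: "\<And>i. i \<le> m \<Longrightarrow> ?f (\<phi> (x i)) = of_real (p i) * v" by metis
  have v0: "v \<noteq> 0" using v by auto
  have p0: "p 0 = 0" using p[of 0] x0 v0 by simp
  have injp: "inj_on p {..m}"
  proof (rule inj_onI)
    fix i j assume ij: "i \<in> {..m}" "j \<in> {..m}" "p i = p j"
    then have "?f (\<phi> (x i)) = ?f (\<phi> (x j))" using p by simp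
    moreover have "\<phi> (x i) \<noteq> \<phi> d'" "\<phi> (x j) \<noteq> \<phi> d'" using ij xV inj_\<phi> d by (meson atMost_iff)+
    ultimately have "\<phi> (x i) = \<phi> (x j)" by (rule invert_eqD)
    then have "x i = x j" using ij xV inj_\<phi> by (meson atMost_iff)
    then show "i = j" using inj ij by (auto simp: inj_on_def)
  qed
  have nbw: "\<not> (p i < p j \<and> p j < p (Suc i)) \<and> \<not> (p (Suc i) < p j \<and> p j < p i)"
    if ij: "i < m" "j \<le> m" "j \<noteq> i" "j \<noteq> Suc i" for i j
  proof -
    have ne: "x j \<noteq> x i" "x j \<noteq> x (Suc i)" using inj ij by (auto simp: inj_on_def)
    have a: "adj (x i) (x (Suc i))" "col (x i) (x (Suc i)) = S" using step ij by auto
    have b: "adj (x (Suc i)) (x i)" "col (x (Suc i)) (x i) = S" using a adj_sym col_sym by auto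
    have V: "x i \<noteq> d'" "x (Suc i) \<noteq> d'" "x j \<noteq> d'" "x j \<in> V" using xV ij by auto
    have P: "?f (\<phi> (x i)) = of_real (p i) * v" "?f (\<phi> (x (Suc i))) = of_real (p (Suc i)) * v" "?f (\<phi> (x j)) = of_real (p j) * v"
      using p ij by auto
    show ?thesis
      using arc_no_between[OF v a V(1,2) d(2) V(4) ne V(3) P] arc_no_between[OF v b V(2,1) d(2) V(4) ne(2,1) V(3) P(2,1,3)]
      by blast
  qed
  have mono: "strict_mono_on {..m} q" if "\<And>i. i < m \<Longrightarrow> q i < q (Suc i)" for q :: "nat \<Rightarrow> real"
  proof (rule strict_mono_onI)
    fix i j assume "i \<in> {..m}" "j \<in> {..m}" "i < j"
    then show "q i < q j"
    proof (induction j)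
      case (Suc j)
      then show ?case using that[of j] by (cases "i = j") auto
    qed simp
  qed
  from monotone_if_none_between[OF injp nbw] show ?thesis
  proof
    assume "\<forall>i<m. p i < p (Suc i)"
    then show ?thesis using that[OF v p p0 mono] by blast
  next
    assume "\<forall>i<m. p (Suc i) < p i"
    then have "strict_mono_on {..m} (\<lambda>i. - p i)" by (intro mono) auto
    then show ?thesis using that[of "- v" "\<lambda>i. - p i"] v p p0 by (simp add: axis_line_minus)
  qed
qed

text \<open>On a common ray the nearer of the two neighbours would lie between \<open>d\<close> and
  the farther one, that is, inside an edge that does not end in it.\<close>

lemma opposite_rays:
  assumes d: "d \<in> V" "d' \<in> V" "d \<noteq> d'"
    and v: "norm v = 1" "invert (\<phi> d) (\<phi> d') ` (S - {\<phi> d'}) = axis_line v"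
    and v': "norm v' = 1" "invert (\<phi> d) (\<phi> d') ` (S - {\<phi> d'}) = axis_line v'"
    and x: "adj d x" "col d x = S" "x \<noteq> d'" "invert (\<phi> d) (\<phi> d') (\<phi> x) = of_real a * v" "0 < a"
    and y: "adj d y" "col d y = S" "y \<noteq> d'" "invert (\<phi> d) (\<phi> d') (\<phi> y) = of_real b * v'" "0 < b"
    and "x \<noteq> y"
  shows "v' = - v"
proof (rule ccontr)
  assume "v' \<noteq> - v"
  then have eq: "v' = v" using axis_line_unit_eq[OF v(1) v'(1)] v v' by auto
  let ?f = "invert (\<phi> d) (\<phi> d')"
  have 0: "?f (\<phi> d) = of_real 0 * v" by simp
  have V: "x \<in> V" "y \<in> V" "x \<noteq> d" "y \<noteq> d" using adj_in adj_ne x(1) y(1) by blast+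
  have y4: "?f (\<phi> y) = of_real b * v" using y(4) eq by simp
  have "a \<noteq> b"
  proof
    assume "a = b"
    then have "?f (\<phi> x) = ?f (\<phi> y)" using x(4) y4 by simp
    moreover have "\<phi> x \<noteq> \<phi> d'" "\<phi> y \<noteq> \<phi> d'" using V x(3) y(3) d inj_\<phi> by blast+
    ultimately have "\<phi> x = \<phi> y" by (rule invert_eqD)
    then show False using V inj_\<phi> \<open>x \<noteq> y\<close> by blast
  qed
  moreover have "\<not> (0 < a \<and> a < b)"
    by (rule arc_no_between[OF v y(1,2) d(3) y(3) d(2) V(1,3) _ x(3) 0 y4 x(4)]) fact
  moreover have "\<not> (0 < b \<and> b < a)"
    by (rule arc_no_between[OF v x(1,2) d(3) x(3) d(2) V(2,4) _ y(3) 0 x(4) y4]) (use \<open>x \<noteq> y\<close> in simp)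
  ultimately show False using x(5) y(5) by linarith
qed

end

section \<open>The ladder graphs\<close>

text \<open>Four strands join the two poles: one edge, the points \<open>Pt False False k\<close>, the points
  \<open>Pt False True k\<close> followed by \<open>Pt True False k\<close>, and the points \<open>Pt True True k\<close>, where
  \<open>k \<le> N + 1\<close>. A gadget consists of two beads meeting at its \<open>Mid\<close>: \<open>Rung a k\<close> joins
  \<open>Pt a False k\<close> to \<open>Pt a True k\<close>, and \<open>Arch a h\<close> joins the first to the last point \<open>Pt a h k\<close>.
  A bead is a double edge, one of whose edges is subdivided by \<open>Inner g s 0\<close>, which carries an
  octahedron minus an edge with vertices \<open>Inner g s 1\<close>, ..., \<open>Inner g s 6\<close>.\<close>

datatype gadget = Rung bool nat | Arch bool bool

datatype vtx = Pole bool | Pt bool bool nat | Mid gadget | Inner gadget bool nat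

fun gend :: "nat \<Rightarrow> gadget \<Rightarrow> bool \<Rightarrow> vtx" where
  "gend N (Rung a k) s = Pt a s k"
| "gend N (Arch a h) s = Pt a h (if s then Suc N else 0)"

definition gadgets :: "nat \<Rightarrow> gadget set" where
  "gadgets N = {Rung a k | a k. 1 \<le> k \<and> k \<le> N} \<union> {Arch a h | a h. True}"

definition lverts :: "nat \<Rightarrow> vtx set" where
  "lverts N = range Pole \<union> {Pt a h k | a h k. k \<le> Suc N} \<union> Mid ` gadgets N \<union> {Inner g s i | g s i. g \<in> gadgets N \<and> i < 7}"

text \<open>Inverse to \<open>gend\<close>: every point of a strand is the end of exactly one bead,
  which belongs to an arch at the indices 0 and \<open>Suc N\<close> and to a rung
  otherwise.\<close>

definition bead_of :: "nat \<Rightarrow> bool \<Rightarrow> bool \<Rightarrow> nat \<Rightarrow> gadget \<times> bool" where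
  "bead_of N a h k = (if k = 0 then (Arch a h, False) else if k = Suc N then (Arch a h, True) else (Rung a k, h))"

definition prevv :: "nat \<Rightarrow> bool \<Rightarrow> bool \<Rightarrow> nat \<Rightarrow> vtx" where
  "prevv N a h k = (if k = 0 then (if a \<and> \<not> h then Pt False True (Suc N) else Pole False) else Pt a h (k - 1))"

definition nextv :: "nat \<Rightarrow> bool \<Rightarrow> bool \<Rightarrow> nat \<Rightarrow> vtx" where
  "nextv N a h k = (if k = Suc N then (if \<not> a \<and> h then Pt True False 0 else Pole True) else Pt a h (Suc k))"

text \<open>The antipodal pairs of the octahedron are 1 and 3, 2 and 4, 5 and 6. The edge from 1 to
  2 is missing and its ends are attached to the vertex 0.\<close>

definition pend :: "nat \<Rightarrow> nat list" where
  "pend i = (if i = 1 then [0,4,5,6] else if i = 2 then [0,3,5,6] else if i = 3 then [2,4,5,6]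
     else if i = 4 then [1,3,5,6] else [1,2,3,4])"

text \<open>The order in each list is the one in which \<open>pairing\<close> names the neighbours:
  strand edges before bead edges at a point, direct before subdivided edges at a midpoint.\<close>

fun nb :: "nat \<Rightarrow> vtx \<Rightarrow> vtx list" where
  "nb N (Pole b) = (if b then [Pole False, Pt False False (Suc N), Pt True False (Suc N), Pt True True (Suc N)]
     else [Pole True, Pt False False 0, Pt False True 0, Pt True True 0])"
| "nb N (Pt a h k) = [prevv N a h k, nextv N a h k, Mid (fst (bead_of N a h k)),
     Inner (fst (bead_of N a h k)) (snd (bead_of N a h k)) 0]"
| "nb N (Mid g) = [gend N g False, gend N g True, Inner g False 0, Inner g True 0]"
| "nb N (Inner g s i) = (if i = 0 then [gend N g s, Mid g, Inner g s 1, Inner g s 2] else map (Inner g s) (pend i))"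

definition ladder :: "nat \<Rightarrow> vtx pair_pre_digraph" where
  "ladder N = \<lparr>pverts = lverts N, parcs = {(u, w). u \<in> lverts N \<and> w \<in> set (nb N u)}\<rparr>"

lemma mem_gadgets [simp]: "Rung a k \<in> gadgets N \<longleftrightarrow> 1 \<le> k \<and> k \<le> N" "Arch a h \<in> gadgets N"
  by (auto simp: gadgets_def)

lemma mem_lverts [simp]:
  "Pole b \<in> lverts N" "Pt a h k \<in> lverts N \<longleftrightarrow> k \<le> Suc N" "Mid g \<in> lverts N \<longleftrightarrow> g \<in> gadgets N"
  "Inner g s i \<in> lverts N \<longleftrightarrow> g \<in> gadgets N \<and> i < 7"
  by (auto simp: lverts_def)

lemma gend_in: "g \<in> gadgets N \<Longrightarrow> gend N g s \<in> lverts N"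
  by (cases g) auto

lemma bead_of_in: "k \<le> Suc N \<Longrightarrow> fst (bead_of N a h k) \<in> gadgets N"
  by (auto simp: bead_of_def)

lemma gend_bead_of: "gend N (fst (bead_of N a h k)) (snd (bead_of N a h k)) = Pt a h k"
  by (auto simp: bead_of_def)

lemma bead_of_gend: "g \<in> gadgets N \<Longrightarrow> \<exists>a h k. gend N g s = Pt a h k \<and> bead_of N a h k = (g, s)"
  by (cases g) (auto simp: bead_of_def)

lemma less_7_cases: "(i::nat) < 7 \<longleftrightarrow> i = 0 \<or> i = 1 \<or> i = 2 \<or> i = 3 \<or> i = 4 \<or> i = 5 \<or> i = 6"
  by auto

lemma nb_in: "u \<in> lverts N \<Longrightarrow> w \<in> set (nb N u) \<Longrightarrow> w \<in> lverts N"
  by (cases u) (auto simp: gend_in bead_of_in prevv_def nextv_def pend_def split: if_splits)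

lemma nb_sym: "u \<in> lverts N \<Longrightarrow> w \<in> set (nb N u) \<Longrightarrow> u \<in> set (nb N w)"
proof (cases u)
  case (Pole b)
  then show "w \<in> set (nb N u) \<Longrightarrow> u \<in> set (nb N w)"
    by (auto simp: prevv_def nextv_def split: if_splits)
next
  case (Pt a h k)
  then show "u \<in> lverts N \<Longrightarrow> w \<in> set (nb N u) \<Longrightarrow> u \<in> set (nb N w)"
    using gend_bead_of[of N a h k]
    by (cases "snd (bead_of N a h k)") (auto simp: prevv_def nextv_def split: if_splits)
next
  case (Mid g)
  then show "u \<in> lverts N \<Longrightarrow> w \<in> set (nb N u) \<Longrightarrow> u \<in> set (nb N w)"
    using bead_of_gend[of g N True] bead_of_gend[of g N False] by auto
next
  case (Inner g s i)
  then show "u \<in> lverts N \<Longrightarrow> w \<in> set (nb N u) \<Longrightarrow> u \<in> set (nb N w)"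
    using bead_of_gend[of g N s] by (cases s) (auto simp: less_7_cases pend_def)
qed

lemma gend_ne: "g \<in> gadgets N \<Longrightarrow> gend N g False \<noteq> gend N g True"
  by (cases g) auto

lemma gend_simps: "gend N g s \<noteq> Pole b" "gend N g s \<noteq> Mid g'" "gend N g s \<noteq> Inner g' s' i"
  by (cases g; auto)+

lemma nb_distinct: "u \<in> lverts N \<Longrightarrow> distinct (nb N u) \<and> length (nb N u) = 4 \<and> u \<notin> set (nb N u)"
  by (cases u) (auto simp: gend_ne gend_simps gend_simps[symmetric] prevv_def nextv_def pend_def less_7_cases)

lemma finite_lverts: "finite (lverts N)"
proof -
  have g: "finite (gadgets N)"
  proof (rule finite_subset)
    show "gadgets N \<subseteq> (\<lambda>(a, k). Rung a k) ` (UNIV \<times> {..N}) \<union> (\<lambda>(a, h). Arch a h) ` UNIV"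
      by (auto simp: gadgets_def)
  qed simp
  show ?thesis
  proof (rule finite_subset)
    show "lverts N \<subseteq> range Pole \<union> (\<Union>a. \<Union>h. Pt a h ` {..Suc N}) \<union> Mid ` gadgets N
       \<union> (\<Union>g\<in>gadgets N. \<Union>s. Inner g s ` {..<7})"
      unfolding lverts_def by blast
  qed (use g in simp)
qed

lemma pair_graph_ladder: "pair_graph (ladder N)"
proof
  show "finite (pverts (ladder N))" by (simp add: ladder_def finite_lverts)
  have "parcs (ladder N) \<subseteq> lverts N \<times> lverts N" using nb_in by (auto simp: ladder_def)
  then show "finite (parcs (ladder N))" using finite_lverts by (meson finite_SigmaI finite_subset)
  have "(w, u) \<in> parcs (ladder N)" if "(u, w) \<in> parcs (ladder N)" for u w
    using that nb_sym[of u N w] nb_in[of u N w] by (simp add: ladder_def)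
  then show "symmetric (with_proj (ladder N))" unfolding symmetric_def with_proj_simps by (rule symI)
next
  fix e assume e: "e \<in> parcs (ladder N)"
  then show "fst e \<in> pverts (ladder N)" "snd e \<in> pverts (ladder N)"
    using nb_in[of "fst e" N "snd e"] by (auto simp: ladder_def)
  show "fst e \<noteq> snd e" using e nb_distinct[of "fst e" N] by (auto simp: ladder_def)
qed

lemma adj_ladder: "(u, w) \<in> parcs (ladder N) \<longleftrightarrow> u \<in> lverts N \<and> w \<in> set (nb N u)"
  by (simp add: ladder_def)

lemma pverts_ladder [simp]: "pverts (ladder N) = lverts N"
  by (simp add: ladder_def)

lemma regular_ladder: "regular_graph 4 (ladder N)"
  unfolding regular_graph_def
proof
  fix v assume v: "v \<in> pverts (ladder N)"
  then have "{e \<in> parcs (ladder N). fst e = v} = Pair v ` set (nb N v)" by (auto simp: ladder_def)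
  moreover have "card (Pair v ` set (nb N v)) = card (set (nb N v))" by (rule card_image) (simp add: inj_on_def)
  moreover have "card (set (nb N v)) = 4" using nb_distinct[of v N] v distinct_card by fastforce
  ultimately show "out_degree (with_proj (ladder N)) v = 4" by (simp add: out_degree_def out_arcs_def)
qed

lemma reaches_pole: "u \<in> lverts N \<Longrightarrow> (u, Pole False) \<in> (parcs (ladder N))\<^sup>*"
proof -
  let ?R = "parcs (ladder N)"
  have step: "(u, Pole False) \<in> ?R\<^sup>*" if "(w, Pole False) \<in> ?R\<^sup>*" "w \<in> set (nb N u)" "u \<in> lverts N" for u w
    using that by (meson adj_ladder converse_rtrancl_into_rtrancl)
  have P0: "(Pt a h k, Pole False) \<in> ?R\<^sup>*" if "k \<le> Suc N" "\<not> (a \<and> \<not> h)" for a h k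
    using that(1)
  proof (induction k)
    case 0
    show ?case by (rule step[of "Pole False"]) (use that in \<open>auto simp: prevv_def\<close>)
  next
    case (Suc k)
    show ?case by (rule step[of "Pt a h k"]) (use Suc in \<open>auto simp: prevv_def\<close>)
  qed
  have P1: "(Pt True False k, Pole False) \<in> ?R\<^sup>*" if "k \<le> Suc N" for k
    using that
  proof (induction k)
    case 0
    show ?case by (rule step[of "Pt False True (Suc N)"]) (use P0 in \<open>auto simp: prevv_def\<close>)
  next
    case (Suc k)
    show ?case by (rule step[of "Pt True False k"]) (use Suc in \<open>auto simp: prevv_def\<close>)
  qed
  have Pt: "(Pt a h k, Pole False) \<in> ?R\<^sup>*" if "k \<le> Suc N" for a h k using P0[of k a h] P1 that by (cases "a \<and> \<not> h") auto
  have Mid: "(Mid g, Pole False) \<in> ?R\<^sup>*" if g: "g \<in> gadgets N" for g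
  proof -
    obtain a h k where e: "gend N g True = Pt a h k" using bead_of_gend[OF g] by blast
    have "k \<le> Suc N" using gend_in[OF g, of True] e by simp
    then show ?thesis by (rule step[OF Pt[of k a h]]) (use e g in simp_all)
  qed
  have I0: "(Inner g s 0, Pole False) \<in> ?R\<^sup>*" if "g \<in> gadgets N" for g s
    by (rule step[OF Mid[OF that]]) (use that in auto)
  have I1: "(Inner g s i, Pole False) \<in> ?R\<^sup>*" if "g \<in> gadgets N" "i = 1 \<or> i = 2" for g s i
    by (rule step[OF I0[OF that(1)]]) (use that in \<open>auto simp: pend_def\<close>)
  have I2: "(Inner g s i, Pole False) \<in> ?R\<^sup>*" if "g \<in> gadgets N" "i = 4 \<or> i = 5 \<or> i = 6" for g s i
    by (rule step[OF I1[OF that(1), of 1]]) (use that in \<open>auto simp: pend_def\<close>)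
  have I3: "(Inner g s 3, Pole False) \<in> ?R\<^sup>*" if "g \<in> gadgets N" for g s
    by (rule step[OF I1[OF that(1), of 2]]) (use that in \<open>auto simp: pend_def\<close>)
  have Pole: "(Pole b, Pole False) \<in> ?R\<^sup>*" for b by (cases b) (auto intro: step[of "Pole False"])
  show "u \<in> lverts N \<Longrightarrow> (u, Pole False) \<in> ?R\<^sup>*"
    using Pole Pt Mid I0 I1 I2 I3 by (cases u) (auto simp: less_7_cases)
qed

section \<open>Ladder graphs are not realizable\<close>

locale ladder_realization = circle_realization "ladder N" \<C> \<phi> \<psi>
  for N :: nat and \<C> :: "complex set set" and \<phi> :: "vtx \<Rightarrow> complex" and \<psi> :: "vtx set \<Rightarrow> complex set" +
  assumes N_pos: "0 < N"
begin

lemma adj_iff: "adj u w \<longleftrightarrow> u \<in> lverts N \<and> w \<in> set (nb N u)"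
  by (rule adj_ladder)

lemma pairing:
  assumes "v \<in> lverts N" "nb N v = [a, b, c, d]"
  shows "col v a = col v b \<and> col v c = col v d \<and> col v a \<noteq> col v c \<or>
    col v a = col v c \<and> col v b = col v d \<and> col v a \<noteq> col v b \<or>
    col v a = col v d \<and> col v b = col v c \<and> col v a \<noteq> col v b"
proof -
  have "{w. adj v w} = {a, b, c, d}" using assms by (auto simp: adj_iff)
  then show ?thesis using col_pairing[of v a b c d] assms(1) by simp
qed

section \<open>Forced pairings: pendants, beads, strands\<close>

definition pendant :: "gadget \<Rightarrow> bool \<Rightarrow> vtx set" where
  "pendant g s = Inner g s ` {1..<7}"

lemma mem_pendant: "Inner g' s' i \<in> pendant g s \<longleftrightarrow> g' = g \<and> s' = s \<and> 1 \<le> i \<and> i < 7"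
  by (auto simp: pendant_def)

lemma pendant_closed:
  assumes "v \<in> pendant g s" "adj v w" shows "w \<in> insert (Inner g s 0) (pendant g s)"
proof -
  obtain i where i: "v = Inner g s i" "1 \<le> i" "i < 7" using assms(1) by (auto simp: pendant_def)
  have "\<forall>j \<in> set (pend i). j = 0 \<or> 1 \<le> j \<and> j < 7" by (auto simp: pend_def)
  moreover obtain j where "w = Inner g s j" "j \<in> set (pend i)" using assms(2) i by (auto simp: adj_iff)
  ultimately show ?thesis by (auto simp: mem_pendant)
qed

text \<open>\<open>Inner g s 0\<close> is the only exit from the pendant, so
  \<open>circle_vertices_closed\<close> applies with its image as the removed point.\<close>

lemma pendant_circle:
  assumes g: "g \<in> gadgets N" and w: "w \<in> lverts N" "\<phi> w \<in> col (Inner g s 0) (Inner g s 1)"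
  shows "w \<in> insert (Inner g s 0) (pendant g s)"
proof -
  have a: "adj (Inner g s 0) (Inner g s 1)" using g by (simp add: adj_iff)
  show ?thesis
    by (rule circle_vertices_closed[OF col_props(1)[OF a], of "pendant g s" "Inner g s 0" "Inner g s 1"])
      (use pendant_closed col_mem(2)[OF a] w g in \<open>auto simp: mem_pendant\<close>)
qed

lemma pass_through:
  assumes g: "g \<in> gadgets N"
  shows "col (Inner g s 0) (gend N g s) = col (Inner g s 0) (Mid g)"
    "col (Inner g s 0) (Inner g s 1) \<noteq> col (Inner g s 0) (Mid g)" "col (Inner g s 0) (Inner g s 2) \<noteq> col (Inner g s 0) (Mid g)"
proof -
  let ?q = "Inner g s 0"
  have a: "adj ?q (gend N g s)" "adj ?q (Mid g)" using g by (simp_all add: adj_iff)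
  have "gend N g s \<notin> insert ?q (pendant g s)" "Mid g \<notin> insert ?q (pendant g s)"
    by (cases g; auto simp: pendant_def)+
  then have "\<phi> (gend N g s) \<notin> col ?q (Inner g s 1)" "\<phi> (Mid g) \<notin> col ?q (Inner g s 1)"
    using pendant_circle[OF g, of "gend N g s" s] pendant_circle[OF g, of "Mid g" s] gend_in[OF g] g by auto
  then have "col ?q (gend N g s) \<noteq> col ?q (Inner g s 1)" "col ?q (Mid g) \<noteq> col ?q (Inner g s 1)"
    using col_mem(2)[OF a(1)] col_mem(2)[OF a(2)] by auto
  then show "col ?q (gend N g s) = col ?q (Mid g)" "col ?q (Inner g s 1) \<noteq> col ?q (Mid g)" "col ?q (Inner g s 2) \<noteq> col ?q (Mid g)"
    using pairing[of ?q "gend N g s" "Mid g" "Inner g s 1" "Inner g s 2"] g by auto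
qed

text \<open>Only the direct edge is used here; that the subdivided edge is on the same circle is
  shown in \<open>bead_cols\<close>.\<close>

definition bead :: "gadget \<Rightarrow> bool \<Rightarrow> complex set" where
  "bead g s = col (Mid g) (gend N g s)"

lemma adj_bead:
  assumes "g \<in> gadgets N"
  shows "adj (Mid g) (gend N g s)" "adj (Mid g) (Inner g s 0)" "adj (Inner g s 0) (gend N g s)" "adj (gend N g s) (Inner g s 0)" "adj (gend N g s) (Mid g)"
proof -
  show 1: "adj (Mid g) (gend N g s)" "adj (Mid g) (Inner g s 0)" "adj (Inner g s 0) (gend N g s)"
    using assms by (cases s; auto simp: adj_iff)+
  show "adj (gend N g s) (Inner g s 0)" "adj (gend N g s) (Mid g)" using 1 adj_sym by blast+
qed

lemma bead_cols:
  assumes g: "g \<in> gadgets N"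
  shows "col (Mid g) (Inner g s 0) = bead g s" "bead g False \<noteq> bead g True"
proof -
  note A = adj_bead[OF g]
  have q: "col (Mid g) (Inner g s 0) = col (Inner g s 0) (gend N g s)" for s
    using pass_through(1)[OF g] col_sym by metis
  have V: "gend N g False \<in> V" "gend N g True \<in> V" "Mid g \<in> V" using gend_in[OF g] g by auto
  have ne: "gend N g False \<noteq> gend N g True" "gend N g s \<noteq> Mid g" for s using gend_ne[OF g] gend_simps by auto
  have thru: "\<phi> (gend N g s) \<in> col (Mid g) (Inner g s 0)" "\<phi> (Mid g) \<in> col (Mid g) (Inner g s 0)" 
    "\<phi> (gend N g s) \<in> bead g s" "\<phi> (Mid g) \<in> bead g s" for s
    using q[of s] col_mem[OF A(3)[of s]] col_mem[OF A(1)[of s]] col_mem[OF A(2)[of s]] by (auto simp: bead_def)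
  have C: "col (Mid g) (Inner g s 0) \<in> \<C>" "bead g s \<in> \<C>" for s using col_props[OF A(2)] col_props[OF A(1)] by (auto simp: bead_def)
  have *: "S = T" if "S \<in> \<C>" "T \<in> \<C>" "\<phi> (gend N g False) \<in> S \<inter> T" "\<phi> (gend N g True) \<in> S \<inter> T" "\<phi> (Mid g) \<in> S \<inter> T" for S T
    using circles_share_le_2[OF that(1,2) V ne(1) ne(2) ne(2) that(3-5)] .
  \<comment> \<open>The three pairings at the midpoint. In the first and the third, two circles
    would share the midpoint and both ends, hence coincide, contrary to the pairing itself.\<close>
  consider "bead g False = bead g True" "col (Mid g) (Inner g False 0) = col (Mid g) (Inner g True 0)" "bead g False \<noteq> col (Mid g) (Inner g False 0)"
    | "bead g False = col (Mid g) (Inner g False 0)" "bead g True = col (Mid g) (Inner g True 0)" "bead g False \<noteq> bead g True"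
    | "bead g False = col (Mid g) (Inner g True 0)" "bead g True = col (Mid g) (Inner g False 0)" "bead g False \<noteq> bead g True"
    using pairing[of "Mid g" "gend N g False" "gend N g True" "Inner g False 0" "Inner g True 0"] g by (auto simp: bead_def)
  then have "(\<forall>s. col (Mid g) (Inner g s 0) = bead g s) \<and> bead g False \<noteq> bead g True"
  proof cases
    case 1
    then have "bead g False = col (Mid g) (Inner g False 0)"
      using *[OF C(2)[of False] C(1)[of False]] thru[of False] thru[of True] by auto
    then show ?thesis using 1 by simp
  next
    case 2
    then show ?thesis by (metis (full_types))
  next
    case 3
    then have "bead g False = bead g True"
      using *[OF C(2)[of False] C(2)[of True]] thru[of False] thru[of True] by auto
    then show ?thesis using 3 by simp
  qed
  then show "col (Mid g) (Inner g s 0) = bead g s" "bead g False \<noteq> bead g True" by auto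
qed

lemma bead_in: "g \<in> gadgets N \<Longrightarrow> bead g s \<in> \<C>"
  unfolding bead_def by (rule col_props[OF adj_bead(1)])

lemma bead_mem:
  assumes "g \<in> gadgets N"
  shows "\<phi> (gend N g s) \<in> bead g s" "\<phi> (Mid g) \<in> bead g s" 
  using col_mem[OF adj_bead(1)[OF assms]] by (auto simp: bead_def)

lemma strand_straight:
  assumes "k \<le> Suc N"
  shows "col (Pt a h k) (prevv N a h k) = col (Pt a h k) (nextv N a h k)"
    "col (Pt a h k) (prevv N a h k) \<noteq> bead (fst (bead_of N a h k)) (snd (bead_of N a h k))"
proof -
  obtain g s where gs: "bead_of N a h k = (g, s)" by fastforce
  have g: "g \<in> gadgets N" and e: "gend N g s = Pt a h k" using bead_of_in[OF assms, of a h] gend_bead_of[of N a h k] gs by auto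
  have "col (Pt a h k) (Mid g) = bead g s" using e by (simp add: bead_def col_sym)
  moreover have "col (Pt a h k) (Inner g s 0) = bead g s"
    using pass_through(1)[OF g, of s] bead_cols(1)[OF g, of s] e col_sym by metis
  ultimately show "col (Pt a h k) (prevv N a h k) = col (Pt a h k) (nextv N a h k)"
    "col (Pt a h k) (prevv N a h k) \<noteq> bead (fst (bead_of N a h k)) (snd (bead_of N a h k))"
    using pairing[of "Pt a h k" "prevv N a h k" "nextv N a h k" "Mid g" "Inner g s 0"] assms gs by auto
qed

text \<open>At each of the three vertices the two remaining edges belong to the other circle, so
  following the circle of the bead never leaves them.\<close>

lemma bead_vertices:
  assumes g: "g \<in> gadgets N" and w: "w \<in> lverts N" "\<phi> w \<in> bead g s"
  shows "w = gend N g s \<or> w = Mid g \<or> w = Inner g s 0"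
proof -
  let ?K = "{gend N g s, Mid g, Inner g s 0}"
  obtain a h k where e: "gend N g s = Pt a h k" "bead_of N a h k = (g, s)" using bead_of_gend[OF g] by blast
  have k: "k \<le> Suc N" using gend_in[OF g, of s] e by simp
  have "w \<in> insert (Inner g s 0) ?K"
  proof (rule circle_vertices_closed[OF bead_in[OF g, of s], of ?K "Inner g s 0" "Mid g"])
    fix v u assume v: "v \<in> ?K" and u: "adj v u" "col v u = bead g s"
    consider "v = gend N g s" | "v = Mid g" | "v = Inner g s 0" using v by auto
    then show "u \<in> insert (Inner g s 0) ?K"
    proof cases
      case 1
      then have "u \<in> {prevv N a h k, nextv N a h k, Mid g, Inner g s 0}" using u(1) e by (auto simp: adj_iff)
      then show ?thesis using u(2) 1 e strand_straight[OF k, of a h] by auto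
    next
      case 2
      then have "u \<in> {gend N g False, gend N g True, Inner g False 0, Inner g True 0}" using u(1) by (auto simp: adj_iff)
      then show ?thesis using u(2) 2 bead_cols[OF g] by (cases s) (auto simp flip: bead_def)
    next
      case 3
      then have "u \<in> {gend N g s, Mid g, Inner g s 1, Inner g s 2}" using u(1) by (auto simp: adj_iff)
      moreover have "col (Inner g s 0) (Mid g) = bead g s" using bead_cols(1)[OF g, of s] col_sym by metis
      ultimately show ?thesis using u(2) 3 pass_through[OF g, of s] by auto
    qed
  qed (use w g bead_mem[OF g] in auto)
  then show ?thesis by auto
qed

text \<open>The strands as circles: \<open>(a, h) = (False, True)\<close> and \<open>(True, False)\<close> are the two halves of one strand.\<close>

definition strand :: "bool \<Rightarrow> bool \<Rightarrow> complex set" where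
  "strand a h = col (Pole False) (Pt (a \<and> h) (a \<noteq> h \<or> a) 0)"

lemma strand_eq: "strand True False = strand False True"
  by (simp add: strand_def)

lemma strand_col:
  assumes "k \<le> Suc N"
  shows "col (Pt a h k) (prevv N a h k) = strand a h" "col (Pt a h k) (nextv N a h k) = strand a h"
proof -
  \<comment> \<open>The first edge is a hypothesis because the second half of the middle strand
    obtains it from the last point of the first half, to which \<open>main\<close> has already been
    applied.\<close>
  have main: "col (Pt a h k) (prevv N a h k) = strand a h" 
    if base: "col (Pt a h 0) (prevv N a h 0) = strand a h" and "k \<le> Suc N" for a h k
    using that(2)
  proof (induction k)
    case 0
    show ?case by (rule base)
  next
    case (Suc k)
    then have "col (Pt a h k) (nextv N a h k) = strand a h" using strand_straight(1)[of k a h] by simp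
    then have "col (Pt a h k) (Pt a h (Suc k)) = strand a h" using Suc.prems by (simp add: nextv_def)
    then show ?case by (simp add: prevv_def col_sym)
  qed
  have "col (Pt a h 0) (prevv N a h 0) = strand a h"
  proof (cases "a \<and> \<not> h")
    case False
    then show ?thesis by (cases a; cases h) (auto simp: prevv_def strand_def col_sym)
  next
    case True
    have "col (Pt False True 0) (prevv N False True 0) = strand False True" by (simp add: prevv_def strand_def col_sym)
    then have "col (Pt False True (Suc N)) (prevv N False True (Suc N)) = strand False True" by (rule main) simp
    then have "col (Pt False True (Suc N)) (nextv N False True (Suc N)) = strand False True" using strand_straight(1) by simp
    then show ?thesis using True by (simp add: nextv_def prevv_def strand_eq col_sym)
  qed
  from main[OF this assms] show "col (Pt a h k) (prevv N a h k) = strand a h" .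
  then show "col (Pt a h k) (nextv N a h k) = strand a h" using strand_straight(1)[OF assms] by simp
qed

lemma adj_strand: "k \<le> Suc N \<Longrightarrow> adj (Pt a h k) (prevv N a h k)" "k \<le> Suc N \<Longrightarrow> adj (Pt a h k) (nextv N a h k)"
  by (auto simp: adj_iff)

lemma strand_props:
  shows "strand a h \<in> \<C>" "k \<le> Suc N \<Longrightarrow> \<phi> (Pt a h k) \<in> strand a h" "\<phi> (Pole b) \<in> strand a h"
proof -
  show 1: "\<phi> (Pt a h k) \<in> strand a h" if "k \<le> Suc N" for a h k using col_mem(1)[OF adj_strand(1)[OF that]] strand_col[OF that] by simp
  show "strand a h \<in> \<C>" using col_props(1)[OF adj_strand(1), of 0 a h] strand_col(1)[of 0 a h] by simp
  have "\<phi> (Pole False) \<in> strand a h" for a h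
    using col_mem(1)[of "Pole False" "Pt (a \<and> h) (a \<noteq> h \<or> a) 0"] by (cases a; cases h) (auto simp: strand_def adj_iff)
  moreover have "\<phi> (Pole True) \<in> strand a h" if "a \<or> \<not> h" for a h
    using col_mem(2)[OF adj_strand(2), of "Suc N" a h] strand_col(2)[of "Suc N" a h] that
    by (cases a; cases h) (simp_all add: nextv_def)
  then have "\<phi> (Pole True) \<in> strand a h" for a h using strand_eq by (metis (full_types))
  ultimately show "\<phi> (Pole b) \<in> strand a h" by (cases b) auto
qed

lemma pole_circle_ne_bead:
  assumes "g \<in> gadgets N" "\<phi> (Pole b) \<in> S" shows "S \<noteq> bead g s"
  using bead_vertices[OF assms(1), of "Pole b" s] assms(2) gend_simps(1)[of N g s b, symmetric] by auto

text \<open>Only the three vertices of the bead can be common points. The circles at the midpoint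
  are the two beads, those at the subdividing vertex the bead and a circle inside the pendant, and
  none of these passes through a pole. This is how beads become tangent to their strands.\<close>

lemma pole_circle_Int_bead:
  assumes g: "g \<in> gadgets N" and S: "S \<in> \<C>" "\<phi> (Pole b) \<in> S"
  shows "S \<inter> bead g s \<subseteq> {\<phi> (gend N g s)}"
proof
  fix y assume y: "y \<in> S \<inter> bead g s"
  have ne: "S \<noteq> bead g s'" for s' using pole_circle_ne_bead[OF g S(2)] .
  then have "y \<in> contact_points \<C>" using circles_Int_contact[OF S(1) bead_in[OF g, of s]] y by blast
  then obtain w where w: "w \<in> lverts N" "y = \<phi> w" using contact_\<phi> by auto
  then consider "w = gend N g s" | "w = Mid g" | "w = Inner g s 0" using bead_vertices[OF g w(1)] y by auto
  then show "y \<in> {\<phi> (gend N g s)}"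
  proof cases
    case 2
    have "S = bead g False \<or> S = bead g True"
      unfolding bead_def by (rule circles_at_vertex[OF adj_bead(1)[OF g] adj_bead(1)[OF g]])
        (use bead_cols(2)[OF g] S y w 2 in \<open>auto simp: bead_def\<close>)
    then show ?thesis using ne by auto
  next
    case 3
    have m: "col (Inner g s 0) (Mid g) = bead g s" using bead_cols(1)[OF g] col_sym by metis
    have adj: "adj (Inner g s 0) (Inner g s 1)" "adj (Inner g s 0) (Mid g)" using g by (simp_all add: adj_iff)
    have "S = col (Inner g s 0) (Inner g s 1) \<or> S = col (Inner g s 0) (Mid g)"
      by (rule circles_at_vertex[OF adj pass_through(2)[OF g] S(1)]) (use y w 3 in auto)
    then have "S = col (Inner g s 0) (Inner g s 1)" using m ne by auto
    then show ?thesis using pendant_circle[OF g, of "Pole b" s] S(2) by (auto simp: pendant_def)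
  qed (use w in auto)
qed

text \<open>The two circles at a strand point are the strand and a bead, and a bead passes through
  no pole.\<close>

lemma strand_point_circle:
  assumes "k \<le> Suc N" "S \<in> \<C>" "\<phi> (Pole b) \<in> S" "\<phi> (Pt a h k) \<in> S"
  shows "S = strand a h"
proof -
  obtain g s where gs: "bead_of N a h k = (g, s)" by fastforce
  have g: "g \<in> gadgets N" and e: "gend N g s = Pt a h k" using bead_of_in[OF assms(1), of a h] gend_bead_of[of N a h k] gs by auto
  have c: "col (Pt a h k) (Mid g) = bead g s" using e by (simp add: bead_def col_sym)
  have ne: "strand a h \<noteq> bead g s" using pole_circle_ne_bead[OF g strand_props(3)] .
  have "S = col (Pt a h k) (prevv N a h k) \<or> S = col (Pt a h k) (Mid g)"
    by (rule circles_at_vertex[OF adj_strand(1)[OF assms(1)] _ _ assms(2,4)])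
      (use adj_bead(5)[OF g, of s] e c ne strand_col(1)[OF assms(1)] in auto)
  then show ?thesis using strand_col(1)[OF assms(1)] c pole_circle_ne_bead[OF g assms(3)] by auto
qed

lemma beads_Int:
  assumes g: "g \<in> gadgets N" "g' \<in> gadgets N" and "(g, s) \<noteq> (g', s')"
  shows "bead g s \<inter> bead g' s' = (if g = g' then {\<phi> (Mid g)} else {})"
proof -
  have ne: "bead g s \<noteq> bead g' s'"
  proof
    assume eq: "bead g s = bead g' s'"
    then have "Mid g = Mid g'" using bead_vertices[OF g(2), of "Mid g" s'] bead_mem(2)[OF g(1), of s] g(1) gend_simps(2)[of N g' s' g] by auto
    then have "g = g'" by simp
    then have "s \<noteq> s'" using assms by auto
    then show False using eq \<open>g = g'\<close> bead_cols(2)[OF g(1)] by (cases s; cases s') auto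
  qed
  have "y = \<phi> (Mid g) \<and> g = g'" if y: "y \<in> bead g s \<inter> bead g' s'" for y
  proof -
    have "y \<in> contact_points \<C>" using circles_Int_contact[OF bead_in[OF g(1)] bead_in[OF g(2)] ne] y by blast
    then obtain w where w: "w \<in> lverts N" "y = \<phi> w" using contact_\<phi> by auto
    have "w = gend N g s \<or> w = Mid g \<or> w = Inner g s 0" "w = gend N g' s' \<or> w = Mid g' \<or> w = Inner g' s' 0"
      using bead_vertices[OF g(1) w(1)] bead_vertices[OF g(2) w(1)] y w by auto
    moreover have "gend N g s \<noteq> gend N g' s'"
      using bead_of_gend[OF g(1), of s] bead_of_gend[OF g(2), of s'] assms(3) by auto
    ultimately show ?thesis using w assms(3) gend_simps by auto
  qed
  moreover have "\<phi> (Mid g) \<in> bead g s \<inter> bead g' s'" if "g = g'" using that bead_mem(2)[OF g(1)] by auto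
  ultimately show ?thesis by auto
qed

end

context ladder_realization
begin

abbreviation f :: "complex \<Rightarrow> complex" where
  "f \<equiv> invert (\<phi> (Pole False)) (\<phi> (Pole True))"

text \<open>The two halves of the middle strand are handled as one path, which gives them the same
  unit vector.\<close>

lemma strand_rays:
  obtains vv :: "bool \<Rightarrow> bool \<Rightarrow> complex" and pp :: "bool \<Rightarrow> bool \<Rightarrow> nat \<Rightarrow> real" where
    "\<And>a h. norm (vv a h) = 1"
    "\<And>a h. f ` (strand a h - {\<phi> (Pole True)}) = axis_line (vv a h)"
    "\<And>a h k. k \<le> Suc N \<Longrightarrow> f (\<phi> (Pt a h k)) = of_real (pp a h k) * vv a h"
    "\<And>a h. 0 < pp a h 0"
    "\<And>a h k l. k < l \<Longrightarrow> l \<le> Suc N \<Longrightarrow> pp a h k < pp a h l"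
    "vv True False = vv False True"
proof -
  have simple: "\<exists>v p. norm v = 1 \<and> f ` (strand a a - {\<phi> (Pole True)}) = axis_line v \<and>
      (\<forall>k \<le> Suc N. f (\<phi> (Pt a a k)) = of_real (p k) * v) \<and> 0 < p 0 \<and> (\<forall>k l. k < l \<longrightarrow> l \<le> Suc N \<longrightarrow> p k < p l)" for a
  proof -
    define x where "x i = (if i = 0 then Pole False else Pt a a (i - 1))" for i
    obtain v p where *: "norm v = 1" "f ` (strand a a - {\<phi> (Pole True)}) = axis_line v"
      "\<And>i. i \<le> Suc (Suc N) \<Longrightarrow> f (\<phi> (x i)) = of_real (p i) * v" "p 0 = 0" "strict_mono_on {..Suc (Suc N)} p"
    proof (rule strand_ray[of "Pole False" "Pole True" "strand a a" "Suc (Suc N)" x])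
      show "inj_on x {..Suc (Suc N)}" by (auto simp: inj_on_def x_def)
      fix i assume i: "i < Suc (Suc N)"
      show "adj (x i) (x (Suc i)) \<and> col (x i) (x (Suc i)) = strand a a"
      proof (cases i)
        case 0
        then show ?thesis by (cases a) (auto simp: x_def strand_def adj_iff)
      next
        case (Suc j)
        then have "x i = Pt a a j" "x (Suc i) = nextv N a a j" using i by (auto simp: x_def nextv_def)
        then show ?thesis using adj_strand(2)[of j a a] strand_col(2)[of j a a] Suc i by auto
      qed
    qed (auto simp: strand_props x_def)
    have "f (\<phi> (Pt a a k)) = of_real (p (Suc k)) * v" if "k \<le> Suc N" for k using *(3)[of "Suc k"] that by (simp add: x_def)
    moreover have "p k < p l" if "k < l" "l \<le> Suc (Suc N)" for k l using *(5) that by (auto simp: strict_mono_on_def)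
    ultimately show ?thesis using *(1,2,4) by (intro exI[of _ v] exI[of _ "\<lambda>k. p (Suc k)"]) (auto, metis zero_less_Suc Suc_le_mono le0)
  qed
  \<comment> \<open>Index 0 is the pole, 1 to \<open>N + 2\<close> the first half and
    \<open>N + 3\<close> to \<open>2 * N + 4\<close> the second half; hence the shifts by 1 and by
    \<open>N + 3\<close> in \<open>pp\<close>.\<close>
  define x where "x i = (if i = 0 then Pole False else if i \<le> N + 2 then Pt False True (i - 1) else Pt True False (i - (N + 3)))" for i
  obtain v2 p2 where *: "norm v2 = 1" "f ` (strand False True - {\<phi> (Pole True)}) = axis_line v2"
    "\<And>i. i \<le> 2 * N + 4 \<Longrightarrow> f (\<phi> (x i)) = of_real (p2 i) * v2" "p2 0 = 0" "strict_mono_on {..2 * N + 4} p2"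
  proof (rule strand_ray[of "Pole False" "Pole True" "strand False True" "2 * N + 4" x])
    show "inj_on x {..2 * N + 4}" by (auto simp: inj_on_def x_def split: if_splits)
    fix i assume i: "i < 2 * N + 4"
    show "adj (x i) (x (Suc i)) \<and> col (x i) (x (Suc i)) = strand False True"
    proof (cases "i = 0")
      case True
      then show ?thesis by (auto simp: x_def strand_def adj_iff)
    next
      case False
      define h where "h = (i \<le> N + 2)"
      define j where "j = (if h then i - 1 else i - (N + 3))"
      have j: "j \<le> Suc N" "x i = Pt (\<not> h) h j" "x (Suc i) = nextv N (\<not> h) h j"
        using False i by (auto simp: x_def nextv_def h_def j_def Suc_diff_le)
      have "strand (\<not> h) h = strand False True" using strand_eq by (cases h) auto
      then show ?thesis using adj_strand(2)[OF j(1), of "\<not> h" h] strand_col(2)[OF j(1), of "\<not> h" h] j by simp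
    qed
  next
    fix i assume "i \<le> 2 * N + 4"
    then show "x i \<in> V \<and> x i \<noteq> Pole True" by (auto simp: x_def)
  qed (auto simp: strand_props x_def)
  have p2: "f (\<phi> (Pt False True k)) = of_real (p2 (Suc k)) * v2" "f (\<phi> (Pt True False k)) = of_real (p2 (k + (N + 3))) * v2"
    if "k \<le> Suc N" for k using *(3)[of "Suc k"] *(3)[of "k + (N + 3)"] that by (simp_all add: x_def)
  have mono2: "p2 k < p2 l" if "k < l" "l \<le> 2 * N + 4" for k l using *(5) that by (auto simp: strict_mono_on_def)
  from simple obtain v p where s: "\<And>a. norm (v a) = 1" "\<And>a. f ` (strand a a - {\<phi> (Pole True)}) = axis_line (v a)"
    "\<And>a k. k \<le> Suc N \<Longrightarrow> f (\<phi> (Pt a a k)) = of_real (p a k) * v a" "\<And>a. 0 < p a 0"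
    "\<And>a k l. k < l \<Longrightarrow> l \<le> Suc N \<Longrightarrow> p a k < p a l" by metis
  define vv where "vv a h = (if a = h then v a else v2)" for a h :: bool
  define pp where "pp a h k = (if a = h then p a k else if h then p2 (Suc k) else p2 (k + (N + 3)))" for a h k
  show ?thesis
  proof (rule that[of vv pp])
    fix a h
    show "norm (vv a h) = 1" using s * by (simp add: vv_def)
    show "f ` (strand a h - {\<phi> (Pole True)}) = axis_line (vv a h)"
      using s(2) *(2) strand_eq by (cases a; cases h) (simp_all add: vv_def)
    show "0 < pp a h 0" using s(4)[of a] mono2[of 0 "Suc 0"] mono2[of 0 "N + 3"] *(4) by (auto simp: pp_def)
    fix k
    show "k \<le> Suc N \<Longrightarrow> f (\<phi> (Pt a h k)) = of_real (pp a h k) * vv a h"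
      using s(3)[of k a] p2[of k] by (cases a; cases h) (simp_all add: vv_def pp_def)
    fix l assume "k < l" "l \<le> Suc N"
    then show "pp a h k < pp a h l" using s(5)[of k l a] mono2[of "Suc k" "Suc l"] mono2[of "k + (N + 3)" "l + (N + 3)"]
      by (auto simp: pp_def)
  next
    show "vv True False = vv False True" by (simp add: vv_def)
  qed
qed

lemma pole_not_in_bead: "g \<in> gadgets N \<Longrightarrow> \<phi> (Pole b) \<notin> bead g s"
  using pole_circle_ne_bead by blast

lemma pole_pairing:
  defines "s0 \<equiv> col (Pole False) (Pole True)"
  shows "s0 = strand False False \<and> strand False True = strand True True \<and> s0 \<noteq> strand False True \<or>
    s0 = strand False True \<and> strand False False = strand True True \<and> s0 \<noteq> strand False False \<or>
    s0 = strand True True \<and> strand False False = strand False True \<and> s0 \<noteq> strand False False"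
  unfolding s0_def strand_def using pairing[of "Pole False" "Pole True" "Pt False False 0" "Pt False True 0" "Pt True True 0"] by simp

end

locale ladder_rays = ladder_realization N \<C> \<phi> \<psi> for N \<C> \<phi> \<psi> +
  fixes vv :: "bool \<Rightarrow> bool \<Rightarrow> complex" and pp :: "bool \<Rightarrow> bool \<Rightarrow> nat \<Rightarrow> real"
  assumes vv: "norm (vv a h) = 1"
    and line: "f ` (strand a h - {\<phi> (Pole True)}) = axis_line (vv a h)"
    and pos: "k \<le> Suc N \<Longrightarrow> f (\<phi> (Pt a h k)) = of_real (pp a h k) * vv a h"
    and pp0: "0 < pp a h 0"
    and pp_mono: "k < l \<Longrightarrow> l \<le> Suc N \<Longrightarrow> pp a h k < pp a h l"
    and vv_eq: "vv True False = vv False True"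
begin

lemma pp_pos: "k \<le> Suc N \<Longrightarrow> 0 < pp a h k"
  using pp0[of a h] pp_mono[of 0 k a h] by (cases "k = 0") auto

lemma f_image_Int:
  assumes "\<phi> (Pole True) \<notin> A" "\<phi> (Pole True) \<notin> B"
  shows "f ` A \<inter> f ` B = f ` (A \<inter> B)"
  by (rule inj_on_image_Int[OF inj_on_invert, symmetric]) (use assms in auto)

definition bd :: "gadget \<Rightarrow> bool \<Rightarrow> complex set" where
  "bd g s = f ` bead g s"

lemma bd_circle: "g \<in> gadgets N \<Longrightarrow> is_circle (bd g s)"
  unfolding bd_def by (intro invert_circle circle bead_in pole_not_in_bead)

lemma bd_Int: "g \<in> gadgets N \<Longrightarrow> g' \<in> gadgets N \<Longrightarrow> (g, s) \<noteq> (g', s') \<Longrightarrow>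
    bd g s \<inter> bd g' s' = (if g = g' then {f (\<phi> (Mid g))} else {})"
  unfolding bd_def by (subst f_image_Int) (auto simp: pole_not_in_bead beads_Int)

text \<open>Stated for every circle through a pole, not only for strands, because
  \<open>strands_ne\<close> also needs it for the circle of the edge between the poles.\<close>

lemma bd_Int_line:
  assumes g: "g \<in> gadgets N" and S: "S \<in> \<C>" "\<phi> (Pole b) \<in> S" and e: "gend N g s = Pt a h k"
  shows "bd g s \<inter> f ` (S - {\<phi> (Pole True)}) = (if S = strand a h then {of_real (pp a h k) * vv a h} else {})"
proof -
  have k: "k \<le> Suc N" using gend_in[OF g, of s] e by simp
  have "bead g s \<inter> (S - {\<phi> (Pole True)}) = S \<inter> bead g s" using pole_not_in_bead[OF g] by auto
  also have "\<dots> = (if S = strand a h then {\<phi> (Pt a h k)} else {})"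
  proof (cases "S = strand a h")
    case True
    then have "\<phi> (Pt a h k) \<in> S \<inter> bead g s" using bead_mem(1)[OF g, of s] strand_props(2)[OF k, of a h] e by simp
    then have "S \<inter> bead g s = {\<phi> (Pt a h k)}" using pole_circle_Int_bead[OF g S, of s] e by auto
    then show ?thesis using True by simp
  next
    case False
    then have "\<phi> (Pt a h k) \<notin> S" using strand_point_circle[OF k S, of a h] by blast
    then have "S \<inter> bead g s = {}" using pole_circle_Int_bead[OF g S, of s] e by auto
    then show ?thesis using False by simp
  qed
  finally have "f ` (bead g s \<inter> (S - {\<phi> (Pole True)})) = (if S = strand a h then {f (\<phi> (Pt a h k))} else {})" by simp
  then show ?thesis unfolding bd_def using f_image_Int[of "bead g s" "S - {\<phi> (Pole True)}"] pole_not_in_bead[OF g] pos[OF k] by simp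
qed

text \<open>The excluded pair is the half of the middle strand that does not start at the pole; the
  other three have a first point adjacent to \<open>Pole False\<close>.\<close>

lemma opposite:
  assumes "\<not> (a \<and> \<not> h)" "\<not> (a' \<and> \<not> h')" "(a, h) \<noteq> (a', h')" "strand a h = strand a' h'"
  shows "vv a' h' = - vv a h"
proof -
  have A: "adj (Pole False) (Pt a h 0)" "col (Pole False) (Pt a h 0) = strand a h" if "\<not> (a \<and> \<not> h)" for a h
    using that by (cases a; cases h; simp add: adj_iff strand_def)+
  have ne: "Pt a h 0 \<noteq> Pt a' h' 0" using assms(3) by auto
  have d: "Pole False \<in> V" "Pole True \<in> V" "Pole False \<noteq> Pole True" by auto
  show ?thesis
    by (rule opposite_rays[OF d vv[of a h] line[of a h] vv[of a' h'] line[of a' h', folded assms(4)]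
          A[OF assms(1)] _ pos pp0 A(1)[OF assms(2)] _ _ pos pp0 ne]) (use A(2)[OF assms(2)] assms(4) in auto)
qed

text \<open>A rung from a strand to the opposite arc of the same circle would have to cross the other
  circle through the two poles.\<close>

lemma strands_ne: "strand a False \<noteq> strand a True"
proof
  assume eq: "strand a False = strand a True"
  define S where "S = col (Pole False) (Pole True)"
  have adjD: "adj (Pole False) (Pole True)" by (simp add: adj_iff)
  have S: "S \<in> \<C>" "\<phi> (Pole False) \<in> S" "\<phi> (Pole True) \<in> S"
    unfolding S_def using col_props[OF adjD] col_mem[OF adjD] by auto
  \<comment> \<open>By \<open>pole_pairing\<close>, if two strands share a circle, the edge between
    the poles belongs to the other circle at the pole.\<close>
  have Sne: "S \<noteq> strand a h" for h
    using pole_pairing eq strand_eq unfolding S_def by (cases a; cases h) auto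
  obtain t where t: "norm t = 1" "f ` (S - {\<phi> (Pole True)}) = axis_line t"
    by (rule invert_circle_to_line[OF circle[OF S(1)] S(2,3)]) (use inj_\<phi>[of "Pole False" "Pole True"] in auto)
  have opp: "vv a True = - vv a False"
  proof (cases a)
    case True
    then have "vv True True = - vv False True" using opposite[of False True True True] eq strand_eq by simp
    then show ?thesis using True vv_eq by simp
  next
    case False
    then show ?thesis using opposite[of False False False True] eq by simp
  qed
  let ?g = "Rung a 1"
  have g: "?g \<in> gadgets N" using N_pos by simp
  define K where "K = bd ?g False \<union> bd ?g True"
  have con: "Topological_Spaces.connected (bd ?g s)" for s
    using bd_circle[OF g, of s] by (auto simp: is_circle_def intro!: connected_sphere)
  have "bd ?g False \<inter> bd ?g True \<noteq> {}" using bd_Int[OF g g, of False True] by simp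
  then have conK: "Topological_Spaces.connected K" unfolding K_def by (intro connected_Un con)
  have dis: "bd ?g s \<inter> axis_line t = {}" for s using bd_Int_line[OF g S(1,2), of s a s 1] Sne t(2) by auto
  have mem: "of_real (pp a s 1) * vv a s \<in> bd ?g s" for s
    using bd_Int_line[OF g strand_props(1)[of a s] strand_props(3)[of False a s], of s a s 1] by auto
  \<comment> \<open>The signed distance from the line of \<open>S\<close>. It takes values of
    opposite signs, or 0, at the two tangency points, so it vanishes somewhere on the connected
    rung.\<close>
  define H where "H z = Im (cnj t * z)" for z
  have "Topological_Spaces.connected (H ` K)"
    unfolding H_def by (intro connected_continuous_image conK continuous_intros)
  moreover have "0 \<notin> H ` K" 
  proof
    assume "0 \<in> H ` K"
    then obtain z where z: "z \<in> K" "Im (cnj t * z) = 0" by (auto simp: H_def)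
    then have "z \<in> axis_line t" using mem_axis_line_iff[OF t(1)] by blast
    then show False using z(1) dis[of False] dis[of True] unfolding K_def by blast
  qed
  moreover have "pp a False 1 * H (vv a False) \<in> H ` K"
    using mem[of False] by (intro image_eqI[of _ _ "of_real (pp a False 1) * vv a False"]) (auto simp: K_def H_def algebra_simps)
  moreover have "- (pp a True 1 * H (vv a False)) \<in> H ` K"
    using mem[of True] opp by (intro image_eqI[of _ _ "of_real (pp a True 1) * vv a True"]) (auto simp: K_def H_def algebra_simps)
  moreover have "0 < pp a False 1" "0 < pp a True 1" by (simp_all add: pp_pos)
  ultimately have *: "\<And>x y z. x \<in> H ` K \<Longrightarrow> y \<in> H ` K \<Longrightarrow> x \<le> z \<Longrightarrow> z \<le> y \<Longrightarrow> z \<in> H ` K"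
      "0 \<notin> H ` K" "pp a False 1 * H (vv a False) \<in> H ` K" "- (pp a True 1 * H (vv a False)) \<in> H ` K"
      "0 < pp a False 1" "0 < pp a True 1" unfolding connected_iff_interval by blast+
  show False
  proof (cases "0 \<le> H (vv a False)")
    case True
    then show False using *(1)[OF *(4) *(3), of 0] *(2,5,6) by simp
  next
    case False
    then show False using *(1)[OF *(3) *(4), of 0] *(2,5,6) by (simp add: mult_le_0_iff)
  qed
qed

lemma ladder_too_long:
  assumes "Re (cnj (vv a False) * vv a True) \<le> 0"
  shows "N \<le> 20"
proof -
  let ?u = "vv a False" and ?w = "vv a True"
  have axis: "bd g s \<inter> axis_line (vv a' h') = (if strand a' h' = strand b h then {of_real (pp b h k) * vv b h} else {})"
    if "g \<in> gadgets N" "gend N g s = Pt b h k" for g s a' h' b h k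
    using bd_Int_line[OF that(1) strand_props(1)[of a' h'] strand_props(3)[of False a' h'] that(2)] line[of a' h'] by simp
  \<comment> \<open>On collinear rays, the point where an arch bead touches the line of
    \<open>vv a True\<close> would also be on the line of \<open>vv a False\<close>, which this bead
    misses.\<close>
  have ind: "Im (cnj ?u * ?w) \<noteq> 0"
  proof
    assume 0: "Im (cnj ?u * ?w) = 0"
    have "Im (cnj ?u * (of_real (pp a True 0) * ?w)) = pp a True 0 * Im (cnj ?u * ?w)" by (simp add: algebra_simps)
    then have "of_real (pp a True 0) * ?w \<in> axis_line ?u" using 0 mem_axis_line_iff[OF vv] by simp
    then have "of_real (pp a True 0) * ?w \<in> bd (Arch a True) False \<inter> axis_line ?u"
      using axis[of "Arch a True" False a True 0 a True] by auto
    then show False using axis[of "Arch a True" False a True 0 a False] strands_ne[of a] by auto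
  qed
  have ar: "bd (Arch a h) s \<inter> axis_line (vv a h) = {of_real (pp a h (if s then Suc N else 0)) * vv a h}"
    "bd (Arch a h) s \<inter> axis_line (vv a (\<not> h)) = {}" for h s
    using axis[of "Arch a h" s a h "if s then Suc N else 0"] strands_ne[of a] by (cases h; simp)+
  have ch: "bd (Rung a k) h \<inter> axis_line (vv a h) = {of_real (pp a h k) * vv a h}"
    "bd (Rung a k) h \<inter> axis_line (vv a (\<not> h)) = {}" if "k \<in> {1..N}" for h k
    using axis[of "Rung a k" h a h k] strands_ne[of a] that by (cases h; simp)+
  have arch: "arch (vv a h) (vv a (\<not> h)) (pp a h 0) (pp a h (Suc N)) (bd (Arch a h) False) (bd (Arch a h) True)" for h
    unfolding arch_def using ar[of h False] ar[of h True] bd_circle bd_Int[of "Arch a h" "Arch a h" False True] by auto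
  show ?thesis
  proof (rule no_long_ladder[OF vv[of a False] vv[of a True] ind assms, of N "pp a False" "pp a True" "\<lambda>k. bd (Rung a k) False" "\<lambda>k. bd (Rung a k) True"
        "pp a False 0" "pp a False (Suc N)" "bd (Arch a False) False" "bd (Arch a False) True"
        "pp a True 0" "pp a True (Suc N)" "bd (Arch a True) False" "bd (Arch a True) True"])
    show "arch ?u ?w (pp a False 0) (pp a False (Suc N)) (bd (Arch a False) False) (bd (Arch a False) True)" using arch[of False] by simp
    show "arch ?w ?u (pp a True 0) (pp a True (Suc N)) (bd (Arch a True) False) (bd (Arch a True) True)" using arch[of True] by simp
    show "0 < pp a False 0" "0 < pp a True 0" by (rule pp0)+
    fix k assume k: "k \<in> {1..N}"
    then have g: "Rung a k \<in> gadgets N" by simp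
    show "rung ?u ?w (pp a False k) (pp a True k) (bd (Rung a k) False) (bd (Rung a k) True)"
      unfolding rung_def using ch[OF k, of False] ch[OF k, of True] bd_circle[OF g] bd_Int[OF g g, of False True] by auto
    show "pp a False 0 < pp a False k" "pp a False k < pp a False (Suc N)" "pp a True 0 < pp a True k" "pp a True k < pp a True (Suc N)"
      using k by (auto intro: pp_mono)
    have "bd (Arch a h) s \<inter> bd (Rung a k) s' = {}" for h s s' using bd_Int[of "Arch a h" "Rung a k" s s'] g by simp
    then show "(bd (Arch a False) False \<union> bd (Arch a False) True \<union> bd (Arch a True) False \<union> bd (Arch a True) True) \<inter>
        (bd (Rung a k) False \<union> bd (Rung a k) True) = {}" by blast
  next
    fix j k assume "j \<in> {1..N}" "k \<in> {1..N}" "j \<noteq> k"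
    then show "bd (Rung a j) False \<inter> bd (Rung a k) False = {} \<and> bd (Rung a j) True \<inter> bd (Rung a k) True = {}"
      using bd_Int[of "Rung a j" "Rung a k" False False] bd_Int[of "Rung a j" "Rung a k" True True] by simp
  qed
qed

text \<open>The other two pairings at the pole would put both strands of one ladder on one circle,
  so the outer strands are opposite rays. The wedges share the middle ray, their cosines are
  negatives of each other, and one of them is at most 0.\<close>

lemma N_le: "N \<le> 20"
proof (cases "Re (cnj (vv False False) * vv False True) \<le> 0")
  case True
  then show ?thesis by (rule ladder_too_long)
next
  case False
  have "strand False False = strand True True"
    using pole_pairing strands_ne[of False] strands_ne[of True] strand_eq by auto
  then have "vv True True = - vv False False" by (intro opposite) auto
  then have "Re (cnj (vv True False) * vv True True) = - Re (cnj (vv False False) * vv False True)"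
    by (simp add: vv_eq algebra_simps)
  then show ?thesis using False ladder_too_long[of True] by simp
qed

end

lemma ladder_not_realizable:
  assumes "20 < N"
  shows "\<not> realizes \<C> (ladder N)"
proof
  assume "realizes \<C> (ladder N)"
  then obtain \<phi> \<psi> where R: "circle_system \<C>" "bij_betw \<phi> (pverts (ladder N)) (contact_points \<C>)"
    "bij_betw \<psi> (edge_set (ladder N)) (contact_arcs \<C>)"
    "\<forall>e \<in> edge_set (ladder N). \<psi> e \<inter> contact_points \<C> = \<phi> ` e" unfolding realizes_def by blast
  interpret ladder_realization N \<C> \<phi> \<psi>
    by (intro ladder_realization.intro circle_realization.intro ladder_realization_axioms.intro)
      (use R pair_graph_ladder regular_ladder assms in auto)
  obtain vv pp where "ladder_rays N \<C> \<phi> \<psi> vv pp"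
    by (rule strand_rays) (rule that, unfold_locales, assumption+)
  then interpret ladder_rays N \<C> \<phi> \<psi> vv pp .
  show False using N_le assms by simp
qed

section \<open>A straight-line drawing\<close>

definition lin :: "real \<Rightarrow> real \<Rightarrow> complex \<Rightarrow> real" where
  "lin \<alpha> \<beta> z = \<alpha> * Re z + \<beta> * Im z"

lemma lin_eq_inner: "lin \<alpha> \<beta> z = inner (Complex \<alpha> \<beta>) z"
  by (simp add: lin_def inner_complex_def)

text \<open>Serves for hulls that share one vertex: this vertex is the added boundary point of the
  open half-space.\<close>

lemma convex_insert_halfspace: "convex (insert x {z. inner a z < inner a x})"
proof (rule convexI)
  fix y z and u v :: real
  assume y: "y \<in> insert x {z. inner a z < inner a x}" and z: "z \<in> insert x {z. inner a z < inner a x}"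
    and uv: "0 \<le> u" "0 \<le> v" "u + v = 1"
  have le: "inner a y \<le> inner a x" "inner a z \<le> inner a x" using y z by auto
  have eq: "inner a (u *\<^sub>R y + v *\<^sub>R z) - inner a x = u * (inner a y - inner a x) + v * (inner a z - inner a x)"
    using uv(3) by (simp add: inner_add_right algebra_simps) (metis distrib_left mult.commute mult.right_neutral)
  consider "u = 0" | "v = 0" | "y = x" "z = x" | "0 < u" "0 < v" "inner a y < inner a x \<or> inner a z < inner a x"
    using y z uv by force
  then show "u *\<^sub>R y + v *\<^sub>R z \<in> insert x {z. inner a z < inner a x}"
  proof cases
    case 3
    then show ?thesis using uv by (metis insertI1 scaleR_add_left scaleR_one)
  next
    case 4
    have "u * (inner a y - inner a x) \<le> 0" "v * (inner a z - inner a x) \<le> 0" using uv le by (auto simp: mult_le_0_iff)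
    moreover have "u * (inner a y - inner a x) < 0 \<or> v * (inner a z - inner a x) < 0" using 4 by (auto simp: mult_less_0_iff)
    ultimately have "inner a (u *\<^sub>R y + v *\<^sub>R z) < inner a x" using eq by linarith
    then show ?thesis by simp
  qed (use uv y z in auto)
qed

text \<open>Two common elements would each have to be strictly below the other, so there is at most
  one. Without any, the maximum over \<open>A\<close> separates the hulls; with one, they are in
  opposite open half-spaces completed by its image.\<close>

lemma hulls_Int_subset:
  assumes fin: "finite A" "A \<noteq> {}" and sep: "\<And>u w. u \<in> A \<Longrightarrow> w \<in> B \<Longrightarrow> lin \<alpha> \<beta> (p u) < lin \<alpha> \<beta> (p w) \<or> u = w"
  shows "convex hull (p ` A) \<inter> convex hull (p ` B) \<subseteq> p ` (A \<inter> B)"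
proof (cases "A \<inter> B = {}")
  case True
  define a where "a = Complex \<alpha> \<beta>"
  define c where "c = Max ((\<lambda>u. inner a (p u)) ` A)"
  have "inner a (p u) \<le> c" if "u \<in> A" for u unfolding c_def using fin that by (intro Max_ge) auto
  then have 1: "convex hull (p ` A) \<subseteq> {z. inner a z \<le> c}" by (intro hull_minimal convex_halfspace_le) auto
  have "c \<in> (\<lambda>u. inner a (p u)) ` A" unfolding c_def using fin by (intro Max_in) auto
  then obtain u where u: "u \<in> A" "c = inner a (p u)" by auto
  have "c < inner a (p w)" if "w \<in> B" for w using sep[OF u(1) that] u True that by (auto simp: lin_eq_inner a_def)
  then have 2: "convex hull (p ` B) \<subseteq> {z. inner a z > c}" by (intro hull_minimal convex_halfspace_gt) auto
  show ?thesis using 1 2 by fastforce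
next
  case False
  then obtain k where k: "k \<in> A" "k \<in> B" by auto
  define a where "a = Complex \<alpha> \<beta>"
  have "p u \<in> insert (p k) {z. inner a z < inner a (p k)}" if "u \<in> A" for u
    using sep[OF that k(2)] by (auto simp: lin_eq_inner a_def)
  then have 1: "convex hull (p ` A) \<subseteq> insert (p k) {z. inner a z < inner a (p k)}"
    by (intro hull_minimal convex_insert_halfspace) auto
  have "p w \<in> insert (p k) {z. inner (- a) z < inner (- a) (p k)}" if "w \<in> B" for w
    using sep[OF k(1) that] by (auto simp: lin_eq_inner a_def)
  then have 2: "convex hull (p ` B) \<subseteq> insert (p k) {z. inner (- a) z < inner (- a) (p k)}"
    by (intro hull_minimal convex_insert_halfspace) auto
  show ?thesis using 1 2 k by fastforce
qed

text \<open>Injectivity follows from the rest: if \<open>p u = p w\<close>, an edge at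
  \<open>u\<close> avoiding \<open>w\<close> and an edge at \<open>w\<close> avoiding
  \<open>u\<close> meet there, hence in the image of a common further end, and an edge would be
  degenerate.\<close>

lemma planar_straight_line:
  fixes p :: "'a \<Rightarrow> complex"
  assumes G: "pair_graph G"
    and two: "\<And>w u. w \<in> pverts G \<Longrightarrow> \<exists>x. x \<noteq> u \<and> (w, x) \<in> parcs G"
    and nondeg: "\<And>u w. (u, w) \<in> parcs G \<Longrightarrow> p u \<noteq> p w"
    and cross: "\<And>e e'. e \<in> edge_set G \<Longrightarrow> e' \<in> edge_set G \<Longrightarrow> e \<noteq> e' \<Longrightarrow>
      convex hull (p ` e) \<inter> convex hull (p ` e') \<subseteq> p ` (e \<inter> e')"
  shows "planar_graph G"
proof -
  have in_hull: "p u \<in> convex hull (p ` e)" if "u \<in> e" for u e using that by (auto intro: hull_inc)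
  have edge: "{u, w} \<in> edge_set G" if "(u, w) \<in> parcs G" for u w using that by (auto simp: edge_set_def)
  have inj: "inj_on p (pverts G)"
  proof (rule inj_onI, rule ccontr)
    fix u w assume uw: "u \<in> pverts G" "w \<in> pverts G" "p u = p w" "u \<noteq> w"
    obtain x where x: "x \<noteq> w" "(u, x) \<in> parcs G" using two[OF uw(1)] by blast
    obtain y where y: "y \<noteq> u" "(w, y) \<in> parcs G" using two[OF uw(2)] by blast
    have "{u, x} \<noteq> {w, y}" using x y uw by (auto simp: doubleton_eq_iff)
    moreover have "p u \<in> convex hull (p ` {u, x}) \<inter> convex hull (p ` {w, y})"
      using in_hull[of u "{u, x}"] in_hull[of w "{w, y}"] uw(3) by simp
    ultimately obtain k where "k \<in> {u, x} \<inter> {w, y}" "p u = p k" using cross[OF edge[OF x(2)] edge[OF y(2)]] by blast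
    then have "p u = p x" using uw y by auto
    then show False using nondeg[OF x(2)] by simp
  qed
  \<comment> \<open>Edges are unordered, so an orientation is chosen in order to draw a
    segment.\<close>
  define ends where "ends e = (SOME uw. uw \<in> parcs G \<and> e = {fst uw, snd uw})" for e
  have ends: "ends e \<in> parcs G \<and> e = {fst (ends e), snd (ends e)}" if "e \<in> edge_set G" for e
    unfolding ends_def by (rule someI_ex) (use that in \<open>auto simp: edge_set_def\<close>)
  define \<gamma> where "\<gamma> e = linepath (p (fst (ends e))) (p (snd (ends e)))" for e
  have im: "path_image (\<gamma> e) = convex hull (p ` e)" if "e \<in> edge_set G" for e
  proof -
    have "p ` e = {p (fst (ends e)), p (snd (ends e))}" using ends[OF that] by (metis image_empty image_insert)
    then show ?thesis by (simp add: \<gamma>_def segment_convex_hull)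
  qed
  have "planar_drawing G p \<gamma>" unfolding planar_drawing_def
  proof (intro conjI ballI impI)
    show "inj_on p (pverts G)" by (rule inj)
    fix e assume e: "e \<in> edge_set G"
    have pe: "p ` e = {p (fst (ends e)), p (snd (ends e))}" using ends[OF e] by (metis image_empty image_insert)
    show "Path_Connected.arc (\<gamma> e)" unfolding \<gamma>_def using nondeg[of "fst (ends e)" "snd (ends e)"] ends[OF e] by (intro arc_linepath) auto
    show "{pathstart (\<gamma> e), pathfinish (\<gamma> e)} = p ` e" by (simp add: \<gamma>_def pe)
    have eV: "e \<subseteq> pverts G"
    proof -
      interpret pair_graph G by (rule G)
      have "fst (ends e) \<in> pverts G" "snd (ends e) \<in> pverts G" using ends[OF e] arc_fst_in_verts arc_snd_in_verts by blast+
      then show ?thesis using ends[OF e] by (metis empty_subsetI insert_subset)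
    qed
    show "path_image (\<gamma> e) \<inter> p ` pverts G = p ` e"
    proof
      show "p ` e \<subseteq> path_image (\<gamma> e) \<inter> p ` pverts G" using eV in_hull im[OF e] by auto
      show "path_image (\<gamma> e) \<inter> p ` pverts G \<subseteq> p ` e"
      proof (rule subsetI, rule ccontr)
        fix z assume z: "z \<in> path_image (\<gamma> e) \<inter> p ` pverts G" and no: "z \<notin> p ` e"
        then obtain w where w: "w \<in> pverts G" "z = p w" by auto
        obtain x where x: "(w, x) \<in> parcs G" using two[OF w(1)] by blast
        have "w \<notin> e" using w no by auto
        then have "e \<noteq> {w, x}" by auto
        moreover have "z \<in> convex hull (p ` {w, x})" using in_hull[of w "{w, x}"] w by simp
        ultimately have "z \<in> p ` (e \<inter> {w, x})" using cross[OF e edge[OF x]] z im[OF e] by blast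
        then show False using no by auto
      qed
    qed
    fix e' assume e': "e' \<in> edge_set G" "e \<noteq> e'"
    show "path_image (\<gamma> e) \<inter> path_image (\<gamma> e') \<subseteq> p ` (e \<inter> e')"
      unfolding im[OF e] im[OF e'(1)] by (rule cross[OF e e'])
  qed
  then show ?thesis unfolding planar_graph_def by blast
qed

text \<open>The drawing of a bead, in affine coordinates (in tenths) with respect to its end (label 7), its
  midpoint (label 8) and the vertex carrying the pendant octahedron (label 0).\<close>

definition loc_x :: "nat \<Rightarrow> int" where
  "loc_x i = (if i = 1 then 1 else if i = 2 then 4 else if i = 3 \<or> i = 6 then 3 else if i = 4 \<or> i = 5 then 2
     else if i = 8 then 10 else 0)"

definition loc_y :: "nat \<Rightarrow> int" where
  "loc_y i = (if i = 0 then 10 else if i = 5 then 6 else if i = 6 then 4 else if i < 5 then 5 else 0)"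

definition loc_edges :: "(nat \<times> nat) list" where
  "loc_edges = [(7,8),(7,0),(0,8),(0,1),(0,2),(1,4),(1,5),(1,6),(2,3),(2,5),(2,6),(3,4),(3,5),(3,6),(4,5),(4,6)]"

text \<open>Seven directions with both signs, such that any two of the sixteen edges are separated
  by one of them up to a common end. With integer coordinates this is decided by evaluation.\<close>

definition loc_functionals :: "(int \<times> int) list" where
  "loc_functionals = [(9,8),(-9,-8),(9,-8),(-9,8),(9,1),(-9,-1),(4,9),(-4,-9),(8,9),(-8,-9),(8,-9),(-8,9),(9,7),(-9,-7)]"

definition loc_less :: "int \<times> int \<Rightarrow> nat \<Rightarrow> nat \<Rightarrow> bool" where
  "loc_less l u w \<longleftrightarrow> u = w \<or> fst l * loc_x u + snd l * loc_y u < fst l * loc_x w + snd l * loc_y w"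

lemma loc_edges_separated:
  "\<forall>e\<in>set loc_edges. \<forall>e'\<in>set loc_edges. e = e' \<or> (\<exists>l\<in>set loc_functionals.
     loc_less l (fst e) (fst e') \<and> loc_less l (fst e) (snd e') \<and> loc_less l (snd e) (fst e') \<and> loc_less l (snd e) (snd e'))"
  by code_simp

definition aff :: "complex \<Rightarrow> complex \<Rightarrow> complex \<Rightarrow> complex \<Rightarrow> complex" where
  "aff A B Q z = A + of_real (Re z / 10) * (B - A) + of_real (Im z / 10) * (Q - A)"

definition loc :: "nat \<Rightarrow> complex" where
  "loc i = Complex (of_int (loc_x i)) (of_int (loc_y i))"

lemma aff_image_hull: "aff A B Q ` (convex hull S) = convex hull (aff A B Q ` S)"
proof -
  define h where "h z = of_real (Re z / 10) * (B - A) + of_real (Im z / 10) * (Q - A)" for z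
  have "linear h" by (rule linearI) (simp_all add: h_def scaleR_conv_of_real algebra_simps add_divide_distrib)
  moreover have "aff A B Q ` X = (\<lambda>z. A + z) ` (h ` X)" for X by (simp add: aff_def h_def image_image add.assoc)
  ultimately show ?thesis by (metis convex_hull_linear_image convex_hull_translation)
qed

definition det2 :: "complex \<Rightarrow> complex \<Rightarrow> real" where
  "det2 z w = Re z * Im w - Im z * Re w"

text \<open>Cramer's rule for the coordinate differences \<open>s\<close> and
  \<open>t\<close>.\<close>

lemma inj_aff:
  assumes "det2 (B - A) (Q - A) \<noteq> 0"
  shows "inj (aff A B Q)"
proof (rule injI)
  fix z w assume "aff A B Q z = aff A B Q w"
  then have eq: "Re (aff A B Q z) = Re (aff A B Q w)" "Im (aff A B Q z) = Im (aff A B Q w)" by simp_all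
  obtain s t where st: "s = Re z - Re w" "t = Im z - Im w" by simp
  have "s * Re (B - A) + t * Re (Q - A) = 10 * (Re (aff A B Q z) - Re (aff A B Q w))"
    "s * Im (B - A) + t * Im (Q - A) = 10 * (Im (aff A B Q z) - Im (aff A B Q w))"
    by (simp_all add: aff_def st algebra_simps diff_divide_distrib)
  then have "s * Re (B - A) + t * Re (Q - A) = 0" "s * Im (B - A) + t * Im (Q - A) = 0"
    using eq by auto
  then have "s * det2 (B - A) (Q - A) = 0" "t * det2 (B - A) (Q - A) = 0"
    unfolding det2_def by algebra+
  then show "z = w" using assms st by (simp add: complex_eq_iff)
qed

lemma lin_loc_less:
  assumes "loc_less l u w"
  shows "lin (of_int (fst l)) (of_int (snd l)) (loc u) < lin (of_int (fst l)) (of_int (snd l)) (loc w) \<or> u = w"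
proof -
  have eq: "lin (of_int (fst l)) (of_int (snd l)) (loc u) = of_int (fst l * loc_x u + snd l * loc_y u)" for u
    by (simp add: lin_def loc_def)
  show ?thesis using assms unfolding eq of_int_less_iff loc_less_def by blast
qed

lemma loc_hulls_Int:
  assumes "e \<in> set loc_edges" "e' \<in> set loc_edges" "e \<noteq> e'"
  shows "convex hull (loc ` {fst e, snd e}) \<inter> convex hull (loc ` {fst e', snd e'}) \<subseteq> loc ` ({fst e, snd e} \<inter> {fst e', snd e'})"
proof -
  obtain l where l: "loc_less l (fst e) (fst e')" "loc_less l (fst e) (snd e')" "loc_less l (snd e) (fst e')" "loc_less l (snd e) (snd e')"
    using loc_edges_separated assms by blast
  then show ?thesis by (intro hulls_Int_subset) (auto dest: lin_loc_less)
qed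

text \<open>At each corner of the surrounding triangle the functional \<open>l\<close> is smaller
  than at all other labels of edges, so an edge can contain a corner only as an end.\<close>

lemma loc_extreme:
  assumes e: "e \<in> set loc_edges" and i: "i = 0 \<or> i = 7 \<or> i = 8" and m: "loc i \<in> convex hull (loc ` {fst e, snd e})"
  shows "i = fst e \<or> i = snd e"
proof (rule ccontr)
  assume no: "\<not> ?thesis"
  define l :: "int \<times> int" where "l = (if i = 0 then (0, -1) else if i = 7 then (1, 1) else (-1, 1))"
  have "\<forall>e\<in>set loc_edges. \<forall>i\<in>{0,7,8}. i = fst e \<or> i = snd e \<or>
     loc_less (if i = 0 then (0, -1) else if i = 7 then (1, 1) else (-1, 1)) i (fst e) \<and>
     loc_less (if i = 0 then (0, -1) else if i = 7 then (1, 1) else (-1, 1)) i (snd e)" by code_simp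
  then have ll: "loc_less l i (fst e)" "loc_less l i (snd e)" using e i no unfolding l_def by blast+
  then have "convex hull (loc ` {i}) \<inter> convex hull (loc ` {fst e, snd e}) \<subseteq> loc ` ({i} \<inter> {fst e, snd e})"
    by (intro hulls_Int_subset) (auto dest: lin_loc_less)
  then show False using m no by auto
qed

lemma loc_in_triangle: "i < 9 \<Longrightarrow> loc i \<in> convex hull (loc ` {0, 7, 8})"
proof -
  assume i: "i < 9"
  have "\<forall>i\<in>set [0..<9]. 0 \<le> loc_x i \<and> 0 \<le> loc_y i \<and> loc_x i + loc_y i \<le> 10" by code_simp
  then have b: "0 \<le> loc_x i" "0 \<le> loc_y i" "loc_x i + loc_y i \<le> 10" using i by auto
  define s t where "s = real_of_int (loc_x i) / 10" and "t = real_of_int (loc_y i) / 10"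
  have st: "0 \<le> s" "0 \<le> t" "s + t \<le> 1" using b by (auto simp: s_def t_def simp flip: of_int_add add_divide_distrib)
  have "loc i = t *\<^sub>R loc 0 + (1 - s - t) *\<^sub>R loc 7 + s *\<^sub>R loc 8"
    by (simp add: loc_def complex_eq_iff s_def t_def) (simp add: loc_x_def loc_y_def)
  then show ?thesis using st unfolding image_insert image_empty convex_hull_3 by (intro CollectI exI[of _ t] exI[of _ "1 - s - t"] exI[of _ s]) auto
qed

lemma loc_inj: "e \<in> set loc_edges \<Longrightarrow> loc (fst e) \<noteq> loc (snd e)"
proof -
  assume "e \<in> set loc_edges"
  moreover have "\<forall>e\<in>set loc_edges. loc_x (fst e) \<noteq> loc_x (snd e) \<or> loc_y (fst e) \<noteq> loc_y (snd e)" by code_simp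
  ultimately show ?thesis by (auto simp: loc_def)
qed

section \<open>Coordinates of the drawing\<close>

text \<open>The first ladder takes the abscissae up to \<open>N + 1\<close>, the second those from
  \<open>N + 2\<close> on. The last point of the lowest strand and the first of the highest are
  moved to the far ends, so that all edges at the poles lead to abscissa 0 or
  \<open>2 * N + 3\<close>.\<close>

definition px :: "nat \<Rightarrow> bool \<Rightarrow> bool \<Rightarrow> nat \<Rightarrow> real" where
  "px N a h k = (if a \<and> (\<not> h \<or> k \<noteq> 0) then real N + 2 + real k else if \<not> a \<and> \<not> h \<and> k = Suc N then 2 * real N + 3 else real k)"

definition py :: "bool \<Rightarrow> bool \<Rightarrow> real" where
  "py a h = (if a then 2 else 0) + (if h then 2 else 0)"

text \<open>An arch is drawn on the side of its strand facing away from the rungs of its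
  ladder.\<close>

definition outward :: "bool \<Rightarrow> real" where
  "outward h = (if h then 1 else - 1)"

fun mid_x :: "nat \<Rightarrow> gadget \<Rightarrow> real" where
  "mid_x N (Rung a k) = px N a True k"
| "mid_x N (Arch a h) = (px N a h 0 + px N a h (Suc N)) / 2"

fun mid_y :: "gadget \<Rightarrow> real" where
  "mid_y (Rung a k) = py a False + 1"
| "mid_y (Arch a h) = py a h + outward h"

fun apex_x :: "nat \<Rightarrow> gadget \<Rightarrow> bool \<Rightarrow> real" where
  "apex_x N (Rung a k) s = px N a True k + 1 / 4"
| "apex_x N (Arch a h) s = (px N a h (if s then Suc N else 0) + mid_x N (Arch a h)) / 2"

text \<open>For an arch the apex is above or below the middle of the direct edge, whose height there
  is 1/2; the value 3/4 keeps the triangle from degenerating. For a rung the sideways shift by 1/4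
  does this.\<close>

fun apex_y :: "gadget \<Rightarrow> bool \<Rightarrow> real" where
  "apex_y (Rung a k) s = py a False + (if s then 3 / 2 else 1 / 2)"
| "apex_y (Arch a h) s = py a h + outward h * (3 / 4)"

definition end_pt :: "nat \<Rightarrow> gadget \<Rightarrow> bool \<Rightarrow> complex" where
  "end_pt N g s = (case g of Rung a k \<Rightarrow> Complex (px N a s k) (py a s)
     | Arch a h \<Rightarrow> Complex (px N a h (if s then Suc N else 0)) (py a h))"

fun pt :: "nat \<Rightarrow> vtx \<Rightarrow> complex" where
  "pt N (Pole b) = Complex (if b then 2 * real N + 4 else - 1) (- 2)"
| "pt N (Pt a h k) = Complex (px N a h k) (py a h)"
| "pt N (Mid g) = Complex (mid_x N g) (mid_y g)"
| "pt N (Inner g s i) = aff (end_pt N g s) (Complex (mid_x N g) (mid_y g)) (Complex (apex_x N g s) (apex_y g s)) (loc i)"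

lemma pt_gend: "pt N (gend N g s) = end_pt N g s"
  by (cases g) (simp_all add: end_pt_def)

lemma pt_apex: "pt N (Inner g s 0) = Complex (apex_x N g s) (apex_y g s)"
  by (simp add: aff_def loc_def loc_x_def loc_y_def)

definition bloc :: "nat \<Rightarrow> gadget \<Rightarrow> bool \<Rightarrow> nat \<Rightarrow> vtx" where
  "bloc N g s i = (if i = 7 then gend N g s else if i = 8 then Mid g else Inner g s i)"

lemma pt_bloc:
  "pt N (bloc N g s i) = aff (end_pt N g s) (Complex (mid_x N g) (mid_y g)) (Complex (apex_x N g s) (apex_y g s)) (loc i)"
  by (auto simp: bloc_def pt_gend aff_def loc_def loc_x_def loc_y_def diff_divide_distrib)

section \<open>Separating the blocks of the drawing\<close>

text \<open>A bead with its pendant counts as one triangle. Crossings then reduce to separating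
  pairs of blocks, each with at most three corners, and to one finite check inside a
  triangle.\<close>

datatype block = PoleEdge | LeftEdge bool bool | RightEdge bool bool | StrandEdge bool bool nat | JoinEdge | Bead gadget bool

fun bverts :: "nat \<Rightarrow> block \<Rightarrow> vtx set" where
  "bverts N PoleEdge = {Pole False, Pole True}"
| "bverts N (LeftEdge a h) = {Pole False, Pt a h 0}"
| "bverts N (RightEdge a h) = {Pole True, Pt a h (Suc N)}"
| "bverts N (StrandEdge a h k) = {Pt a h k, Pt a h (Suc k)}"
| "bverts N JoinEdge = {Pt False True (Suc N), Pt True False 0}"
| "bverts N (Bead g s) = {gend N g s, Mid g, Inner g s 0}"

fun valid :: "nat \<Rightarrow> block \<Rightarrow> bool" where
  "valid N PoleEdge = True"
| "valid N (LeftEdge a h) = (\<not> a \<or> h)"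
| "valid N (RightEdge a h) = (a \<or> \<not> h)"
| "valid N (StrandEdge a h k) = (k \<le> N)"
| "valid N JoinEdge = True"
| "valid N (Bead g s) = (g \<in> gadgets N)"

definition apart :: "nat \<Rightarrow> block \<Rightarrow> block \<Rightarrow> bool" where
  "apart N b b' \<longleftrightarrow> (\<exists>\<alpha> \<beta>. \<forall>u\<in>bverts N b. \<forall>w\<in>bverts N b'.
     lin \<alpha> \<beta> (pt N u) < lin \<alpha> \<beta> (pt N w) \<or> u = w)"

lemma apart_sym: "apart N b b' \<Longrightarrow> apart N b' b"
proof -
  have "lin (- \<alpha>) (- \<beta>) z = - lin \<alpha> \<beta> z" for \<alpha> \<beta> z by (simp add: lin_def)
  then show "apart N b b' \<Longrightarrow> apart N b' b" unfolding apart_def by (metis neg_less_iff_less)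
qed

lemma apartI:
  assumes "\<And>u w. u \<in> bverts N b \<Longrightarrow> w \<in> bverts N b' \<Longrightarrow> u \<noteq> w \<Longrightarrow> lin \<alpha> \<beta> (pt N u) < lin \<alpha> \<beta> (pt N w)"
  shows "apart N b b'"
  unfolding apart_def using assms by blast

declare pt.simps(4) [simp del]

lemmas coord_simps = lin_def px_def py_def outward_def end_pt_def pt_apex

context
  fixes N :: nat
  assumes N: "2 \<le> N"
begin

lemma apart_E0:
  assumes "valid N b" "b \<noteq> PoleEdge" shows "apart N PoleEdge b"
proof (cases b)
  case (LeftEdge a h)
  then show ?thesis using assms by (intro apartI[of _ _ _ "-1" 1]) (auto simp: coord_simps)
next
  case (RightEdge a h)
  then show ?thesis using assms by (intro apartI[of _ _ _ 1 1]) (auto simp: coord_simps)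
next
  case (StrandEdge a h k)
  then show ?thesis using assms by (intro apartI[of _ _ _ 0 1]) (auto simp: coord_simps)
next
  case JoinEdge
  then show ?thesis by (intro apartI[of _ _ _ 0 1]) (auto simp: coord_simps)
next
  case (Bead g s)
  then show ?thesis using assms by (intro apartI[of _ _ _ 0 1]; cases g) (auto simp: coord_simps)
qed (use assms in auto)

text \<open>The edges leave the pole with slopes \<open>py + 2\<close>; the separating line passes
  through the pole with the mean of the two slopes.\<close>

lemma apart_DL_DL:
  assumes "valid N (LeftEdge a h)" "valid N (LeftEdge a' h')" "LeftEdge a h \<noteq> LeftEdge a' h'"
  shows "apart N (LeftEdge a h) (LeftEdge a' h')"
  using assms N
  by (intro apartI[of _ _ _ "(if py a h < py a' h' then - 1 else 1) * ((py a h + py a' h') / 2 + 2)"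
      "if py a h < py a' h' then 1 else - 1"];
      cases a; cases h; cases a'; cases h'; auto simp: coord_simps split: if_splits)

lemma apart_DL_DR:
  assumes "valid N (LeftEdge a h)" "valid N (RightEdge a' h')"
  shows "apart N (LeftEdge a h) (RightEdge a' h')"
  using assms N
  by (intro apartI[of _ _ _ "1"
      "0"];
      cases a; cases h; cases a'; cases h'; auto simp: coord_simps split: if_splits)

text \<open>The weight 16 outweighs all differences in height, so the second coordinate decides only
  among points with abscissa 0. The same functional serves for arches, whose inner corners have
  abscissa at least 3/4.\<close>

lemma apart_DL_H:
  assumes "valid N (LeftEdge a h)" "valid N (StrandEdge a' h' k)"
  shows "apart N (LeftEdge a h) (StrandEdge a' h' k)"
  using assms N
  by (intro apartI[of _ _ _ "16"
      "if py a h \<le> py a' h' then 1 else - 1"];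
      cases a; cases h; cases a'; cases h'; auto simp: coord_simps split: if_splits)

lemma apart_DL_J:
  assumes "valid N (LeftEdge a h)"
  shows "apart N (LeftEdge a h) JoinEdge"
  using assms N
  by (intro apartI[of _ _ _ "1"
      "0"];
      cases a; cases h; auto simp: coord_simps split: if_splits)

lemma apart_DL_Ch:
  assumes "valid N (LeftEdge a h)" "valid N (Bead (Rung a' k) s)"
  shows "apart N (LeftEdge a h) (Bead (Rung a' k) s)"
  using assms N
  by (intro apartI[of _ _ _ "1"
      "0"];
      cases a; cases h; cases a'; cases s; auto simp: coord_simps split: if_splits)

lemma apart_DL_Ar:
  assumes "valid N (LeftEdge a h)"
  shows "apart N (LeftEdge a h) (Bead (Arch a' h') s)"
  using assms N
  by (intro apartI[of _ _ _ "16"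
      "if py a h \<le> py a' h' then 1 else - 1"];
      cases a; cases h; cases a'; cases h'; cases s; auto simp: coord_simps add_divide_distrib diff_divide_distrib split: if_splits)

lemma apart_DR_DR:
  assumes "valid N (RightEdge a h)" "valid N (RightEdge a' h')" "RightEdge a h \<noteq> RightEdge a' h'"
  shows "apart N (RightEdge a h) (RightEdge a' h')"
  using assms N
  by (intro apartI[of _ _ _ "(if py a h < py a' h' then 1 else - 1) * ((py a h + py a' h') / 2 + 2)"
      "if py a h < py a' h' then 1 else - 1"];
      cases a; cases h; cases a'; cases h'; auto simp: coord_simps split: if_splits)

lemma apart_DR_H:
  assumes "valid N (RightEdge a h)" "valid N (StrandEdge a' h' k)"
  shows "apart N (RightEdge a h) (StrandEdge a' h' k)"
  using assms N
  by (intro apartI[of _ _ _ "- 16"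
      "if py a h \<le> py a' h' then 1 else - 1"];
      cases a; cases h; cases a'; cases h'; auto simp: coord_simps split: if_splits)

lemma apart_DR_J:
  assumes "valid N (RightEdge a h)"
  shows "apart N (RightEdge a h) JoinEdge"
  using assms N
  by (intro apartI[of _ _ _ "- 1"
      "0"];
      cases a; cases h; auto simp: coord_simps split: if_splits)

lemma apart_DR_Ch:
  assumes "valid N (RightEdge a h)" "valid N (Bead (Rung a' k) s)"
  shows "apart N (RightEdge a h) (Bead (Rung a' k) s)"
  using assms N
  by (intro apartI[of _ _ _ "- 1"
      "0"];
      cases a; cases h; cases a'; cases s; auto simp: coord_simps split: if_splits)

lemma apart_DR_Ar:
  assumes "valid N (RightEdge a h)"
  shows "apart N (RightEdge a h) (Bead (Arch a' h') s)"
  using assms N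
  by (intro apartI[of _ _ _ "- 16"
      "if py a h \<le> py a' h' then 1 else - 1"];
      cases a; cases h; cases a'; cases h'; cases s; auto simp: coord_simps add_divide_distrib diff_divide_distrib split: if_splits)

lemma apart_H_H:
  assumes "valid N (StrandEdge a h k)" "valid N (StrandEdge a' h' k')" "StrandEdge a h k \<noteq> StrandEdge a' h' k'"
  shows "apart N (StrandEdge a h k) (StrandEdge a' h' k')"
  using assms N
  by (intro apartI[of _ _ _ "if py a h \<noteq> py a' h' then 0 else if a = a' \<and> k < k' \<or> \<not> a \<and> a' then 1 else - 1"
      "if py a h < py a' h' then 1 else if py a' h' < py a h then - 1 else 0"];
      cases a; cases h; cases a'; cases h'; auto simp: coord_simps split: if_splits)

lemma apart_H_J:
  assumes "valid N (StrandEdge a h k)"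
  shows "apart N (StrandEdge a h k) JoinEdge"
  using assms N
  by (intro apartI[of _ _ _ "if py a h \<noteq> 2 then 0 else if a then - 1 else 1"
      "if py a h < 2 then 1 else if py a h = 2 then 0 else - 1"];
      cases a; cases h; auto simp: coord_simps split: if_splits)

text \<open>At equal height the bead leaves the strand vertically; the factor 4 lets the heights 1/2
  and 1 of its apex and midpoint outweigh the shift of the apex by 1/4 along the strand.\<close>

lemma apart_H_Ch:
  assumes "valid N (StrandEdge a h k)" "valid N (Bead (Rung a' k') s)"
  shows "apart N (StrandEdge a h k) (Bead (Rung a' k') s)"
  using assms N
  by (intro apartI[of _ _ _ "if py a h \<noteq> py a' s then 0 else if a = a' \<and> k' \<le> k \<or> a \<and> \<not> a' then - 1 else 1"
      "if py a h < py a' s then 1 else if py a' s < py a h then - 1 else if s then - 4 else 4"];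
      cases a; cases h; cases a'; cases s; auto simp: coord_simps split: if_splits)

text \<open>The factor \<open>4 * (real N + 1)\<close> lets the heights 3/4 and 1 of an arch
  outweigh its horizontal extent, which is at most \<open>2 * N + 3\<close>.\<close>

lemma apart_H_Ar:
  assumes "valid N (StrandEdge a h k)"
  shows "apart N (StrandEdge a h k) (Bead (Arch a' h') s)"
  using assms N
  by (intro apartI[of _ _ _ "if py a h \<noteq> py a' h' then 0 else if a = a' \<and> \<not> s \<or> a \<and> \<not> a' then - 1 else 1"
      "if py a h < py a' h' then 1 else if py a' h' < py a h then - 1 else 4 * (real N + 1) * outward h'"];
      cases a; cases h; cases a'; cases h'; cases s; auto simp: coord_simps add_divide_distrib diff_divide_distrib split: if_splits)

lemma apart_J_Ch:
  assumes "valid N (Bead (Rung a k) s)"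
  shows "apart N JoinEdge (Bead (Rung a k) s)"
  using assms N
  by (intro apartI[of _ _ _ "if py a s \<noteq> 2 then 0 else if a then 1 else - 1"
      "if py a s < 2 then - 1 else if py a s = 2 then 0 else 1"];
      cases a; cases s; auto simp: coord_simps split: if_splits)

lemma apart_J_Ar:
  shows "apart N JoinEdge (Bead (Arch a h) s)"
  using N
  by (intro apartI[of _ _ _ "if py a h \<noteq> 2 then 0 else if a then 1 else - 1"
      "if py a h < 2 then - 1 else if py a h = 2 then 0 else 1"];
      cases a; cases h; cases s; auto simp: coord_simps add_divide_distrib diff_divide_distrib split: if_splits)

lemma apart_Ch_Ch:
  assumes "valid N (Bead (Rung a k) s)" "valid N (Bead (Rung a' k') s')" "Bead (Rung a k) s \<noteq> Bead (Rung a' k') s'"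
  shows "apart N (Bead (Rung a k) s) (Bead (Rung a' k') s')"
  using assms N
  by (intro apartI[of _ _ _ "if a = a' \<and> k = k' then 0 else if a = a' \<and> k < k' \<or> \<not> a \<and> a' then 1 else - 1"
      "if a = a' \<and> k = k' then (if s then - 1 else 1) else 0"];
      cases a; cases a'; cases s; cases s'; auto simp: coord_simps split: if_splits)

text \<open>An arch of the same ladder is on the outer side of its strand, where height dominates.
  An arch of the other ladder is either in the same horizontal strip beside the rungs or in another
  strip.\<close>

lemma apart_Ch_Ar:
  assumes "valid N (Bead (Rung a k) s)"
  shows "apart N (Bead (Rung a k) s) (Bead (Arch a' h') s')"
  using assms N
  by (intro apartI[of _ _ _ "if a = a' then (if s' then 1 else - 1) else if a = h' then (if a then - 1 else 1) else 0"
      "if a = a' then 4 * (real N + 1) * outward h' else if a = h' then 0 else if a then - 1 else 1"];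
      cases a; cases a'; cases h'; cases s; cases s'; auto simp: coord_simps add_divide_distrib diff_divide_distrib split: if_splits)

text \<open>The two arches on the middle strand both have ends at height 2 and are separated
  horizontally, as are the two beads of one arch; the remaining pairs differ in height.\<close>

lemma apart_Ar_Ar:
  assumes "Bead (Arch a h) s \<noteq> Bead (Arch a' h') s'"
  shows "apart N (Bead (Arch a h) s) (Bead (Arch a' h') s')"
  using assms N
  by (intro apartI[of _ _ _ "if a = a' \<and> h = h' then (if s then - 1 else 1) else if a \<noteq> a' \<and> h = a' \<and> h' = a then (if a then - 1 else 1) else 0"
      "if a = a' \<and> h = h' \<or> a \<noteq> a' \<and> h = a' \<and> h' = a then 0 else if \<not> a \<and> \<not> h \<or> a' \<and> h' then 1 else - 1"];
      cases a; cases h; cases a'; cases h'; cases s; cases s'; auto simp: coord_simps add_divide_distrib diff_divide_distrib split: if_splits)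

end

lemma block_exhaust:
  obtains "b = PoleEdge" | a h where "b = LeftEdge a h" | a h where "b = RightEdge a h" | a h k where "b = StrandEdge a h k" | "b = JoinEdge"
  | a k s where "b = Bead (Rung a k) s" | a h s where "b = Bead (Arch a h) s"
proof (cases b)
  case (Bead g s)
  then show thesis using that(6,7) by (cases g) auto
qed (use that in auto)

lemma apart_blocks:
  assumes N: "2 \<le> N" and b: "valid N b" "valid N b'" "b \<noteq> b'"
  shows "apart N b b'"
proof -
  consider "b = PoleEdge" | "b' = PoleEdge" | "b \<noteq> PoleEdge" "b' \<noteq> PoleEdge" by blast
  then have "apart N b b' \<or> apart N b' b"
  proof cases
    case 1
    then show ?thesis using apart_E0[OF N b(2)] b(3) by auto
  next
    case 2
    then show ?thesis using apart_E0[OF N b(1)] b(3) by auto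
  next
    case 3
    then show ?thesis using b
      by (cases b rule: block_exhaust; cases b' rule: block_exhaust;
          blast intro: apart_DL_DL[OF N] apart_DL_DR[OF N] apart_DL_H[OF N] apart_DL_J[OF N] apart_DL_Ch[OF N] apart_DL_Ar[OF N]
            apart_DR_DR[OF N] apart_DR_H[OF N] apart_DR_J[OF N] apart_DR_Ch[OF N] apart_DR_Ar[OF N]
            apart_H_H[OF N] apart_H_J[OF N] apart_H_Ch[OF N] apart_H_Ar[OF N] apart_J_Ch[OF N] apart_J_Ar[OF N]
            apart_Ch_Ch[OF N] apart_Ch_Ar[OF N] apart_Ar_Ar[OF N])
  qed
  then show ?thesis using apart_sym by blast
qed

lemma block_hulls_Int:
  assumes "2 \<le> N" "valid N b" "valid N b'" "b \<noteq> b'"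
  shows "convex hull (pt N ` bverts N b) \<inter> convex hull (pt N ` bverts N b') \<subseteq> pt N ` (bverts N b \<inter> bverts N b')"
proof -
  obtain \<alpha> \<beta> where ab: "\<forall>u\<in>bverts N b. \<forall>w\<in>bverts N b'. lin \<alpha> \<beta> (pt N u) < lin \<alpha> \<beta> (pt N w) \<or> u = w"
    using apart_blocks[OF assms] by (auto simp: apart_def)
  have "finite (bverts N b)" "bverts N b \<noteq> {}" by (cases b; simp)+
  then show ?thesis using ab by (intro hulls_Int_subset[of _ _ \<alpha> \<beta>]) auto
qed

lemma bead_det:
  assumes "g \<in> gadgets N"
  shows "det2 (Complex (mid_x N g) (mid_y g) - end_pt N g s) (Complex (apex_x N g s) (apex_y g s) - end_pt N g s) \<noteq> 0"
proof (cases g)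
  case (Rung a k)
  then show ?thesis using assms by (cases a; cases s) (auto simp: det2_def end_pt_def px_def py_def)
next
  case (Arch a h)
  then show ?thesis by (cases a; cases h; cases s) (auto simp: det2_def end_pt_def px_def py_def outward_def field_simps)
qed

definition bead_map :: "nat \<Rightarrow> gadget \<Rightarrow> bool \<Rightarrow> complex \<Rightarrow> complex" where
  "bead_map N g s = aff (end_pt N g s) (Complex (mid_x N g) (mid_y g)) (Complex (apex_x N g s) (apex_y g s))"

lemma pt_bloc_image: "pt N ` bloc N g s ` A = bead_map N g s ` loc ` A"
  by (simp add: image_image pt_bloc bead_map_def)

lemma inj_bead_map: "g \<in> gadgets N \<Longrightarrow> inj (bead_map N g s)"
  unfolding bead_map_def by (rule inj_aff[OF bead_det])

lemma bverts_bead: "bverts N (Bead g s) = bloc N g s ` {0, 7, 8}"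
  by (auto simp: bloc_def)

section \<open>From blocks back to edges\<close>

fun in_block :: "nat \<Rightarrow> vtx set \<Rightarrow> block \<Rightarrow> bool" where
  "in_block N e (Bead g s) \<longleftrightarrow> (\<exists>x\<in>set loc_edges. e = bloc N g s ` {fst x, snd x})"
| "in_block N e b \<longleftrightarrow> e = bverts N b"

lemma in_block_bverts: "(\<And>g s. b \<noteq> Bead g s) \<Longrightarrow> in_block N (bverts N b) b"
  by (cases b) auto

lemma pt_ne_block:
  assumes "\<And>g s. b \<noteq> Bead g s" "valid N b" "u \<in> bverts N b" "w \<in> bverts N b" "u \<noteq> w"
  shows "pt N u \<noteq> pt N w"
proof (cases b)
  case (StrandEdge a h k)
  then show ?thesis using assms(2-5) by (cases a; cases h) (auto simp: px_def split: if_splits)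
qed (use assms in \<open>auto simp: px_def split: if_splits\<close>)

lemma in_block_cases:
  assumes "in_block N e b"
  obtains "e = bverts N b" "\<And>e'. in_block N e' b \<Longrightarrow> e' = e" "\<And>g s. b \<noteq> Bead g s"
  | g s x where "b = Bead g s" "x \<in> set loc_edges" "e = bloc N g s ` {fst x, snd x}"
  using assms by (cases b) auto

lemma hull_in_block:
  assumes "in_block N e b" "valid N b"
  shows "convex hull (pt N ` e) \<subseteq> convex hull (pt N ` bverts N b)"
  using assms(1)
proof (cases rule: in_block_cases)
  case (2 g s x)
  have "\<forall>x\<in>set loc_edges. fst x < 9 \<and> snd x < 9" by code_simp
  then have "loc ` {fst x, snd x} \<subseteq> convex hull (loc ` {0, 7, 8})" using 2(2) loc_in_triangle by auto
  then have "convex hull (loc ` {fst x, snd x}) \<subseteq> convex hull (loc ` {0, 7, 8})" by (simp add: hull_minimal)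
  then show ?thesis unfolding 2 bverts_bead pt_bloc_image bead_map_def aff_image_hull[symmetric] by (rule image_mono)
qed auto

text \<open>Two blocks may share a corner that is no end of the edges considered; this shows that an
  edge inside a block contains such a corner only as an end.\<close>

lemma vertex_in_block:
  assumes e: "in_block N e b" "valid N b" and k: "k \<in> bverts N b" "pt N k \<in> convex hull (pt N ` e)"
  shows "k \<in> e"
  using e(1)
proof (cases rule: in_block_cases)
  case (2 g s x)
  then have g: "g \<in> gadgets N" using e by simp
  obtain i where i: "i = 0 \<or> i = 7 \<or> i = 8" "k = bloc N g s i" using k(1) unfolding 2(1) bverts_bead by auto
  have "bead_map N g s (loc i) \<in> bead_map N g s ` (convex hull (loc ` {fst x, snd x}))"
    using k(2) i pt_bloc[of N g s i] unfolding 2(3) pt_bloc_image by (simp add: bead_map_def aff_image_hull)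
  then have "loc i \<in> convex hull (loc ` {fst x, snd x})" using inj_bead_map[OF g] by (simp add: inj_image_mem_iff)
  then have "i = fst x \<or> i = snd x" by (rule loc_extreme[OF 2(2) i(1)])
  then show ?thesis using i 2 by auto
qed (use k in auto)

text \<open>The affine map onto the triangle of a bead is injective and commutes with hulls, so the
  finite check on the table carries over.\<close>

lemma same_block:
  assumes e: "in_block N e b" "in_block N e' b" "valid N b" "e \<noteq> e'"
  shows "convex hull (pt N ` e) \<inter> convex hull (pt N ` e') \<subseteq> pt N ` (e \<inter> e')"
  using e(1)
proof (cases rule: in_block_cases)
  case 1
  then show ?thesis using e by blast
next
  case (2 g s x)
  then have g: "g \<in> gadgets N" using e by simp
  obtain y where y: "y \<in> set loc_edges" "e' = bloc N g s ` {fst y, snd y}" using e(2) 2(1) by auto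
  have "x \<noteq> y" using e(4) 2 y by auto
  then have "convex hull (loc ` {fst x, snd x}) \<inter> convex hull (loc ` {fst y, snd y}) \<subseteq> loc ` ({fst x, snd x} \<inter> {fst y, snd y})"
    by (rule loc_hulls_Int[OF 2(2) y(1)])
  then have "bead_map N g s ` (convex hull (loc ` {fst x, snd x}) \<inter> convex hull (loc ` {fst y, snd y})) \<subseteq>
      bead_map N g s ` loc ` ({fst x, snd x} \<inter> {fst y, snd y})" by (rule image_mono)
  also have "\<dots> = pt N ` bloc N g s ` ({fst x, snd x} \<inter> {fst y, snd y})" by (simp only: pt_bloc_image)
  also have "\<dots> \<subseteq> pt N ` (e \<inter> e')" unfolding 2 y by blast
  finally show ?thesis unfolding image_Int[OF inj_bead_map[OF g]] unfolding 2 y pt_bloc_image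
    by (simp only: bead_map_def aff_image_hull)
qed

lemma edge_in_block:
  assumes "(u, w) \<in> parcs (ladder N)"
  shows "\<exists>b. valid N b \<and> in_block N {u, w} b"
proof -
  have u: "u \<in> lverts N" and w: "w \<in> set (nb N u)" using assms by (auto simp: adj_ladder)
  have bead: "\<exists>b. valid N b \<and> in_block N {bloc N g s i, bloc N g s j} b"
    if "g \<in> gadgets N" "(i, j) \<in> set loc_edges \<or> (j, i) \<in> set loc_edges" for g s i j
    using that by (intro exI[of _ "Bead g s"]) (force simp: insert_commute)
  have plain: "\<exists>b. valid N b \<and> in_block N {u, w} b" if "valid N b" "{u, w} = bverts N b" "\<And>g s. b \<noteq> Bead g s" for b
    using that in_block_bverts by metis
  show ?thesis
  proof (cases u)
    case (Pole b)
    obtain b' where "valid N b'" "{u, w} = bverts N b'" "\<And>g s. b' \<noteq> Bead g s"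
    proof -
      have "w = Pole (\<not> b) \<or> b \<and> (\<exists>a h. (a \<or> \<not> h) \<and> w = Pt a h (Suc N)) \<or> \<not> b \<and> (\<exists>a h. (\<not> a \<or> h) \<and> w = Pt a h 0)"
        using w Pole by (cases b) auto
      then consider "w = Pole (\<not> b)" | a h where "b" "a \<or> \<not> h" "w = Pt a h (Suc N)" | a h where "\<not> b" "\<not> a \<or> h" "w = Pt a h 0" by blast
      then show thesis
      proof cases
        case 1
        show ?thesis by (rule that[of PoleEdge]) (use 1 Pole in \<open>cases b; auto\<close>)+
      next
        case (2 a h)
        show ?thesis by (rule that[of "RightEdge a h"]) (use 2 Pole in auto)
      next
        case (3 a h)
        show ?thesis by (rule that[of "LeftEdge a h"]) (use 3 Pole in auto)
      qed
    qed
    then show ?thesis by (rule plain)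
  next
    case (Pt a h k)
    then have k: "k \<le> Suc N" using u by simp
    obtain g s where gs: "bead_of N a h k = (g, s)" by fastforce
    have g: "g \<in> gadgets N" and e: "gend N g s = Pt a h k" using bead_of_in[OF k, of a h] gend_bead_of[of N a h k] gs by auto
    consider "w = prevv N a h k" | "w = nextv N a h k" | "w = Mid g" | "w = Inner g s 0" using w Pt gs by auto
    then show ?thesis
    proof cases
      case 1
      define b where "b = (if k = 0 then if a \<and> \<not> h then JoinEdge else LeftEdge a h else StrandEdge a h (k - 1))"
      show ?thesis by (rule plain[of b]) (use 1 Pt k in \<open>auto simp: prevv_def b_def split: if_splits\<close>)
    next
      case 2
      define b where "b = (if k = Suc N then if \<not> a \<and> h then JoinEdge else RightEdge a h else StrandEdge a h k)"
      show ?thesis by (rule plain[of b]) (use 2 Pt k in \<open>auto simp: nextv_def b_def split: if_splits\<close>)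
    next
      case 3
      then show ?thesis using bead[OF g, of 7 8 s] Pt e by (simp add: bloc_def loc_edges_def)
    next
      case 4
      then show ?thesis using bead[OF g, of 7 0 s] Pt e by (simp add: bloc_def loc_edges_def)
    qed
  next
    case (Mid g)
    then have g: "g \<in> gadgets N" using u by simp
    obtain s where "w = gend N g s \<or> w = Inner g s 0" using w Mid by auto
    then show ?thesis using bead[OF g, of 8 7 s] bead[OF g, of 8 0 s] Mid by (auto simp: bloc_def loc_edges_def)
  next
    case (Inner g s i)
    then have g: "g \<in> gadgets N" "i < 7" using u by auto
    have tab: "\<forall>i\<in>set [1..<7]. \<forall>j\<in>set (pend i). j < 7 \<and> ((i, j) \<in> set loc_edges \<or> (j, i) \<in> set loc_edges)" by code_simp
    show ?thesis
    proof (cases "i = 0")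
      case True
      then have "w = gend N g s \<or> w = Mid g \<or> w = Inner g s 1 \<or> w = Inner g s 2" using w Inner by auto
      then show ?thesis using bead[OF g(1), of 0 7 s] bead[OF g(1), of 0 8 s] bead[OF g(1), of 0 1 s] bead[OF g(1), of 0 2 s] Inner True
        by (auto simp: bloc_def loc_edges_def)
    next
      case False
      then obtain j where j: "w = Inner g s j" "j \<in> set (pend i)" using w Inner by auto
      then have "j < 7" "(i, j) \<in> set loc_edges \<or> (j, i) \<in> set loc_edges" using tab g(2) False by auto
      then show ?thesis using bead[OF g(1), of i j s] Inner j(1) g(2) by (simp add: bloc_def)
    qed
  qed
qed

lemma planar_ladder:
  assumes N: "2 \<le> N"
  shows "planar_graph (ladder N)"
proof (rule planar_straight_line[OF pair_graph_ladder, of N "pt N"])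
  fix w u assume "w \<in> pverts (ladder N)"
  then have w: "w \<in> lverts N" by simp
  then obtain a b c d where "nb N w = [a, b, c, d]" "distinct [a, b, c, d]"
    using nb_distinct[of w N] by (auto simp: length_Suc_conv numeral_eq_Suc)
  then show "\<exists>x. x \<noteq> u \<and> (w, x) \<in> parcs (ladder N)" using w by (cases "u = a") (auto simp: adj_ladder)
next
  fix u w assume uw: "(u, w) \<in> parcs (ladder N)"
  then obtain b where b: "valid N b" "in_block N {u, w} b" using edge_in_block by blast
  have "u \<noteq> w" using uw nb_distinct[of u N] by (auto simp: adj_ladder)
  from b(2) show "pt N u \<noteq> pt N w"
  proof (cases rule: in_block_cases)
    case 1
    then show ?thesis using \<open>u \<noteq> w\<close> b(1) by (intro pt_ne_block[of b]) auto
  next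
    case (2 g s x)
    then have "inj (bead_map N g s)" using inj_bead_map b(1) by simp
    then have "bead_map N g s (loc (fst x)) \<noteq> bead_map N g s (loc (snd x))" using loc_inj[OF 2(2)] by (simp add: inj_eq)
    then have "pt N (bloc N g s (fst x)) \<noteq> pt N (bloc N g s (snd x))" by (simp add: pt_bloc bead_map_def)
    then show ?thesis using 2(3) by (auto simp: doubleton_eq_iff)
  qed
next
  fix e e' assume e: "e \<in> edge_set (ladder N)" "e' \<in> edge_set (ladder N)" "e \<noteq> e'"
  then obtain b b' where b: "valid N b" "in_block N e b" "valid N b'" "in_block N e' b'"
    using edge_in_block unfolding edge_set_def by blast
  show "convex hull (pt N ` e) \<inter> convex hull (pt N ` e') \<subseteq> pt N ` (e \<inter> e')"
  proof (cases "b = b'")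
    case True
    then show ?thesis using same_block b e(3) by simp
  next
    case False
    show ?thesis
    proof
      fix z assume z: "z \<in> convex hull (pt N ` e) \<inter> convex hull (pt N ` e')"
      \<comment> \<open>In the hulls of the whole blocks the common point is the image of a common
        corner \<open>k\<close>, which \<open>vertex_in_block\<close> then places in both
        edges.\<close>
      then have "z \<in> convex hull (pt N ` bverts N b) \<inter> convex hull (pt N ` bverts N b')"
        using hull_in_block[OF b(2,1)] hull_in_block[OF b(4,3)] by blast
      then obtain k where k: "k \<in> bverts N b" "k \<in> bverts N b'" "z = pt N k"
        using block_hulls_Int[OF N b(1,3) False] by blast
      then have "k \<in> e" "k \<in> e'" using vertex_in_block[OF b(2,1)] vertex_in_block[OF b(4,3)] z by auto
      then show "z \<in> pt N ` (e \<inter> e')" using k by blast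
    qed
  qed
qed

section \<open>The theorem\<close>

text \<open>The ladders have vertices of type \<open>vtx\<close>, while the class consists of graphs
  on \<open>nat\<close>; an injection carries all properties over.\<close>

definition map_graph :: "('a \<Rightarrow> 'b) \<Rightarrow> 'a pair_pre_digraph \<Rightarrow> 'b pair_pre_digraph" where
  "map_graph f G = \<lparr>pverts = f ` pverts G, parcs = map_prod f f ` parcs G\<rparr>"

lemma edge_set_eq_image: "edge_set G = (\<lambda>e. {fst e, snd e}) ` parcs G"
  by (force simp: edge_set_def)

context
  fixes f :: "'a \<Rightarrow> 'b" and G :: "'a pair_pre_digraph"
  assumes f: "inj f" and G: "pair_graph G"
begin

interpretation pair_graph G by (rule G)

lemma arc_map_graph: "(f u, f v) \<in> parcs (map_graph f G) \<longleftrightarrow> (u, v) \<in> parcs G"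
  using f by (auto simp: map_graph_def dest: injD)

lemma pair_graph_map_graph: "pair_graph (map_graph f G)"
proof
  show "finite (pverts (map_graph f G))" "finite (parcs (map_graph f G))" by (auto simp: map_graph_def)
  have "(w, u) \<in> parcs (map_graph f G)" if uw: "(u, w) \<in> parcs (map_graph f G)" for u w
  proof -
    obtain u' w' where "u = f u'" "w = f w'" "(u', w') \<in> parcs G" using uw by (auto simp: map_graph_def)
    moreover have "(w', u') \<in> parcs G"
      using pair_sym_arcs calculation unfolding symmetric_def with_proj_simps by (blast dest: symD)
    ultimately show ?thesis by (simp add: arc_map_graph)
  qed
  then show "symmetric (with_proj (map_graph f G))" unfolding symmetric_def with_proj_simps by (rule symI)
next
  fix e assume "e \<in> parcs (map_graph f G)"
  then obtain e' where e': "e' \<in> parcs G" "e = map_prod f f e'" by (auto simp: map_graph_def)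
  then have "fst e' \<in> pverts G" "snd e' \<in> pverts G" "fst e' \<noteq> snd e'"
    using arc_fst_in_verts arc_snd_in_verts pair_no_loops by auto
  then show "fst e \<in> pverts (map_graph f G)" "snd e \<in> pverts (map_graph f G)" "fst e \<noteq> snd e"
    using e' f by (auto simp: map_graph_def dest: injD)
qed

lemma regular_map_graph:
  assumes "regular_graph k G" shows "regular_graph k (map_graph f G)"
  unfolding regular_graph_def
proof
  fix w assume "w \<in> pverts (map_graph f G)"
  then obtain v where v: "v \<in> pverts G" "w = f v" by (auto simp: map_graph_def)
  have "{e \<in> parcs (map_graph f G). fst e = f v} = map_prod f f ` {e \<in> parcs G. fst e = v}"
    using f by (force simp: map_graph_def dest: injD)
  moreover have "card (map_prod f f ` {e \<in> parcs G. fst e = v}) = card {e \<in> parcs G. fst e = v}"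
    by (rule card_image) (meson f inj_on_subset prod.inj_map subset_UNIV)
  ultimately show "out_degree (with_proj (map_graph f G)) w = k"
    using assms v by (simp add: regular_graph_def out_degree_def out_arcs_def)
qed

lemma edge_set_map_graph: "edge_set (map_graph f G) = image f ` edge_set G"
  by (simp add: edge_set_eq_image map_graph_def image_image)

lemma planar_map_graph:
  assumes "planar_graph G" shows "planar_graph (map_graph f G)"
proof -
  obtain p \<gamma> where pl: "planar_drawing G p \<gamma>" using assms by (auto simp: planar_graph_def)
  let ?i = "inv f"
  have i: "?i (f x) = x" for x using f by simp
  have i2: "(p \<circ> ?i) ` (f ` A) = p ` A" for A by (simp add: image_image i)
  have i3: "?i ` (f ` A) = A" for A by (simp add: image_image i)
  have i4: "f ` A \<inter> f ` B = f ` (A \<inter> B)" for A B using f by (simp add: image_Int)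
  note pl = pl[unfolded planar_drawing_def]
  have "planar_drawing (map_graph f G) (p \<circ> ?i) (\<lambda>e. \<gamma> (?i ` e))"
    unfolding planar_drawing_def edge_set_map_graph
  proof (intro conjI ballI impI)
    show "inj_on (p \<circ> ?i) (pverts (map_graph f G))" using pl by (auto simp: map_graph_def inj_on_def i)
    fix e assume "e \<in> image f ` edge_set G"
    then obtain e0 where e0: "e = f ` e0" "e0 \<in> edge_set G" by blast
    show "Path_Connected.arc (\<gamma> (?i ` e))" "{pathstart (\<gamma> (?i ` e)), pathfinish (\<gamma> (?i ` e))} = (p \<circ> ?i) ` e"
      unfolding e0(1) i2 i3 using pl e0(2) by simp_all
    have V: "(p \<circ> ?i) ` pverts (map_graph f G) = p ` pverts G" unfolding map_graph_def by (simp only: pair_pre_digraph.simps i2)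
    show "path_image (\<gamma> (?i ` e)) \<inter> (p \<circ> ?i) ` pverts (map_graph f G) = (p \<circ> ?i) ` e"
      unfolding e0(1) V i2 i3 using pl e0(2) by simp
    fix e' assume "e' \<in> image f ` edge_set G" and ne: "e \<noteq> e'"
    then obtain e1 where e1: "e' = f ` e1" "e1 \<in> edge_set G" by blast
    have "e0 \<noteq> e1" using ne e0 e1 by blast
    then show "path_image (\<gamma> (?i ` e)) \<inter> path_image (\<gamma> (?i ` e')) \<subseteq> (p \<circ> ?i) ` (e \<inter> e')"
      unfolding e0(1) e1(1) i3 i4 i2 using pl e0(2) e1(2) by simp
  qed
  then show ?thesis unfolding planar_graph_def by blast
qed

lemma realizes_map_graph:
  assumes "realizes \<C> (map_graph f G)" shows "realizes \<C> G"
proof -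
  from assms obtain \<phi> \<psi> where R: "circle_system \<C>" "bij_betw \<phi> (f ` pverts G) (contact_points \<C>)"
    "bij_betw \<psi> (image f ` edge_set G) (contact_arcs \<C>)" "\<forall>e \<in> edge_set G. \<psi> (f ` e) \<inter> contact_points \<C> = \<phi> ` (f ` e)"
    unfolding realizes_def edge_set_map_graph by (auto simp: map_graph_def)
  have "bij_betw f (pverts G) (f ` pverts G)" using f by (auto simp: bij_betw_def dest: inj_on_subset)
  then have 1: "bij_betw (\<phi> \<circ> f) (pverts G) (contact_points \<C>)" using R(2) bij_betw_trans by blast
  have "inj_on (image f) (edge_set G)" using f by (meson inj_image_eq_iff inj_onI)
  then have "bij_betw (image f) (edge_set G) (image f ` edge_set G)" by (auto simp: bij_betw_def)
  then have 2: "bij_betw (\<psi> \<circ> image f) (edge_set G) (contact_arcs \<C>)" using R(3) bij_betw_trans by blast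
  show ?thesis unfolding realizes_def using R 1 2 by (intro conjI exI[of _ "\<phi> \<circ> f"] exI[of _ "\<psi> \<circ> image f"]) (auto simp: image_comp)
qed

lemma connected_map_graph:
  assumes r: "r \<in> pverts G" "\<And>u. u \<in> pverts G \<Longrightarrow> (u, r) \<in> (parcs G)\<^sup>*"
  shows "Digraph_Component.connected (with_proj (map_graph f G))"
proof -
  interpret H: pair_graph "map_graph f G" by (rule pair_graph_map_graph)
  have img: "(f u, f v) \<in> (parcs (map_graph f G))\<^sup>*" if "(u, v) \<in> (parcs G)\<^sup>*" for u v
    using that by (induction rule: rtrancl_induct) (auto intro: rtrancl_into_rtrancl simp: arc_map_graph)
  have "sym (parcs G)" using pair_sym_arcs unfolding symmetric_def with_proj_simps .
  then have "(r, u) \<in> (parcs G)\<^sup>*" if "u \<in> pverts G" for u using r(2)[OF that] by (metis sym_rtrancl symD)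
  then have all: "(u, v) \<in> (parcs (map_graph f G))\<^sup>*" if "u \<in> pverts (map_graph f G)" "v \<in> pverts (map_graph f G)" for u v
    using that r(2) img by (auto simp: map_graph_def) (meson img rtrancl_trans)
  have "pverts (map_graph f G) \<noteq> {}" using r by (auto simp: map_graph_def)
  then show ?thesis
    by (intro H.connectedI H.reachable_mk_symmetricI) (use all in \<open>auto simp: H.reachable_conv\<close>)
qed

end

text \<open>The number of vertices is the invariant that tells the graphs of the class apart, since
  it grows strictly with \<open>N\<close>.\<close>

lemma digraph_iso_card_verts:
  assumes "digraph_iso G H" shows "card (verts G) = card (verts H)"
proof -
  obtain h where h: "pre_digraph.digraph_isomorphism G h" "H = app_iso h G" using assms by (auto simp: digraph_iso_def)
  then have "inj_on (iso_verts h) (verts G)" by (simp add: pre_digraph.digraph_isomorphism_def)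
  then show ?thesis using h by (simp add: verts_app_iso card_image)
qed

instance gadget :: countable by countable_datatype
instance vtx :: countable by countable_datatype

lemma card_lverts_mono: "N < N' \<Longrightarrow> card (lverts N) < card (lverts N')"
proof (rule psubset_card_mono[OF finite_lverts])
  assume "N < N'"
  moreover have "Pt False False (Suc N') \<in> lverts N' - lverts N" using calculation by simp
  moreover have "lverts N \<subseteq> lverts N'"
  proof
    fix v assume "v \<in> lverts N"
    moreover have "gadgets N \<subseteq> gadgets N'" using \<open>N < N'\<close> by (auto simp: gadgets_def)
    ultimately show "v \<in> lverts N'" using \<open>N < N'\<close> by (cases v) auto
  qed
  ultimately show "lverts N \<subset> lverts N'" by blast
qed


theorem theorem4:
  shows "\<exists>\<G> :: nat pair_pre_digraph set.
    infinite \<G> \<and>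
    (\<forall>G \<in> \<G>. \<forall>H \<in> \<G>. G \<noteq> H \<longrightarrow> \<not> digraph_iso (with_proj G) (with_proj H)) \<and>
    (\<forall>G \<in> \<G>.
       pair_graph G \<and>
       Digraph_Component.connected (with_proj G) \<and>
       regular_graph 4 G \<and>
       planar_graph G \<and>
       \<not> (\<exists>\<C>. realizes \<C> G))"
proof -
  define T :: "nat \<Rightarrow> nat pair_pre_digraph" where "T N = map_graph to_nat (ladder N)" for N
  have inj: "inj (to_nat :: vtx \<Rightarrow> nat)" by simp
  have card: "card (verts (with_proj (T N))) = card (lverts N)" for N
    unfolding T_def map_graph_def by (simp add: card_image inj_on_subset[OF inj])
  have iso: "N = N'" if "digraph_iso (with_proj (T N)) (with_proj (T N'))" for N N'
    using digraph_iso_card_verts[OF that] card_lverts_mono[of N N'] card_lverts_mono[of N' N] card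
    by (metis linorder_neqE_nat less_irrefl)
  \<comment> \<open>Different numbers of vertices also make the graphs themselves different, so the
    class is infinite.\<close>
  have "inj_on T {20<..}" using card card_lverts_mono by (metis inj_onI linorder_neqE_nat less_irrefl)
  then have "infinite (T ` {20<..})" using finite_imageD infinite_Ioi by blast
  moreover have "\<forall>G \<in> T ` {20<..}. \<forall>H \<in> T ` {20<..}. G \<noteq> H \<longrightarrow> \<not> digraph_iso (with_proj G) (with_proj H)"
    using iso by blast
  moreover have "\<forall>G \<in> T ` {20<..}. pair_graph G \<and> Digraph_Component.connected (with_proj G) \<and>
      regular_graph 4 G \<and> planar_graph G \<and> \<not> (\<exists>\<C>. realizes \<C> G)"
  proof
    fix G assume "G \<in> T ` {20<..}"
    then obtain N where N: "20 < N" "G = map_graph to_nat (ladder N)" by (auto simp: T_def)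
    note L = inj pair_graph_ladder[of N]
    show "pair_graph G \<and> Digraph_Component.connected (with_proj G) \<and>
      regular_graph 4 G \<and> planar_graph G \<and> \<not> (\<exists>\<C>. realizes \<C> G)"
      unfolding N(2)
      using pair_graph_map_graph[OF L] connected_map_graph[OF L, of "Pole False"] reaches_pole[of _ N]
        regular_map_graph[OF L regular_ladder] planar_map_graph[OF L planar_ladder] realizes_map_graph[OF L]
        ladder_not_realizable[OF N(1)] N(1) by auto
  qed
  ultimately show ?thesis by blast
qed

end
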